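(* Fix $0<\varepsilon<1/64$, and fix $k_0\in\mathbb N$ depending only on $\varepsilon$ such that $2^{-k}<\varepsilon/4$ for all $k\ge k_0$. There exists $C_3>0$ independent of $k$ such that for every $k\ge k_0$, all $x,y\in E^k$ and all $t>0$, $$p_k(t,x,y)\le\begin{cases}C_3\left(\frac1t\vee\frac1{\sqrt t}\right)e^{-d_k(x,y)^2/(32t)}, & \text{when } d_k(x,y)\le 16\cdot2^kt;\\[2mm] C_3\left(\frac1t\vee\frac1{\sqrt t}\right)e^{-2^kd_k(x,y)/2}, & \text{when } d_k(x,y)\ge 16\cdot 2^kt.\end{cases}$$ In particular, given any $T>0$, there exists $C_4>0$, independent of $k$, such that for all $k\ge k_0$ $$p_k(t,x,y)\le\frac{C_4}t\left(e^{-d_k(x,y)^2/(32t)}+e^{-2^kd_k(x,y)/2}\right)\quad\text{for all }(t,x,y)\in(0,T]\times E^k\times E^k.$$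
   Context: Let $B_\varepsilon$ be the closed disk in $\mathbb R^2$ centered at the origin with radius $\varepsilon$ and $D_\varepsilon:=\mathbb R^2\setminus B_\varepsilon$. For $k\in\mathbb N$ let $D^k_\varepsilon:=D_\varepsilon\cap 2^{-k}\mathbb Z^2$; the vertices of $2^{-k}\mathbb Z^2$ in $B_\varepsilon$ are identified with a single point $a^*_k$. Let $E^k:=2^{-k}\mathbb Z_+\cup\{a^*_k\}\cup D^k_\varepsilon$, $\mathbb Z_+=\{1,2,\dots\}$; the point $0$ of the lattice $2^{-k}\mathbb Z_+\cup\{0\}$ is identified with $a^*_k$. The graph $G^k$ has vertex set $E^k$ and the following unoriented edges (at most one per pair of vertices): between $x,y\in D^k_\varepsilon$ with $|x-y|=2^{-k}$ whose connecting lattice segment is disjoint from $B_\varepsilon$; between nearest neighbors of $2^{-k}\mathbb Z_+\cup\{0\}$; and between $x\in D^k_\varepsilon$ and $a^*_k$ whenever there is $y\in 2^{-k}\mathbb Z^2\cap B_\varepsilon$ with $|x-y|=2^{-k}$. Write $x\leftrightarrow y$ for adjacency and $v_k(x)$ for the number of vertices adjacent to $x$ in $G^k$. Let $m_k(x)=\frac{2^{-2k}}4v_k(x)$ for $x\in D^k_\varepsilon$, $m_k(x)=\frac{2^{-k}}2v_k(x)$ for $x\in2^{-k}\mathbb Z_+$, $m_k(a^*_k)=\frac{2^{-k}}2+\frac{2^{-2k}}4(v_k(a^*_k)-1)$. $X^k$ is the $m_k$-symmetric continuous-time Markov chain on $E^k$ associated with the regular Dirichlet form on $L^2(E^k,m_k)$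 with domain $L^2(E^k,m_k)$ and $$\mathcal E^k(f,f)=\frac18\sum_{(x,y)}(f(x)-f(y))^2+\frac{2^k}4\sum_{(x,y)}{}'(f(x)-f(y))^2,$$ where the first sum is over oriented edges of $G^k$ with both endpoints in $D^k_\varepsilon\cup\{a^*_k\}$ and the second (primed) sum over oriented edges with both endpoints in $2^{-k}\mathbb Z_+\cup\{a^*_k\}$ (each unoriented edge is counted twice). Equivalently, $X^k$ waits at each vertex an exponential time with parameter $2^{2k}$ and then jumps from $x\ne a^*_k$ to a uniformly chosen adjacent vertex, and from $a_k^*$ to each adjacent $y\in D^k_\varepsilon$ with probability $1/(v_k(a^*_k)+2^{k+1}-1)$ and to the adjacent $y\in2^{-k}\mathbb Z_+$ with probability $2^{k+1}/(v_k(a^*_k)+2^{k+1}-1)$. $p_k(t,x,y)$ is the transition density of $X^k$ with respect to $m_k$, i.e. $\mathbb P^x[X^k_t=y]=p_k(t,x,y)m_k(y)$. $d_k(x,y):=2^{-k}\times$ (number of edges along a shortest path between $x$ and $y$ in $G^k$). $a\vee b=\max\{a,b\}$. *)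

theory Defs
  imports "HOL-Probability.Probability"
begin

text \<open>
  The vertices are encoded by integer coordinates: \<open>Plane (i, j)\<close> is the point \<open>(i / 2 ^ k, j / 2 ^ k)\<close>
  of the scaled planar lattice, \<open>Leg n\<close> is the point \<open>n / 2 ^ k\<close> of the scaled half-line lattice
  (a vertex only for \<open>n \<ge> 1\<close>), and \<open>Star\<close> is the vertex obtained by collapsing all planar lattice
  points in the closed disk of radius \<open>\<epsilon>\<close>, glued to the origin of the half-line. The vertex type is
  countable, which the measurability of the jump chain below relies on.
\<close>

datatype vertex = Star | Leg nat | Plane "int \<times> int"

instance vertex :: countable
  by countable_datatype

definition plane_pt :: "nat \<Rightarrow> int \<times> int \<Rightarrow> real \<times> real" where
  "plane_pt k u = (of_int (fst u) / 2 ^ k, of_int (snd u) / 2 ^ k)"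

definition plane_verts :: "real \<Rightarrow> nat \<Rightarrow> (int \<times> int) set" where
  "plane_verts \<epsilon> k = {u. plane_pt k u \<notin> cball 0 \<epsilon>}"

definition vertices :: "real \<Rightarrow> nat \<Rightarrow> vertex set" where
  "vertices \<epsilon> k = insert Star (Leg ` {1..} \<union> Plane ` plane_verts \<epsilon> k)"

definition touches_disk :: "real \<Rightarrow> nat \<Rightarrow> int \<times> int \<Rightarrow> bool" where
  "touches_disk \<epsilon> k u \<longleftrightarrow> u \<in> plane_verts \<epsilon> k \<and>
     (\<exists>w. plane_pt k w \<in> cball 0 \<epsilon> \<and> dist (plane_pt k u) (plane_pt k w) = 1 / 2 ^ k)"

fun adj :: "real \<Rightarrow> nat \<Rightarrow> vertex \<Rightarrow> vertex \<Rightarrow> bool" where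
  "adj \<epsilon> k (Plane u) (Plane w) \<longleftrightarrow> u \<in> plane_verts \<epsilon> k \<and> w \<in> plane_verts \<epsilon> k \<and>
     dist (plane_pt k u) (plane_pt k w) = 1 / 2 ^ k \<and>
     closed_segment (plane_pt k u) (plane_pt k w) \<inter> cball 0 \<epsilon> = {}"
| "adj \<epsilon> k (Plane u) Star \<longleftrightarrow> touches_disk \<epsilon> k u"
| "adj \<epsilon> k Star (Plane u) \<longleftrightarrow> touches_disk \<epsilon> k u"
| "adj \<epsilon> k (Leg m) (Leg n) \<longleftrightarrow> m \<ge> 1 \<and> n \<ge> 1 \<and> (n = Suc m \<or> m = Suc n)"
| "adj \<epsilon> k (Leg n) Star \<longleftrightarrow> n = 1"
| "adj \<epsilon> k Star (Leg n) \<longleftrightarrow> n = 1"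
| "adj \<epsilon> k _ _ \<longleftrightarrow> False"

definition num_nbrs :: "real \<Rightarrow> nat \<Rightarrow> vertex \<Rightarrow> nat" where
  "num_nbrs \<epsilon> k x = card {y. adj \<epsilon> k x y}"

definition graph_dist :: "real \<Rightarrow> nat \<Rightarrow> vertex \<Rightarrow> vertex \<Rightarrow> real" where
  "graph_dist \<epsilon> k x y = real (LEAST n. (x, y) \<in> {(a, b). adj \<epsilon> k a b} ^^ n) / 2 ^ k"

fun mass :: "real \<Rightarrow> nat \<Rightarrow> vertex \<Rightarrow> real" where
  "mass \<epsilon> k (Plane u) = (1 / 2 ^ (2 * k)) / 4 * real (num_nbrs \<epsilon> k (Plane u))"
| "mass \<epsilon> k (Leg n) = (1 / 2 ^ k) / 2 * real (num_nbrs \<epsilon> k (Leg n))"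
| "mass \<epsilon> k Star = (1 / 2 ^ k) / 2 + (1 / 2 ^ (2 * k)) / 4 * (real (num_nbrs \<epsilon> k Star) - 1)"

definition jump_prob :: "real \<Rightarrow> nat \<Rightarrow> vertex \<Rightarrow> vertex \<Rightarrow> real" where
  "jump_prob \<epsilon> k x y =
     (if \<not> adj \<epsilon> k x y then 0
      else if x = Star
      then (if y = Leg 1 then 2 ^ (k + 1) else 1) / (real (num_nbrs \<epsilon> k Star) + 2 ^ (k + 1) - 1)
      else 1 / real (num_nbrs \<epsilon> k x))"

text \<open>
  For vertices \<open>x\<close> the embedding into \<open>pmf\<close> is legitimate, see \<open>pmf_jump\<close> below; elsewhere the
  value is irrelevant.
\<close>

definition jump :: "real \<Rightarrow> nat \<Rightarrow> vertex \<Rightarrow> vertex pmf" where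
  "jump \<epsilon> k x = embed_pmf (jump_prob \<epsilon> k x)"

text \<open>
  The chain started at \<open>x\<close> is realised on the product of two spaces: independent jump instructions
  \<open>\<xi> (n, z)\<close>, the position after jump \<open>n + 1\<close> if the position before it is \<open>z\<close>, and independent
  exponential holding times \<open>\<tau> n\<close> of rate \<open>2 ^ (2 * k)\<close>.
\<close>

definition chain_space :: "real \<Rightarrow> nat \<Rightarrow> ((nat \<times> vertex \<Rightarrow> vertex) \<times> (nat \<Rightarrow> real)) measure" where
  "chain_space \<epsilon> k =
     (\<Pi>\<^sub>M (n, z)\<in>UNIV. measure_pmf (jump \<epsilon> k z)) \<Otimes>\<^sub>M
     (\<Pi>\<^sub>M n\<in>UNIV. density lborel (exponential_density (2 ^ (2 * k))))"

primrec jump_chain :: "vertex \<Rightarrow> (nat \<times> vertex \<Rightarrow> vertex) \<Rightarrow> nat \<Rightarrow> vertex" where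
  "jump_chain x \<xi> 0 = x"
| "jump_chain x \<xi> (Suc n) = \<xi> (n, jump_chain x \<xi> n)"

definition num_jumps :: "(nat \<Rightarrow> real) \<Rightarrow> real \<Rightarrow> nat" where
  "num_jumps \<tau> t = (LEAST n. t < (\<Sum>i\<le>n. \<tau> i))"

definition chain :: "vertex \<Rightarrow> real \<Rightarrow> (nat \<times> vertex \<Rightarrow> vertex) \<times> (nat \<Rightarrow> real) \<Rightarrow> vertex" where
  "chain x t \<omega> = jump_chain x (fst \<omega>) (num_jumps (snd \<omega>) t)"

definition trans_density :: "real \<Rightarrow> nat \<Rightarrow> real \<Rightarrow> vertex \<Rightarrow> vertex \<Rightarrow> real" where
  "trans_density \<epsilon> k t x y =
     measure (chain_space \<epsilon> k) {\<omega> \<in> space (chain_space \<epsilon> k). chain x t \<omega> = y} / mass \<epsilon> k y"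

text \<open>
  The Dirichlet form, which the theorem \<open>energy_eq_generator\<close> below identifies on all of
  \<open>L\<^sup>2\<close> with the form of the (bounded, symmetric) generator of the chain.
\<close>

definition energy :: "real \<Rightarrow> nat \<Rightarrow> (vertex \<Rightarrow> real) \<Rightarrow> real" where
  "energy \<epsilon> k f =
     1 / 8 * (\<Sum>\<^sub>\<infinity>(x, y)\<in>{(x, y). adj \<epsilon> k x y \<and> {x, y} \<subseteq> insert Star (range Plane)}. (f x - f y)\<^sup>2) +
     2 ^ k / 4 * (\<Sum>\<^sub>\<infinity>(x, y)\<in>{(x, y). adj \<epsilon> k x y \<and> {x, y} \<subseteq> insert Star (range Leg)}. (f x - f y)\<^sup>2)"

definition generator :: "real \<Rightarrow> nat \<Rightarrow> (vertex \<Rightarrow> real) \<Rightarrow> vertex \<Rightarrow> real" where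
  "generator \<epsilon> k f x = 2 ^ (2 * k) * (measure_pmf.expectation (jump \<epsilon> k x) f - f x)"


lemma adj_sym: "adj \<epsilon> k x y \<Longrightarrow> adj \<epsilon> k y x"
  by (cases x; cases y) (auto simp: dist_commute closed_segment_commute)

lemma adj_in_vertices: "adj \<epsilon> k x y \<Longrightarrow> x \<in> vertices \<epsilon> k"
  by (cases x; cases y) (auto simp: vertices_def touches_disk_def)

lemma norm_plane_pt_ge: "\<bar>real_of_int (fst u)\<bar> / 2 ^ k \<le> norm (plane_pt k u)"
  "\<bar>real_of_int (snd u)\<bar> / 2 ^ k \<le> norm (plane_pt k u)"
  using norm_fst_le[of "fst (plane_pt k u)" "snd (plane_pt k u)"]
    norm_snd_le[of "snd (plane_pt k u)" "fst (plane_pt k u)"]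
  by (auto simp: plane_pt_def)

lemma finite_bounded_plane: "finite {u. norm (plane_pt k u) \<le> r}"
proof (rule finite_subset)
  let ?N = "\<lceil>r * 2 ^ k\<rceil>"
  show "{u. norm (plane_pt k u) \<le> r} \<subseteq> {-?N..?N} \<times> {-?N..?N}"
  proof safe
    fix a b :: int
    assume "norm (plane_pt k (a, b)) \<le> r"
    then have "\<bar>real_of_int a\<bar> / 2 ^ k \<le> r" "\<bar>real_of_int b\<bar> / 2 ^ k \<le> r"
      using norm_plane_pt_ge[of "(a, b)" k] by auto
    then have "\<bar>real_of_int a\<bar> \<le> r * 2 ^ k" "\<bar>real_of_int b\<bar> \<le> r * 2 ^ k"
      by (auto simp: field_simps)
    then have "\<bar>a\<bar> \<le> ?N" "\<bar>b\<bar> \<le> ?N"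
      by linarith+
    then show "a \<in> {-?N..?N}" "b \<in> {-?N..?N}"
      by auto
  qed
qed auto

lemma finite_neighbours: "finite {y. adj \<epsilon> k x y}"
proof -
  have *: "{y. adj \<epsilon> k x y} \<subseteq> insert Star (Leg ` {n. adj \<epsilon> k x (Leg n)} \<union> Plane ` {u. adj \<epsilon> k x (Plane u)})"
  proof
    fix y assume "y \<in> {y. adj \<epsilon> k x y}"
    then show "y \<in> insert Star (Leg ` {n. adj \<epsilon> k x (Leg n)} \<union> Plane ` {u. adj \<epsilon> k x (Plane u)})"
      by (cases y) auto
  qed
  have "finite {n. adj \<epsilon> k x (Leg n)}"
  proof (cases x)
    case (Leg m)
    then have "{n. adj \<epsilon> k x (Leg n)} \<subseteq> {..Suc m}" by auto
    then show ?thesis using finite_subset by blast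
  next
    case Star
    then have "{n. adj \<epsilon> k x (Leg n)} \<subseteq> {1}" by auto
    then show ?thesis using finite_subset by blast
  qed auto
  moreover have "finite {u. adj \<epsilon> k x (Plane u)}"
  proof (cases x)
    case Star
    have "{u. adj \<epsilon> k x (Plane u)} \<subseteq> {u. norm (plane_pt k u) \<le> \<epsilon> + 1 / 2 ^ k}"
    proof safe
      fix u1 u2 assume "adj \<epsilon> k x (Plane (u1, u2))"
      then obtain w where w: "norm (plane_pt k w) \<le> \<epsilon>" "dist (plane_pt k (u1, u2)) (plane_pt k w) = 1 / 2 ^ k"
        using Star by (auto simp: touches_disk_def)
      then show "norm (plane_pt k (u1, u2)) \<le> \<epsilon> + 1 / 2 ^ k"
        using norm_triangle_sub[of "plane_pt k (u1, u2)" "plane_pt k w"] by (simp add: dist_norm)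
    qed
    then show ?thesis using finite_bounded_plane finite_subset by blast
  next
    case (Plane w)
    have "{u. adj \<epsilon> k x (Plane u)} \<subseteq> {u. norm (plane_pt k u) \<le> norm (plane_pt k w) + 1 / 2 ^ k}"
    proof safe
      fix u1 u2 assume "adj \<epsilon> k x (Plane (u1, u2))"
      then have "dist (plane_pt k (u1, u2)) (plane_pt k w) = 1 / 2 ^ k"
        using Plane by (auto simp: dist_commute)
      then show "norm (plane_pt k (u1, u2)) \<le> norm (plane_pt k w) + 1 / 2 ^ k"
        using norm_triangle_sub[of "plane_pt k (u1, u2)" "plane_pt k w"] by (simp add: dist_norm)
    qed
    then show ?thesis using finite_bounded_plane finite_subset by blast
  qed auto
  ultimately show ?thesis
    using finite_subset[OF *] by simp
qed

lemma outward_neighbour: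
  assumes "u \<in> plane_verts \<epsilon> k"
  shows "\<exists>w. adj \<epsilon> k (Plane u) (Plane w)"
proof -
  obtain a b where u: "u = (a, b)" by (cases u)
  define s :: int where "s = (if a \<ge> 0 then 1 else -1)"
  have s: "\<bar>s\<bar> = 1" "real_of_int a * real_of_int s \<ge> 0"
    by (auto simp: s_def)
  define w where "w = (a + s, b)"
  have diff: "plane_pt k w - plane_pt k u = (of_int s / 2 ^ k, 0)"
    by (simp add: plane_pt_def w_def u add_divide_distrib)
  have d: "dist (plane_pt k u) (plane_pt k w) = 1 / 2 ^ k"
  proof -
    have "dist (plane_pt k u) (plane_pt k w) = norm (plane_pt k w - plane_pt k u)"
      by (metis dist_commute dist_norm)
    then show ?thesis
      unfolding diff by (simp add: norm_Pair s_def)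
  qed
  have big: "norm z > \<epsilon>" if z: "z \<in> closed_segment (plane_pt k u) (plane_pt k w)" for z
  proof -
    from z obtain c where c: "0 \<le> c" "z = plane_pt k u + c *\<^sub>R (plane_pt k w - plane_pt k u)"
      by (auto simp: closed_segment_def algebra_simps)
    have z: "z = ((of_int a + c * of_int s) / 2 ^ k, of_int b / 2 ^ k)"
      unfolding c(2) diff by (simp add: plane_pt_def u add_divide_distrib)
    have "\<bar>real_of_int a\<bar> \<le> \<bar>of_int a + c * of_int s\<bar>"
      using c(1) by (auto simp: s_def)
    then have "\<bar>real_of_int a / 2 ^ k\<bar> \<le> \<bar>(of_int a + c * of_int s) / 2 ^ k\<bar>"
      by (simp add: divide_right_mono)
    then have "(real_of_int a / 2 ^ k)\<^sup>2 \<le> ((of_int a + c * of_int s) / 2 ^ k)\<^sup>2"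
      by (metis abs_le_square_iff)
    then have "norm (plane_pt k u) \<le> norm z"
      unfolding z plane_pt_def u norm_Pair real_norm_def power2_abs fst_conv snd_conv
      by (rule real_sqrt_le_mono[OF add_right_mono])
    moreover have "norm (plane_pt k u) > \<epsilon>"
      using assms by (simp add: plane_verts_def)
    ultimately show ?thesis by linarith
  qed
  have "w \<in> plane_verts \<epsilon> k"
    using big[of "plane_pt k w"] by (simp add: plane_verts_def)
  moreover have "closed_segment (plane_pt k u) (plane_pt k w) \<inter> cball 0 \<epsilon> = {}"
    using big by force
  ultimately have "adj \<epsilon> k (Plane u) (Plane w)"
    using assms d by simp
  then show ?thesis by blast
qed

lemma num_nbrs_pos:
  assumes "x \<in> vertices \<epsilon> k"
  shows "num_nbrs \<epsilon> k x > 0"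
proof -
  have "{y. adj \<epsilon> k x y} \<noteq> {}"
  proof (cases x)
    case Star
    then have "adj \<epsilon> k x (Leg 1)" by simp
    then show ?thesis by blast
  next
    case (Leg n)
    then have "adj \<epsilon> k x (Leg (Suc n))" using assms by (auto simp: vertices_def)
    then show ?thesis by blast
  next
    case (Plane u)
    then obtain w where "adj \<epsilon> k x (Plane w)"
      using assms outward_neighbour[of u \<epsilon> k] by (auto simp: vertices_def simp del: adj.simps)
    then show ?thesis by blast
  qed
  then show ?thesis
    using finite_neighbours by (simp add: num_nbrs_def card_gt_0_iff)
qed

lemma jump_prob_nonneg: "jump_prob \<epsilon> k x y \<ge> 0"
proof -
  have "(1::real) \<le> 2 ^ (k + 1)"
    by (rule one_le_power) simp
  then have "real (num_nbrs \<epsilon> k Star) + 2 ^ (k + 1) - 1 \<ge> 0"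
    by linarith
  then show ?thesis
    by (auto simp: jump_prob_def intro!: divide_nonneg_nonneg)
qed

lemma sum_jump_prob:
  assumes "x \<in> vertices \<epsilon> k"
  shows "(\<Sum>y | adj \<epsilon> k x y. jump_prob \<epsilon> k x y) = 1"
proof (cases "x = Star")
  case False
  then show ?thesis
    using num_nbrs_pos[OF assms] by (simp add: jump_prob_def flip: num_nbrs_def)
next
  case True
  let ?A = "{y. adj \<epsilon> k Star y}"
  have A: "Leg 1 \<in> ?A" by simp
  have "(\<Sum>y\<in>?A. if y = Leg 1 then 2 ^ (k + 1) else 1 :: real)
      = 2 ^ (k + 1) + (\<Sum>y\<in>?A - {Leg 1}. if y = Leg 1 then 2 ^ (k + 1) else 1)"
    by (subst sum.remove[OF finite_neighbours A]) simp
  also have "(\<Sum>y\<in>?A - {Leg 1}. if y = Leg 1 then 2 ^ (k + 1) else 1 :: real) = real (card (?A - {Leg 1}))"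
    by simp
  also have "\<dots> = real (num_nbrs \<epsilon> k Star) - 1"
    using num_nbrs_pos[OF assms] card_Diff_singleton[OF A] True by (simp add: num_nbrs_def of_nat_diff)
  finally have *: "(\<Sum>y\<in>?A. if y = Leg 1 then 2 ^ (k + 1) else 1 :: real)
      = real (num_nbrs \<epsilon> k Star) + 2 ^ (k + 1) - 1"
    by simp
  have "(1::real) \<le> 2 ^ (k + 1)"
    by (rule one_le_power) simp
  then have nz: "real (num_nbrs \<epsilon> k Star) + 2 ^ (k + 1) - 1 > 0"
    using num_nbrs_pos[OF assms] True by simp
  have "(\<Sum>y\<in>?A. jump_prob \<epsilon> k Star y) =
      (\<Sum>y\<in>?A. (if y = Leg 1 then 2 ^ (k + 1) else 1) / (real (num_nbrs \<epsilon> k Star) + 2 ^ (k + 1) - 1))"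
    by (intro sum.cong) (simp_all add: jump_prob_def)
  also have "\<dots> = 1"
    using nz by (simp only: * flip: sum_divide_distrib) simp
  finally show ?thesis using True by simp
qed

lemma pmf_jump:
  assumes "x \<in> vertices \<epsilon> k"
  shows "pmf (jump \<epsilon> k x) y = jump_prob \<epsilon> k x y"
  unfolding jump_def
proof (rule pmf_embed_pmf)
  have "(\<integral>\<^sup>+ y. ennreal (jump_prob \<epsilon> k x y) \<partial>count_space UNIV)
      = (\<Sum>y | adj \<epsilon> k x y. ennreal (jump_prob \<epsilon> k x y))"
    by (rule nn_integral_count_space'[OF finite_neighbours]) (auto simp: jump_prob_def)
  also have "\<dots> = 1"
    using sum_jump_prob[OF assms] by (simp add: jump_prob_nonneg)
  finally show "(\<integral>\<^sup>+ y. ennreal (jump_prob \<epsilon> k x y) \<partial>count_space UNIV) = 1" .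
qed (rule jump_prob_nonneg)

lemma mass_pos:
  assumes "x \<in> vertices \<epsilon> k"
  shows "mass \<epsilon> k x > 0"
  using num_nbrs_pos[OF assms] by (cases x) (auto intro!: add_pos_nonneg)

definition conductance :: "real \<Rightarrow> nat \<Rightarrow> vertex \<Rightarrow> vertex \<Rightarrow> real" where
  "conductance \<epsilon> k x y =
     (if \<not> adj \<epsilon> k x y then 0 else if x \<in> range Leg \<or> y \<in> range Leg then 2 ^ k / 2 else 1 / 4)"

lemma conductance_nonneg: "conductance \<epsilon> k x y \<ge> 0"
  by (auto simp: conductance_def)

lemma conductance_sym: "conductance \<epsilon> k x y = conductance \<epsilon> k y x"
  using adj_sym by (auto simp: conductance_def)

lemma mass_jump_prob: "2 ^ (2 * k) * mass \<epsilon> k x * jump_prob \<epsilon> k x y = conductance \<epsilon> k x y"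
proof (cases "adj \<epsilon> k x y")
  case True
  have d: "num_nbrs \<epsilon> k x > 0"
    using num_nbrs_pos adj_in_vertices[OF True] by blast
  show ?thesis
  proof (cases x)
    case Star
    define Z where "Z = real (num_nbrs \<epsilon> k Star) + 2 ^ (k + 1) - 1"
    have "(1::real) \<le> 2 ^ (k + 1)"
      by (rule one_le_power) simp
    then have Z: "Z > 0"
      using d Star by (simp add: Z_def)
    have "2 ^ (2 * k) * mass \<epsilon> k x = Z / 4"
      using Star by (simp add: Z_def field_simps power_mult power2_eq_square power_mult_distrib
          flip: power_mult_distrib)
    moreover have "jump_prob \<epsilon> k x y = (if y = Leg 1 then 2 ^ (k + 1) else 1) / Z"
      using True Star by (simp add: jump_prob_def Z_def)
    ultimately show ?thesis
      using True Star Z by (cases y) (auto simp: conductance_def)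
  next
    case (Leg n)
    then show ?thesis
      using True d by (simp add: conductance_def jump_prob_def field_simps power_mult power2_eq_square
          flip: power_mult_distrib)
  next
    case (Plane u)
    then show ?thesis
      using True d by (cases y) (auto simp: conductance_def jump_prob_def field_simps)
  qed
qed (simp add: jump_prob_def conductance_def)

theorem mass_jump_prob_symmetric:
  "mass \<epsilon> k x * jump_prob \<epsilon> k x y = mass \<epsilon> k y * jump_prob \<epsilon> k y x"
proof -
  have "2 ^ (2 * k) * (mass \<epsilon> k x * jump_prob \<epsilon> k x y) = 2 ^ (2 * k) * (mass \<epsilon> k y * jump_prob \<epsilon> k y x)"
    using mass_jump_prob[of k \<epsilon> x y] mass_jump_prob[of k \<epsilon> y x] conductance_sym[of \<epsilon> k x y]
    by (simp add: mult.assoc)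
  then show ?thesis by simp
qed

lemma generator_eq_sum:
  assumes "x \<in> vertices \<epsilon> k"
  shows "mass \<epsilon> k x * generator \<epsilon> k f x = (\<Sum>y | adj \<epsilon> k x y. conductance \<epsilon> k x y * (f y - f x))"
proof -
  have "measure_pmf.expectation (jump \<epsilon> k x) f
      = (\<Sum>y | adj \<epsilon> k x y. pmf (jump \<epsilon> k x) y *\<^sub>R f y)"
    by (rule integral_measure_pmf[OF finite_neighbours])
      (use assms in \<open>auto simp: set_pmf_eq pmf_jump jump_prob_def split: if_splits\<close>)
  also have "\<dots> - f x = (\<Sum>y | adj \<epsilon> k x y. jump_prob \<epsilon> k x y * (f y - f x))"
    using sum_jump_prob[OF assms]
    by (simp add: pmf_jump[OF assms] right_diff_distrib sum_subtractf flip: sum_distrib_right)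
  finally show ?thesis
    by (simp add: generator_def sum_distrib_left mult.assoc flip: mass_jump_prob)
      (simp add: mult_ac)
qed

lemma sum_conductance:
  assumes "x \<in> vertices \<epsilon> k"
  shows "(\<Sum>y | adj \<epsilon> k x y. conductance \<epsilon> k x y) = 2 ^ (2 * k) * mass \<epsilon> k x"
  using sum_jump_prob[OF assms] by (simp flip: mass_jump_prob sum_distrib_left)

theorem energy_eq_generator:
  assumes "(\<lambda>x. (f x)\<^sup>2 * mass \<epsilon> k x) summable_on vertices \<epsilon> k"
  shows "energy \<epsilon> k f = (\<Sum>\<^sub>\<infinity>x\<in>vertices \<epsilon> k. - generator \<epsilon> k f x * f x * mass \<epsilon> k x)"
proof -
  define c where "c = conductance \<epsilon> k"
  let ?V = "vertices \<epsilon> k" and ?N = "\<lambda>x. {y. adj \<epsilon> k x y}"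
  let ?A = "{(x, y). adj \<epsilon> k x y}"
  have A: "?A = Sigma ?V ?N"
    using adj_in_vertices by auto
  have c0: "c x y \<ge> 0" and csym: "c x y = c y x" for x y
    by (simp_all add: c_def conductance_nonneg conductance_sym)
  define h1 where "h1 = (\<lambda>(x, y). c x y * (f x)\<^sup>2)"
  define h2 where "h2 = (\<lambda>(x, y). c x y * (f y)\<^sup>2)"
  define h3 where "h3 = (\<lambda>(x, y). c x y * (f x * f y))"
  have s1: "h1 summable_on ?A"
    unfolding A
  proof (rule summable_on_SigmaI)
    fix x assume x: "x \<in> ?V"
    have "(\<Sum>y\<in>?N x. h1 (x, y)) = 2 ^ (2 * k) * ((f x)\<^sup>2 * mass \<epsilon> k x)"
      using sum_conductance[OF x] by (simp add: h1_def c_def flip: sum_distrib_right)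
    then show "((\<lambda>y. h1 (x, y)) has_sum 2 ^ (2 * k) * ((f x)\<^sup>2 * mass \<epsilon> k x)) (?N x)"
      using has_sum_finite[OF finite_neighbours, of "\<lambda>y. h1 (x, y)" \<epsilon> k x] by simp
  next
    show "(\<lambda>x. 2 ^ (2 * k) * ((f x)\<^sup>2 * mass \<epsilon> k x)) summable_on ?V"
      using assms by (rule summable_on_cmult_right)
  qed (simp add: h1_def c0)
  have bij: "bij_betw prod.swap ?A ?A"
    by (rule bij_betwI[where g = prod.swap]) (auto intro: adj_sym)
  have h12: "h2 p = h1 (prod.swap p)" for p
    using csym by (cases p) (auto simp: h1_def h2_def)
  have s2: "h2 summable_on ?A"
    unfolding h12 using s1 summable_on_reindex_bij_betw[OF bij, of h1] by simp
  have i2: "infsum h2 ?A = infsum h1 ?A"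
    unfolding h12 using infsum_reindex_bij_betw[OF bij, of h1] by simp
  have "(\<lambda>p. norm (h3 p)) summable_on ?A"
  proof (rule summable_on_comparison_test)
    show "(\<lambda>p. h1 p + h2 p) summable_on ?A"
      by (rule summable_on_add[OF s1 s2])
    fix p :: "vertex \<times> vertex"
    obtain x y where p: "p = (x, y)" by (cases p)
    have "0 \<le> (\<bar>f x\<bar> - \<bar>f y\<bar>)\<^sup>2" "0 \<le> \<bar>f x\<bar> * \<bar>f y\<bar>" by auto
    then have "\<bar>f x\<bar> * \<bar>f y\<bar> \<le> (f x)\<^sup>2 + (f y)\<^sup>2"
      unfolding power2_diff power2_abs by linarith
    then have "c x y * (\<bar>f x\<bar> * \<bar>f y\<bar>) \<le> c x y * ((f x)\<^sup>2 + (f y)\<^sup>2)"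
      by (rule mult_left_mono) (rule c0)
    then show "norm (h3 p) \<le> h1 p + h2 p"
      using c0[of x y] by (simp add: p h1_def h2_def h3_def abs_mult distrib_left)
  qed simp
  then have s3: "h3 summable_on ?A"
    by (rule abs_summable_summable)
  define g where "g = (\<lambda>(x, y). c x y * (f x - f y)\<^sup>2)"
  have g: "g = (\<lambda>p. (h1 p + h2 p) + (-2) * h3 p)"
    by (auto simp: g_def h1_def h2_def h3_def power2_eq_square algebra_simps)
  have sg: "g summable_on ?A"
    unfolding g by (intro summable_on_add summable_on_cmult_right s1 s2 s3)
  have ig: "infsum g ?A = 2 * (infsum h1 ?A - infsum h3 ?A)"
  proof -
    have "infsum g ?A = infsum (\<lambda>p. h1 p + h2 p) ?A + infsum (\<lambda>p. (-2) * h3 p) ?A"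
      unfolding g by (intro infsum_add summable_on_add summable_on_cmult_right s1 s2 s3)
    also have "\<dots> = infsum h1 ?A + infsum h2 ?A + (-2) * infsum h3 ?A"
      by (simp only: infsum_add[OF s1 s2] infsum_cmult_right')
    finally show ?thesis by (simp add: i2)
  qed
  define A1 where "A1 = {(x, y). adj \<epsilon> k x y \<and> {x, y} \<subseteq> insert Star (range Plane)}"
  define A2 where "A2 = {(x, y). adj \<epsilon> k x y \<and> {x, y} \<subseteq> insert Star (range Leg)}"
  have un: "?A = A1 \<union> A2"
  proof -
    have "adj \<epsilon> k x y \<longleftrightarrow> (x, y) \<in> A1 \<union> A2" for x y
      by (cases x; cases y) (auto simp: A1_def A2_def)
    then show ?thesis by auto
  qed
  have disj: "A1 \<inter> A2 = {}"
    by (auto simp: A1_def A2_def)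
  have sub: "A1 \<subseteq> ?A" "A2 \<subseteq> ?A"
    by (auto simp: A1_def A2_def)
  have "infsum g ?A = infsum g A1 + infsum g A2"
    unfolding un by (rule infsum_Un_disjoint[OF _ _ disj]) (use sg sub summable_on_subset_banach in blast)+
  also have "infsum g A1 = infsum (\<lambda>p. 1 / 4 * (case p of (x, y) \<Rightarrow> (f x - f y)\<^sup>2)) A1"
    by (rule infsum_cong) (auto simp: g_def A1_def c_def conductance_def)
  also have "infsum g A2 = infsum (\<lambda>p. 2 ^ k / 2 * (case p of (x, y) \<Rightarrow> (f x - f y)\<^sup>2)) A2"
    by (rule infsum_cong) (auto simp: g_def A2_def c_def conductance_def)
  finally have "infsum g ?A = 1 / 4 * infsum (\<lambda>(x, y). (f x - f y)\<^sup>2) A1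
      + 2 ^ k / 2 * infsum (\<lambda>(x, y). (f x - f y)\<^sup>2) A2"
    by (simp only: infsum_cmult_right')
  then have "energy \<epsilon> k f = infsum g ?A / 2"
    unfolding energy_def A1_def A2_def by simp
  also have "\<dots> = infsum h1 ?A - infsum h3 ?A"
    by (simp add: ig)
  also have "\<dots> = infsum (\<lambda>p. h1 p - h3 p) ?A"
    using infsum_add[OF s1 summable_on_cmult_right[OF s3, of "-1"]]
    by (simp only: infsum_cmult_right') simp
  also have "\<dots> = (\<Sum>\<^sub>\<infinity>x\<in>?V. \<Sum>\<^sub>\<infinity>y\<in>?N x. h1 (x, y) - h3 (x, y))"
    unfolding A by (rule infsum_Sigma_banach[symmetric]) (use summable_on_add[OF s1 summable_on_cmult_right[OF s3, of "-1"]] A in simp)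
  also have "\<dots> = (\<Sum>\<^sub>\<infinity>x\<in>?V. - generator \<epsilon> k f x * f x * mass \<epsilon> k x)"
  proof (rule infsum_cong)
    fix x assume x: "x \<in> ?V"
    have "(\<Sum>\<^sub>\<infinity>y\<in>?N x. h1 (x, y) - h3 (x, y)) = (\<Sum>y\<in>?N x. h1 (x, y) - h3 (x, y))"
      by (rule infsum_finite[OF finite_neighbours])
    also have "\<dots> = - f x * (\<Sum>y\<in>?N x. c x y * (f y - f x))"
      unfolding sum_distrib_left
      by (rule sum.cong) (auto simp: h1_def h3_def power2_eq_square algebra_simps)
    also have "\<dots> = - generator \<epsilon> k f x * f x * mass \<epsilon> k x"
      using generator_eq_sum[OF x, of f] by (simp add: c_def mult_ac)
    finally show "(\<Sum>\<^sub>\<infinity>y\<in>?N x. h1 (x, y) - h3 (x, y)) = - generator \<epsilon> k f x * f x * mass \<epsilon> k x" .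
  qed
  finally show ?thesis .
qed

lemma measurable_jump_chain:
  "jump_chain x \<in> (\<Pi>\<^sub>M (n, z)\<in>UNIV. measure_pmf (jump \<epsilon> k z)) \<rightarrow>\<^sub>M (\<Pi>\<^sub>M n\<in>UNIV. count_space UNIV)"
proof (rule measurable_PiM_single')
  fix n
  let ?M = "\<Pi>\<^sub>M (n, z)\<in>UNIV. measure_pmf (jump \<epsilon> k z)"
  show "(\<lambda>\<xi>. jump_chain x \<xi> n) \<in> ?M \<rightarrow>\<^sub>M count_space UNIV"
  proof (induction n)
    case (Suc n)
    have comp: "(\<lambda>\<xi>. \<xi> (n, z)) \<in> ?M \<rightarrow>\<^sub>M count_space UNIV" for z
      using measurable_component_singleton[of "(n, z)" UNIV "\<lambda>(n, z). measure_pmf (jump \<epsilon> k z)"] by simp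
    show ?case
      unfolding jump_chain.simps
      by (rule measurable_compose_countable[OF comp Suc])
  qed simp
qed (auto simp: space_PiM)

lemma measurable_num_jumps:
  "(\<lambda>\<tau>. num_jumps \<tau> t) \<in> (\<Pi>\<^sub>M n\<in>UNIV. density lborel (exponential_density (2 ^ (2 * k)))) \<rightarrow>\<^sub>M count_space UNIV"
proof -
  let ?M = "\<Pi>\<^sub>M n\<in>UNIV :: nat set. density lborel (exponential_density (2 ^ (2 * k)))"
  have "(\<lambda>\<tau>. \<tau> i) \<in> ?M \<rightarrow>\<^sub>M borel" for i
    using measurable_component_singleton[of i UNIV "\<lambda>_. density lborel (exponential_density (2 ^ (2 * k)))"]
    by simp
  then have [measurable]: "(\<lambda>\<tau>. \<Sum>i\<le>n. \<tau> i) \<in> ?M \<rightarrow>\<^sub>M borel" for n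
    by (intro borel_measurable_sum)
  show ?thesis
    unfolding num_jumps_def by measurable
qed

theorem measurable_chain: "chain x t \<in> chain_space \<epsilon> k \<rightarrow>\<^sub>M count_space UNIV"
proof -
  let ?M = "\<Pi>\<^sub>M (n, z)\<in>UNIV. measure_pmf (jump \<epsilon> k z)"
  let ?N = "\<Pi>\<^sub>M n\<in>UNIV :: nat set. density lborel (exponential_density (2 ^ (2 * k)))"
  have "(\<lambda>\<xi>. jump_chain x \<xi> n) \<in> ?M \<rightarrow>\<^sub>M count_space UNIV" for n
    using measurable_compose[OF measurable_jump_chain measurable_component_singleton[of n UNIV]] by simp
  then have "(\<lambda>\<omega>. jump_chain x (fst \<omega>) n) \<in> ?M \<Otimes>\<^sub>M ?N \<rightarrow>\<^sub>M count_space UNIV" for n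
    using measurable_compose[OF measurable_fst] by blast
  moreover have "(\<lambda>\<omega>. num_jumps (snd \<omega>) t) \<in> ?M \<Otimes>\<^sub>M ?N \<rightarrow>\<^sub>M count_space UNIV"
    using measurable_compose[OF measurable_snd measurable_num_jumps] by blast
  ultimately show ?thesis
    unfolding chain_def chain_space_def by (rule measurable_compose_countable)
qed

theorem prob_space_chain_space: "prob_space (chain_space \<epsilon> k)"
proof -
  have J: "prob_space (\<Pi>\<^sub>M (n :: nat, z)\<in>UNIV. measure_pmf (jump \<epsilon> k z))"
    by (rule prob_space_PiM) (auto simp: measure_pmf.prob_space_axioms split: prod.split)
  have H: "prob_space (\<Pi>\<^sub>M n\<in>UNIV :: nat set. density lborel (exponential_density (2 ^ (2 * k))))"
    by (intro prob_space_PiM prob_space_exponential_density) simp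
  show ?thesis
    unfolding chain_space_def by (rule prob_space_pair[OF J H])
qed

end

theory Submission
  imports Defs
begin

text \<open>
  On the two-dimensional part every vertex is joined to infinity by a horizontal and by a vertical
  lattice ray avoiding the disk, so a Gagliardo argument along these rays gives the planar Nash
  inequality with no extension over the hole; the half-line has the one-dimensional one. Their
  combination \<open>N\<^sup>3 \<le> K E F\<^sup>2 (N + F\<^sup>2)\<close>, where \<open>N = \<parallel>f\<parallel>\<^sub>2\<^sup>2\<close>, \<open>F = \<parallel>f\<parallel>\<^sub>1\<close> and \<open>E\<close> is the energy, has
  constants independent of \<open>k\<close> and \<open>\<epsilon>\<close> and is responsible for the factor \<open>1/t \<or> 1/\<surd>t\<close>.

  The off-diagonal factor comes from Davies' method. For a function \<open>\<psi>\<close> that is \<open>\<sigma>\<close>-Lipschitz along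
  edges, the moments of \<open>v = exp \<psi> \<cdot> u\<close>, with \<open>u\<close> a solution of the heat equation, satisfy
  \<open>d/dt \<parallel>v\<parallel>\<^bsub>2p\<^esub>\<^bsup>2p\<^esup> \<le> - E(v\<^sup>p) + 3 p\<^sup>2 sinh\<^sup>2(\<sigma>) 4\<^sup>k \<parallel>v\<parallel>\<^bsub>2p\<^esub>\<^bsup>2p\<^esup>\<close>. Nash's inequality turns this into
  \<open>L\<^sup>p\<close> to \<open>L\<^bsup>2p\<^esup>\<close> bounds for \<open>p = 2, 4, 8, \<dots>\<close> on time steps shrinking like \<open>4\<^sup>-\<^sup>i\<close>, and duality gives
  \<open>p(t,x,y) \<le> C (1/t \<or> 1/\<surd>t) exp (8 \<sigma>\<^sup>2 4\<^sup>k t - \<sigma> n)\<close> for \<open>\<sigma> \<le> 1\<close>, where \<open>n = 2\<^sup>k d\<close> is the number of edges.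
  The two regimes are \<open>\<sigma> = d / (16 \<cdot> 2\<^sup>k t)\<close> and \<open>\<sigma> = 1\<close>.

  The chain is a Poisson clock of rate \<open>4\<^sup>k\<close> run along the jump chain; the first \<open>N\<close> terms of the
  Poisson series only see the ball of radius \<open>N\<close>, so everything is done for the chain killed outside a
  finite set.
\<close>

section \<open>Elementary inequalities\<close>

text \<open>A Stroock-Varopoulos inequality. Both sides contain the factor (a - b)^2. What remains
  on the left is the square of a sum of p terms, which Cauchy-Schwarz bounds by p times the sum of
  their squares; these squares are the even-indexed terms of the cofactor on the right.\<close>

lemma power_diff_squared_le:
  fixes a b :: real
  assumes "a \<ge> 0" "b \<ge> 0" "p \<ge> 1"
  shows "(a ^ p - b ^ p)\<^sup>2 \<le> real p * ((a ^ (2 * p - 1) - b ^ (2 * p - 1)) * (a - b))"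
proof -
  obtain n where p: "p = Suc n" using assms(3) by (cases p) auto
  define f where "f i = a ^ i * b ^ (n - i)" for i
  define g where "g i = a ^ i * b ^ (2 * n - i)" for i
  have 1: "a ^ p - b ^ p = (a - b) * (\<Sum>i<p. f i)"
    using power_diff_sumr2[of a p b] by (simp add: p f_def mult_ac)
  have 2: "a ^ (2 * p - 1) - b ^ (2 * p - 1) = (a - b) * (\<Sum>i<2 * p - 1. g i)"
    using power_diff_sumr2[of a "2 * p - 1" b] by (simp add: p g_def mult_ac)
  have "(\<Sum>i<p. f i)\<^sup>2 \<le> real p * (\<Sum>i<p. (f i)\<^sup>2)"
    using Cauchy_Schwarz_ineq_sum[of "\<lambda>_. 1" f "{..<p}"] by simp
  also have "(\<Sum>i<p. (f i)\<^sup>2) = (\<Sum>i<p. g (2 * i))"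
    by (intro sum.cong) (auto simp: f_def g_def p power_mult_distrib diff_mult_distrib diff_mult_distrib2 mult.commute simp flip: power_mult)
  also have "\<dots> = (\<Sum>i\<in>(\<lambda>i. 2 * i) ` {..<p}. g i)"
    by (subst sum.reindex) (auto simp: inj_on_def)
  also have "\<dots> \<le> (\<Sum>i<2 * p - 1. g i)"
    by (rule sum_mono2) (auto simp: g_def assms)
  finally have "(\<Sum>i<p. f i)\<^sup>2 \<le> real p * (\<Sum>i<2 * p - 1. g i)" by (simp add: mult_left_mono)
  then have "(a - b)\<^sup>2 * (\<Sum>i<p. f i)\<^sup>2 \<le> (a - b)\<^sup>2 * (real p * (\<Sum>i<2 * p - 1. g i))"
    by (rule mult_left_mono) simp
  then show ?thesis
    unfolding 1 2 by (simp add: power_mult_distrib power2_eq_square mult_ac)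
qed

text \<open>Write exp(\<plusminus>\<delta>) as cosh \<plusminus> sinh. By
  \<open>power_diff_squared_le\<close>, 2P(X + Y) is at most 2PS minus two copies of (A - B)^2. One
  copy pays for the square on the left; the other absorbs the antisymmetric term sinh \<delta> (X -
  Y) through Young's inequality. The three remaining P^2 sinh^2 terms give the constant 3.\<close>

lemma tilted_edge_bound:
  fixes a b \<delta> \<sigma> :: real
  assumes ab: "a \<ge> 0" "b \<ge> 0" and p: "p \<ge> 1" and \<delta>: "\<bar>\<delta>\<bar> \<le> \<sigma>"
  shows "2 * real p * (exp \<delta> * (a ^ (2 * p - 1) * b) + exp (- \<delta>) * (a * b ^ (2 * p - 1)))
      + (a ^ p - b ^ p)\<^sup>2 \<le> (2 * real p + 3 * (real p)\<^sup>2 * (sinh \<sigma>)\<^sup>2) * (a ^ (2 * p) + b ^ (2 * p))"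
proof -
  define X where "X = a ^ (2 * p - 1) * b"
  define Y where "Y = a * b ^ (2 * p - 1)"
  define A where "A = a ^ p"
  define B where "B = b ^ p"
  define P where "P = real p"
  define S where "S = A\<^sup>2 + B\<^sup>2"
  have P1: "P \<ge> 1" using p by (simp add: P_def)
  have XY0: "X \<ge> 0" "Y \<ge> 0" "A \<ge> 0" "B \<ge> 0" "S \<ge> 0" using ab by (auto simp: X_def Y_def A_def B_def S_def)
  obtain n where n: "2 * p = Suc n" using p by (cases "2 * p") auto
  have A2: "A\<^sup>2 = a ^ (2 * p - 1) * a" and B2: "B\<^sup>2 = b ^ (2 * p - 1) * b"
    using n by (simp_all add: A_def B_def mult.commute flip: power_mult)
  have diff: "S - X - Y = (a ^ (2 * p - 1) - b ^ (2 * p - 1)) * (a - b)"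
    by (simp add: S_def A2 B2 X_def Y_def algebra_simps)
  have i: "(A - B)\<^sup>2 \<le> P * (S - X - Y)"
    using power_diff_squared_le[OF ab p] by (simp add: diff A_def B_def P_def)
  have "0 \<le> P * (S - X - Y)" using i by (rule order_trans[rotated]) simp
  then have XYS: "X + Y \<le> S" using P1 by (simp add: zero_le_mult_iff)
  \<comment> \<open>Both (A^2 - B^2) - (X - Y) and (A^2 - B^2) + (X - Y) factor with the sign of a -
    b, so X - Y lies between -(A^2 - B^2) and A^2 - B^2 or the reverse.\<close>
  have ii: "\<bar>X - Y\<bar> \<le> \<bar>A - B\<bar> * (A + B)"
  proof -
    have AB: "\<bar>A - B\<bar> * (A + B) = \<bar>A\<^sup>2 - B\<^sup>2\<bar>"
    proof -
      have "A\<^sup>2 - B\<^sup>2 = (A - B) * (A + B)" by (simp add: power2_eq_square algebra_simps)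
      then show ?thesis using XY0 by (simp add: abs_mult)
    qed
    have e1: "(A\<^sup>2 - B\<^sup>2) - (X - Y) = (a - b) * (a ^ (2 * p - 1) + b ^ (2 * p - 1))"
      by (simp add: A2 B2 X_def Y_def algebra_simps)
    have e2: "(A\<^sup>2 - B\<^sup>2) + (X - Y) = (a + b) * (a ^ (2 * p - 1) - b ^ (2 * p - 1))"
      by (simp add: A2 B2 X_def Y_def algebra_simps)
    show ?thesis
    proof (cases "b \<le> a")
      case True
      then have "0 \<le> (A\<^sup>2 - B\<^sup>2) - (X - Y)" "0 \<le> (A\<^sup>2 - B\<^sup>2) + (X - Y)"
        unfolding e1 e2 using ab by (auto intro!: mult_nonneg_nonneg power_mono)
      then show ?thesis unfolding AB by linarith
    next
      case False
      then have "(A\<^sup>2 - B\<^sup>2) - (X - Y) \<le> 0"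
        unfolding e1 using ab by (intro mult_nonpos_nonneg) auto
      moreover have "(A\<^sup>2 - B\<^sup>2) + (X - Y) \<le> 0"
        unfolding e2 using ab False by (intro mult_nonneg_nonpos) (auto intro!: power_mono)
      ultimately have "0 \<ge> (A\<^sup>2 - B\<^sup>2) - (X - Y)" "0 \<ge> (A\<^sup>2 - B\<^sup>2) + (X - Y)" by auto
      then show ?thesis unfolding AB by linarith
    qed
  qed
  define s where "s = (sinh \<delta>)\<^sup>2"
  have s0: "s \<ge> 0" by (simp add: s_def)
  have s\<sigma>: "s \<le> (sinh \<sigma>)\<^sup>2"
  proof -
    have "\<bar>sinh \<delta>\<bar> = sinh \<bar>\<delta>\<bar>" by (simp add: sinh_real_abs)
    also have "\<dots> \<le> sinh \<sigma>" using \<delta> by (simp only: sinh_real_le_iff)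
    finally show ?thesis unfolding s_def
      by (metis abs_le_square_iff abs_ge_self order_trans)
  qed
  have cosh: "2 * (cosh \<delta> - 1) \<le> s"
  proof -
    have "s = (cosh \<delta> - 1) * (cosh \<delta> + 1)"
      unfolding s_def sinh_square_eq by (simp add: power2_eq_square algebra_simps)
    moreover have "(cosh \<delta> - 1) * 2 \<le> (cosh \<delta> - 1) * (cosh \<delta> + 1)"
      using cosh_real_ge_1[of \<delta>] by (intro mult_left_mono) auto
    ultimately show ?thesis by simp
  qed
  have iii: "2 * P * ((cosh \<delta> - 1) * (X + Y)) \<le> P\<^sup>2 * s * S"
  proof -
    have "2 * P * ((cosh \<delta> - 1) * (X + Y)) \<le> 2 * P * ((cosh \<delta> - 1) * S)"
      using XYS P1 cosh_real_ge_1[of \<delta>] by (intro mult_left_mono) auto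
    also have "\<dots> = P * S * (2 * (cosh \<delta> - 1))" by simp
    also have "\<dots> \<le> P * S * s" using cosh P1 XY0 by (intro mult_left_mono) auto
    also have "\<dots> \<le> P\<^sup>2 * S * s" using P1 XY0 s0
      by (intro mult_right_mono) (auto simp: power2_eq_square)
    finally show ?thesis by (simp add: mult_ac)
  qed
  have iv: "2 * P * (sinh \<delta> * (X - Y)) \<le> (A - B)\<^sup>2 + 2 * (P\<^sup>2 * s * S)"
  proof -
    have "2 * P * (sinh \<delta> * (X - Y)) \<le> 2 * P * (\<bar>sinh \<delta>\<bar> * (\<bar>A - B\<bar> * (A + B)))"
    proof (intro mult_left_mono)
      have "sinh \<delta> * (X - Y) \<le> \<bar>sinh \<delta>\<bar> * \<bar>X - Y\<bar>" by (metis abs_ge_self abs_mult)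
      also have "\<dots> \<le> \<bar>sinh \<delta>\<bar> * (\<bar>A - B\<bar> * (A + B))" using ii by (intro mult_left_mono) auto
      finally show "sinh \<delta> * (X - Y) \<le> \<bar>sinh \<delta>\<bar> * (\<bar>A - B\<bar> * (A + B))" .
    qed (use P1 in auto)
    also have "\<dots> = 2 * \<bar>A - B\<bar> * (P * \<bar>sinh \<delta>\<bar> * (A + B))" by simp
    also have "\<dots> \<le> \<bar>A - B\<bar>\<^sup>2 + (P * \<bar>sinh \<delta>\<bar> * (A + B))\<^sup>2"
      using sum_squares_bound by blast
    also have "\<dots> = (A - B)\<^sup>2 + P\<^sup>2 * s * (A + B)\<^sup>2" by (simp add: power_mult_distrib s_def)
    also have "\<dots> \<le> (A - B)\<^sup>2 + P\<^sup>2 * s * (2 * S)"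
    proof -
      have "(A + B)\<^sup>2 \<le> 2 * S"
        using sum_squares_bound[of A B] by (simp add: S_def power2_sum)
      then show ?thesis using s0 by (intro add_left_mono mult_left_mono) auto
    qed
    finally show ?thesis by simp
  qed
  have ex: "exp \<delta> * X + exp (- \<delta>) * Y = (X + Y) + (cosh \<delta> - 1) * (X + Y) + sinh \<delta> * (X - Y)"
    by (simp add: cosh_def sinh_def field_simps)
  have "2 * P * (exp \<delta> * X + exp (- \<delta>) * Y) + (A - B)\<^sup>2
     = 2 * P * (X + Y) + 2 * P * ((cosh \<delta> - 1) * (X + Y)) + 2 * P * (sinh \<delta> * (X - Y)) + (A - B)\<^sup>2"
    unfolding ex by (simp add: algebra_simps)
  also have "\<dots> \<le> 2 * P * S + 3 * (P\<^sup>2 * s * S)"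
    using i iii iv by (simp add: algebra_simps)
  also have "\<dots> \<le> 2 * P * S + 3 * (P\<^sup>2 * (sinh \<sigma>)\<^sup>2 * S)"
    using s\<sigma> XY0 by (intro add_left_mono mult_left_mono mult_right_mono) auto
  also have "\<dots> = (2 * P + 3 * P\<^sup>2 * (sinh \<sigma>)\<^sup>2) * S" by (simp add: algebra_simps)
  finally show ?thesis
    by (simp add: X_def Y_def A_def B_def P_def S_def mult.commute flip: power_mult)
qed

text \<open>Separation of variables: the differential inequality says that 1/z + 1/(2 z^2) grows at
  rate at least 1/K. At time \<tau> one of the two terms is at least \<tau>/(2K); the first gives
  decay 1/\<tau>, the second 1/sqrt \<tau>.\<close>

lemma cubic_decay:
  fixes z z' :: "real \<Rightarrow> real"
  assumes \<tau>: "\<tau> > 0" and K: "K > 0"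
    and pos: "\<And>t. 0 \<le> t \<Longrightarrow> t \<le> \<tau> \<Longrightarrow> z t > 0"
    and der: "\<And>t. 0 \<le> t \<Longrightarrow> t \<le> \<tau> \<Longrightarrow> (z has_real_derivative z' t) (at t)"
    and le: "\<And>t. 0 \<le> t \<Longrightarrow> t \<le> \<tau> \<Longrightarrow> K * z' t * (1 + z t) \<le> - ((z t) ^ 3)"
  shows "z \<tau> \<le> max (2 * K / \<tau>) (sqrt (K / \<tau>))"
proof -
  define \<Phi> where "\<Phi> t = 1 / z t + 1 / (2 * (z t)\<^sup>2) - t / K" for t
  have "\<Phi> 0 \<le> \<Phi> \<tau>"
  proof (rule DERIV_nonneg_imp_nondecreasing[where f = \<Phi>])
    fix t assume t: "0 \<le> t" "t \<le> \<tau>"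
    have zp: "z t > 0" using pos t by auto
    have "(\<Phi> has_real_derivative (- z' t / (z t)\<^sup>2 - z' t / (z t) ^ 3 - 1 / K)) (at t)"
      unfolding \<Phi>_def using zp K
      by (auto intro!: derivative_eq_intros der[OF t] simp: field_simps power2_eq_square power3_eq_cube)
    moreover have "- z' t / (z t)\<^sup>2 - z' t / (z t) ^ 3 - 1 / K \<ge> 0"
      using le[OF t] zp K by (simp add: field_simps power2_eq_square power3_eq_cube)
    ultimately show "\<exists>y. (\<Phi> has_real_derivative y) (at t) \<and> 0 \<le> y" by blast
  qed (use \<tau> in auto)
  moreover have "\<Phi> 0 > 0" using pos[of 0] \<tau> by (simp add: \<Phi>_def add_pos_pos)
  ultimately have "\<tau> / K < 1 / z \<tau> + 1 / (2 * (z \<tau>)\<^sup>2)" by (simp add: \<Phi>_def)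
  then consider "\<tau> / K / 2 \<le> 1 / z \<tau>" | "\<tau> / K / 2 \<le> 1 / (2 * (z \<tau>)\<^sup>2)" by linarith
  then show ?thesis
  proof cases
    case 1
    then have "z \<tau> \<le> 2 * K / \<tau>" using pos[of \<tau>] \<tau> K by (simp add: field_simps)
    then show ?thesis by simp
  next
    case 2
    then have "(z \<tau>)\<^sup>2 \<le> K / \<tau>" using pos[of \<tau>] \<tau> K by (simp add: field_simps)
    then have "z \<tau> \<le> sqrt (K / \<tau>)" by (rule real_le_rsqrt)
    then show ?thesis by simp
  qed
qed


text \<open>A constant factor disappears under 2^n-th roots. This is the passage from moments of
  order 2 * 2^n to a pointwise bound.\<close>

lemma le_if_power_le:
  fixes x R :: real
  assumes "x \<ge> 0" "R \<ge> 0" and le: "\<And>n. n \<ge> 1 \<Longrightarrow> x ^ (2 ^ n) \<le> C * R ^ (2 ^ n)"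
  shows "x \<le> R"
proof (rule ccontr)
  assume "\<not> x \<le> R"
  then have xR: "x > R" by simp
  show False
  proof (cases "R = 0")
    case True
    then show False using le[of 1] xR by simp
  next
    case False
    then have R: "R > 0" using assms by simp
    then have "x / R > 1" using xR by simp
    then obtain n where n: "C < (x / R) ^ n" using real_arch_pow by blast
    have "(x / R) ^ n \<le> (x / R) ^ (2 ^ Suc n)"
    proof (rule power_increasing)
      show "n \<le> 2 ^ Suc n" using less_exp[of "Suc n"] by linarith
    qed (use \<open>x / R > 1\<close> in auto)
    also have "\<dots> \<le> C"
      using le[of "Suc n"] R by (simp add: power_divide field_simps)
    finally show False using n by simp
  qed
qed

section \<open>Heat flow on a killed network\<close>

text \<open>Every point has total jump rate \<Lambda>. \<open>row_sum_le\<close> is only an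
  inequality because jumps leading out of V are not recorded in the sum; the deficit is the killing
  rate.\<close>

locale killed_network =
  fixes V :: "'a set" and c :: "'a \<Rightarrow> 'a \<Rightarrow> real" and m :: "'a \<Rightarrow> real" and \<Lambda> :: real
  assumes finite_V: "finite V"
    and c_nonneg: "c x y \<ge> 0"
    and c_sym: "c x y = c y x"
    and m_pos: "x \<in> V \<Longrightarrow> m x > 0"
    and rate_pos: "\<Lambda> > 0"
    and row_sum_le: "x \<in> V \<Longrightarrow> (\<Sum>y\<in>V. c x y) \<le> \<Lambda> * m x"
begin

text \<open>\<open>avg\<close> is \<Lambda> times the substochastic transition operator, so the
  generator of the killed chain is \<open>avg f\<close> - \<Lambda> f.\<close>

definition avg :: "('a \<Rightarrow> real) \<Rightarrow> 'a \<Rightarrow> real" where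
  "avg f x = (\<Sum>y\<in>V. c x y * f y) / m x"

text \<open>The Dirichlet energy of the extension of \<open>f\<close> by zero: edges leaving \<open>V\<close> are accounted for
  because the total jump rate out of every point is \<open>\<Lambda>\<close>.\<close>

definition form :: "('a \<Rightarrow> real) \<Rightarrow> real" where
  "form f = \<Lambda> * (\<Sum>x\<in>V. m x * (f x)\<^sup>2) - (\<Sum>x\<in>V. \<Sum>y\<in>V. c x y * (f x * f y))"

text \<open>Nonnegativity is built in because the edge inequality is applied to powers of the
  solution. The derivative is two-sided even at t = 0, which the power series solution below
  provides.\<close>

definition heat_sol :: "(real \<Rightarrow> 'a \<Rightarrow> real) \<Rightarrow> bool" where
  "heat_sol u \<longleftrightarrow> (\<forall>t\<ge>0. \<forall>x\<in>V. u t x \<ge> 0 \<and>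
     ((\<lambda>s. u s x) has_real_derivative avg (u t) x - \<Lambda> * u t x) (at t))"

definition moment :: "('a \<Rightarrow> real) \<Rightarrow> (real \<Rightarrow> 'a \<Rightarrow> real) \<Rightarrow> nat \<Rightarrow> real \<Rightarrow> real" where
  "moment \<psi> u p t = (\<Sum>x\<in>V. m x * (exp (\<psi> x) * u t x) ^ p)"

definition moment_deriv :: "('a \<Rightarrow> real) \<Rightarrow> (real \<Rightarrow> 'a \<Rightarrow> real) \<Rightarrow> nat \<Rightarrow> real \<Rightarrow> real" where
  "moment_deriv \<psi> u p t = (\<Sum>x\<in>V. m x *
     (real p * (exp (\<psi> x) * u t x) ^ (p - 1) * (exp (\<psi> x) * (avg (u t) x - \<Lambda> * u t x))))"

definition lipschitz_weight :: "real \<Rightarrow> ('a \<Rightarrow> real) \<Rightarrow> bool" where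
  "lipschitz_weight \<sigma> \<psi> \<longleftrightarrow> (\<forall>x\<in>V. \<forall>y\<in>V. c x y \<noteq> 0 \<longrightarrow> \<bar>\<psi> x - \<psi> y\<bar> \<le> \<sigma>)"

lemma mass_avg: "x \<in> V \<Longrightarrow> m x * avg f x = (\<Sum>y\<in>V. c x y * f y)"
  using m_pos[of x] by (simp add: avg_def)

lemma lipschitz_weight_uminus: "lipschitz_weight \<sigma> \<psi> \<Longrightarrow> lipschitz_weight \<sigma> (\<lambda>x. - \<psi> x)"
  by (auto simp: lipschitz_weight_def abs_minus_commute)

lemma heat_sol_shift: "heat_sol u \<Longrightarrow> s \<ge> 0 \<Longrightarrow> heat_sol (\<lambda>t. u (s + t))"
  unfolding heat_sol_def
proof (intro allI impI ballI conjI)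
  fix t :: real and x assume *: "\<forall>t\<ge>0. \<forall>x\<in>V. 0 \<le> u t x \<and> ((\<lambda>s. u s x) has_real_derivative avg (u t) x - \<Lambda> * u t x) (at t)"
    "0 \<le> s" "0 \<le> t" "x \<in> V"
  then show "0 \<le> u (s + t) x" by simp
  have "((\<lambda>s. u s x) has_real_derivative avg (u (s + t)) x - \<Lambda> * u (s + t) x) (at (s + t))"
    using * by simp
  then show "((\<lambda>r. u (s + r) x) has_real_derivative avg (u (s + t)) x - \<Lambda> * u (s + t) x) (at t)"
    by (simp add: DERIV_shift add.commute[of s])
qed

section \<open>Differential inequality for tilted moments\<close>

lemma moment_has_derivative:
  assumes "heat_sol u" "t \<ge> 0"
  shows "(moment \<psi> u p has_real_derivative moment_deriv \<psi> u p t) (at t)"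
  unfolding moment_def[abs_def] moment_deriv_def
proof (rule DERIV_sum)
  fix x assume "x \<in> V"
  then have [derivative_intros]: "((\<lambda>s. u s x) has_real_derivative avg (u t) x - \<Lambda> * u t x) (at t)"
    using assms by (simp add: heat_sol_def)
  show "((\<lambda>s. m x * (exp (\<psi> x) * u s x) ^ p) has_real_derivative
      m x * (real p * (exp (\<psi> x) * u t x) ^ (p - 1) * (exp (\<psi> x) * (avg (u t) x - \<Lambda> * u t x)))) (at t)"
    by (auto intro!: derivative_eq_intros)
qed

lemma moment_nonneg: "heat_sol u \<Longrightarrow> t \<ge> 0 \<Longrightarrow> moment \<psi> u p t \<ge> 0"
  unfolding moment_def using m_pos
  by (intro sum_nonneg mult_nonneg_nonneg zero_le_power) (auto simp: heat_sol_def less_imp_le)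

lemma sum_edges_le:
  assumes "\<And>x. x \<in> V \<Longrightarrow> g x \<ge> 0"
  shows "(\<Sum>x\<in>V. \<Sum>y\<in>V. c x y * (g x + g y)) \<le> 2 * \<Lambda> * (\<Sum>x\<in>V. m x * g x)"
proof -
  have "(\<Sum>x\<in>V. \<Sum>y\<in>V. c x y * g y) = (\<Sum>x\<in>V. \<Sum>y\<in>V. c x y * g x)"
    by (subst sum.swap) (simp add: c_sym[of _ _])
  then have "(\<Sum>x\<in>V. \<Sum>y\<in>V. c x y * (g x + g y)) = 2 * (\<Sum>x\<in>V. \<Sum>y\<in>V. c x y * g x)"
    by (simp add: distrib_left sum.distrib)
  also have "(\<Sum>x\<in>V. \<Sum>y\<in>V. c x y * g x) = (\<Sum>x\<in>V. (\<Sum>y\<in>V. c x y) * g x)"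
    by (simp add: sum_distrib_right)
  also have "\<dots> \<le> (\<Sum>x\<in>V. (\<Lambda> * m x) * g x)"
    using assms row_sum_le by (intro sum_mono mult_right_mono) auto
  also have "\<dots> = \<Lambda> * (\<Sum>x\<in>V. m x * g x)" by (simp add: sum_distrib_left mult_ac)
  finally show ?thesis by simp
qed

lemma form_nonneg: "form f \<ge> 0"
proof -
  have "(\<Sum>x\<in>V. \<Sum>y\<in>V. c x y * (f x * f y)) \<le> (\<Sum>x\<in>V. \<Sum>y\<in>V. c x y * ((f x)\<^sup>2 / 2 + (f y)\<^sup>2 / 2))"
    using sum_squares_bound[of "f _" "f _"] c_nonneg
    by (intro sum_mono mult_left_mono) (auto simp: field_simps)
  also have "\<dots> \<le> 2 * \<Lambda> * (\<Sum>x\<in>V. m x * ((f x)\<^sup>2 / 2))"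
    by (rule sum_edges_le) simp
  also have "\<dots> = \<Lambda> * (\<Sum>x\<in>V. m x * (f x)\<^sup>2)" by (simp add: sum_distrib_left)
  finally show ?thesis by (simp add: form_def)
qed

text \<open>Symmetrizing the double sum pairs the two orientations of an edge, and
  \<open>tilted_edge_bound\<close> applies to each pair. \<open>sum_edges_le\<close> then converts
  the sum of the v^(2p) over edges into \<Lambda> times the moment, so the leading terms
  2P\<Lambda>N cancel.\<close>

lemma moment_deriv_le:
  assumes u: "heat_sol u" and t: "t \<ge> 0" and \<psi>: "lipschitz_weight \<sigma> \<psi>" and p: "p \<ge> 1"
  shows "moment_deriv \<psi> u (2 * p) t
    \<le> 3 * (real p)\<^sup>2 * (sinh \<sigma>)\<^sup>2 * \<Lambda> * moment \<psi> u (2 * p) t - form (\<lambda>x. (exp (\<psi> x) * u t x) ^ p)"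
proof -
  define v where "v x = exp (\<psi> x) * u t x" for x
  define P where "P = real p"
  define \<kappa> where "\<kappa> = 3 * P\<^sup>2 * (sinh \<sigma>)\<^sup>2"
  define N where "N = (\<Sum>x\<in>V. m x * v x ^ (2 * p))"
  define W where "W x y = exp (\<psi> x - \<psi> y) * (v x ^ (2 * p - 1) * v y)" for x y
  have P1: "P \<ge> 1" using p by (simp add: P_def)
  have v0: "v x \<ge> 0" if "x \<in> V" for x using u t that by (simp add: v_def heat_sol_def)
  have pw: "v x ^ (2 * p - 1) * v x = v x ^ (2 * p)" for x
    using p power_minus_mult[of "2 * p" "v x"] by simp
  have "moment_deriv \<psi> u (2 * p) t = (\<Sum>x\<in>V. 2 * P * ((\<Sum>y\<in>V. c x y * W x y) - \<Lambda> * (m x * v x ^ (2 * p))))"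
    unfolding moment_deriv_def
  proof (rule sum.cong[OF refl])
    fix x assume "x \<in> V"
    then have "exp (\<psi> x) * (m x * avg (u t) x) = (\<Sum>y\<in>V. c x y * (exp (\<psi> x - \<psi> y) * v y))"
      by (simp add: mass_avg sum_distrib_left v_def exp_diff mult_ac)
    then have "v x ^ (2 * p - 1) * (exp (\<psi> x) * (m x * avg (u t) x)) = (\<Sum>y\<in>V. c x y * W x y)"
      by (simp add: sum_distrib_left W_def mult_ac)
    moreover have "v x ^ (2 * p - 1) * (exp (\<psi> x) * u t x) = v x ^ (2 * p)"
      using pw[of x] by (simp add: v_def)
    moreover have "m x * (real (2 * p) * v x ^ (2 * p - 1) * (exp (\<psi> x) * (avg (u t) x - \<Lambda> * u t x)))
        = 2 * P * (v x ^ (2 * p - 1) * (exp (\<psi> x) * (m x * avg (u t) x))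
            - \<Lambda> * (m x * (v x ^ (2 * p - 1) * (exp (\<psi> x) * u t x))))"
      by (simp add: P_def algebra_simps)
    ultimately show "m x * (real (2 * p) * (exp (\<psi> x) * u t x) ^ (2 * p - 1) * (exp (\<psi> x) * (avg (u t) x - \<Lambda> * u t x)))
        = 2 * P * ((\<Sum>y\<in>V. c x y * W x y) - \<Lambda> * (m x * v x ^ (2 * p)))"
      by (simp only: v_def[symmetric])
  qed
  also have "\<dots> = 2 * P * (\<Sum>x\<in>V. \<Sum>y\<in>V. c x y * W x y) - 2 * P * \<Lambda> * N"
    by (simp add: right_diff_distrib sum_subtractf N_def sum_distrib_left mult_ac)
  finally have deriv: "moment_deriv \<psi> u (2 * p) t = 2 * P * (\<Sum>x\<in>V. \<Sum>y\<in>V. c x y * W x y) - 2 * P * \<Lambda> * N" .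
  have "2 * P * (\<Sum>x\<in>V. \<Sum>y\<in>V. c x y * W x y) = (\<Sum>x\<in>V. \<Sum>y\<in>V. c x y * (P * (W x y + W y x)))"
  proof -
    have "(\<Sum>x\<in>V. \<Sum>y\<in>V. c x y * W y x) = (\<Sum>x\<in>V. \<Sum>y\<in>V. c x y * W x y)"
      by (subst sum.swap) (simp add: c_sym[of _ _])
    moreover have "(\<Sum>x\<in>V. \<Sum>y\<in>V. c x y * (P * (W x y + W y x)))
        = P * (\<Sum>x\<in>V. \<Sum>y\<in>V. c x y * W x y) + P * (\<Sum>x\<in>V. \<Sum>y\<in>V. c x y * W y x)"
      by (simp add: sum_distrib_left sum.distrib[symmetric] algebra_simps)
    ultimately show ?thesis by simp
  qed
  also have "\<dots> \<le> (\<Sum>x\<in>V. \<Sum>y\<in>V. c x y * ((P + \<kappa> / 2 - 1 / 2) * v x ^ (2 * p) + (P + \<kappa> / 2 - 1 / 2) * v y ^ (2 * p))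
      + c x y * (v x ^ p * v y ^ p))"
  proof (intro sum_mono)
    fix x y assume xy: "x \<in> V" "y \<in> V"
    show "c x y * (P * (W x y + W y x)) \<le> c x y * ((P + \<kappa> / 2 - 1 / 2) * v x ^ (2 * p) + (P + \<kappa> / 2 - 1 / 2) * v y ^ (2 * p))
      + c x y * (v x ^ p * v y ^ p)"
    proof (cases "c x y = 0")
      case False
      then have "\<bar>\<psi> x - \<psi> y\<bar> \<le> \<sigma>" using \<psi> xy by (simp add: lipschitz_weight_def)
      from tilted_edge_bound[OF v0[OF xy(1)] v0[OF xy(2)] p this]
      have "2 * P * (W x y + W y x) + (v x ^ p - v y ^ p)\<^sup>2 \<le> (2 * P + \<kappa>) * (v x ^ (2 * p) + v y ^ (2 * p))"
        by (simp add: W_def P_def \<kappa>_def mult_ac)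
      moreover have "(v x ^ p - v y ^ p)\<^sup>2 = v x ^ (2 * p) + v y ^ (2 * p) - 2 * (v x ^ p * v y ^ p)"
        by (simp add: power2_diff mult.commute flip: power_mult)
      \<comment> \<open>Halving the edge bound and expanding the square leaves v x ^ p * v y ^ p
        with coefficient 1, the off-diagonal part of \<open>form\<close>. The -1/2 at each endpoint
        sums to -\<Lambda>N, its diagonal part.\<close>
      ultimately have "P * (W x y + W y x) \<le> (P + \<kappa> / 2 - 1 / 2) * v x ^ (2 * p) + (P + \<kappa> / 2 - 1 / 2) * v y ^ (2 * p) + v x ^ p * v y ^ p"
        by (simp add: field_simps)
      from mult_left_mono[OF this c_nonneg[of x y]] show ?thesis by (simp add: distrib_left)
    qed simp
  qed
  also have "\<dots> = (\<Sum>x\<in>V. \<Sum>y\<in>V. c x y * ((P + \<kappa> / 2 - 1 / 2) * v x ^ (2 * p) + (P + \<kappa> / 2 - 1 / 2) * v y ^ (2 * p)))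
      + (\<Sum>x\<in>V. \<Sum>y\<in>V. c x y * (v x ^ p * v y ^ p))"
    by (simp add: sum.distrib)
  also have "\<dots> \<le> 2 * \<Lambda> * (\<Sum>x\<in>V. m x * ((P + \<kappa> / 2 - 1 / 2) * v x ^ (2 * p)))
      + (\<Sum>x\<in>V. \<Sum>y\<in>V. c x y * (v x ^ p * v y ^ p))"
  proof (intro add_right_mono sum_edges_le mult_nonneg_nonneg zero_le_power v0)
    have "\<kappa> \<ge> 0" by (simp add: \<kappa>_def)
    then show "P + \<kappa> / 2 - 1 / 2 \<ge> 0" using P1 by simp
  qed
  finally have sum_le: "2 * P * (\<Sum>x\<in>V. \<Sum>y\<in>V. c x y * W x y)
      \<le> 2 * \<Lambda> * (\<Sum>x\<in>V. m x * ((P + \<kappa> / 2 - 1 / 2) * v x ^ (2 * p)))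
      + (\<Sum>x\<in>V. \<Sum>y\<in>V. c x y * (v x ^ p * v y ^ p))" .
  have "2 * \<Lambda> * (\<Sum>x\<in>V. m x * ((P + \<kappa> / 2 - 1 / 2) * v x ^ (2 * p))) = 2 * \<Lambda> * ((P + \<kappa> / 2 - 1 / 2) * N)"
    by (simp add: N_def sum_distrib_left mult_ac)
  then have "moment_deriv \<psi> u (2 * p) t \<le> 2 * \<Lambda> * ((P + \<kappa> / 2 - 1 / 2) * N)
      + (\<Sum>x\<in>V. \<Sum>y\<in>V. c x y * (v x ^ p * v y ^ p)) - 2 * P * \<Lambda> * N"
    using sum_le deriv by linarith
  also have "\<dots> = \<kappa> * \<Lambda> * N - form (\<lambda>x. v x ^ p)"
    by (simp add: form_def N_def algebra_simps flip: power_mult)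
  finally show ?thesis by (simp add: N_def moment_def v_def \<kappa>_def P_def)
qed

text \<open>Gronwall, after dropping the nonnegative energy in
  \<open>moment_deriv_le\<close>.\<close>

lemma moment_growth:
  assumes u: "heat_sol u" and s: "0 \<le> s" "s \<le> t" and \<psi>: "lipschitz_weight \<sigma> \<psi>" and p: "p \<ge> 1"
  shows "moment \<psi> u (2 * p) t \<le> exp (3 * (real p)\<^sup>2 * (sinh \<sigma>)\<^sup>2 * \<Lambda> * (t - s)) * moment \<psi> u (2 * p) s"
proof -
  define \<kappa> where "\<kappa> = 3 * (real p)\<^sup>2 * (sinh \<sigma>)\<^sup>2 * \<Lambda>"
  define g where "g r = exp (- \<kappa> * r) * moment \<psi> u (2 * p) r" for r
  have "g t \<le> g s"
  proof (rule DERIV_nonpos_imp_nonincreasing[where f = g])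
    fix r assume r: "s \<le> r" "r \<le> t"
    then have r0: "r \<ge> 0" using s by simp
    have "(g has_real_derivative exp (- \<kappa> * r) * (moment_deriv \<psi> u (2 * p) r - \<kappa> * moment \<psi> u (2 * p) r)) (at r)"
      unfolding g_def by (auto intro!: derivative_eq_intros moment_has_derivative[OF u r0] simp: algebra_simps)
    moreover have "moment_deriv \<psi> u (2 * p) r - \<kappa> * moment \<psi> u (2 * p) r \<le> 0"
      using moment_deriv_le[OF u r0 \<psi> p] form_nonneg[of "\<lambda>x. (exp (\<psi> x) * u r x) ^ p"] by (simp add: \<kappa>_def)
    ultimately show "\<exists>y. (g has_real_derivative y) (at r) \<and> y \<le> 0"
      by (metis exp_ge_zero mult_nonneg_nonpos)
  qed (use s in simp)
  then have le: "exp (\<kappa> * t) * g t \<le> exp (\<kappa> * t) * g s" by simp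
  have gt: "exp (\<kappa> * t) * g t = moment \<psi> u (2 * p) t"
    by (simp add: g_def exp_minus)
  have gs: "exp (\<kappa> * t) * g s = exp (\<kappa> * (t - s)) * moment \<psi> u (2 * p) s"
    by (simp add: g_def exp_minus exp_diff right_diff_distrib divide_inverse)
  show ?thesis using le unfolding gt gs unfolding \<kappa>_def .
qed

section \<open>Duality and construction of the semigroup\<close>

text \<open>The pairing of u at time s with w at time T - s is constant in s, because
  \<open>avg\<close> is symmetric with respect to m and the \<Lambda> terms cancel.\<close>

lemma heat_duality:
  assumes u: "heat_sol u" and w: "heat_sol w" and T: "T \<ge> 0"
  shows "(\<Sum>x\<in>V. m x * (u T x * w 0 x)) = (\<Sum>x\<in>V. m x * (u 0 x * w T x))"
proof (cases "T = 0")
  case False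
  define f where "f s = (\<Sum>x\<in>V. m x * (u s x * w (T - s) x))" for s
  have der: "(f has_real_derivative 0) (at s)" if s: "0 \<le> s" "s \<le> T" for s
  proof -
    have "(f has_real_derivative (\<Sum>x\<in>V. m x * ((avg (u s) x - \<Lambda> * u s x) * w (T - s) x
        + - (avg (w (T - s)) x - \<Lambda> * w (T - s) x) * u s x))) (at s)"
      unfolding f_def
    proof (rule DERIV_sum)
      fix x assume x: "x \<in> V"
      have 1: "((\<lambda>s. u s x) has_real_derivative avg (u s) x - \<Lambda> * u s x) (at s)"
        using u s x by (simp add: heat_sol_def)
      have "((\<lambda>s. w s x) has_real_derivative avg (w (T - s)) x - \<Lambda> * w (T - s) x) (at (T - s))"
        using w s x by (simp add: heat_sol_def)
      moreover have "((\<lambda>s. T - s) has_real_derivative - 1) (at s)"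
        by (auto intro!: derivative_eq_intros)
      ultimately have 2: "((\<lambda>s. w (T - s) x) has_real_derivative (avg (w (T - s)) x - \<Lambda> * w (T - s) x) * - 1) (at s)"
        by (rule DERIV_chain2[where f = "\<lambda>s. w s x" and g = "\<lambda>s. T - s"])
      show "((\<lambda>s. m x * (u s x * w (T - s) x)) has_real_derivative m x * ((avg (u s) x - \<Lambda> * u s x) * w (T - s) x
        + - (avg (w (T - s)) x - \<Lambda> * w (T - s) x) * u s x)) (at s)"
        by (rule derivative_eq_intros 1 2 refl)+ (simp add: algebra_simps)
    qed
    also have "(\<Sum>x\<in>V. m x * ((avg (u s) x - \<Lambda> * u s x) * w (T - s) x
        + - (avg (w (T - s)) x - \<Lambda> * w (T - s) x) * u s x))
        = (\<Sum>x\<in>V. \<Sum>y\<in>V. c x y * (u s y * w (T - s) x)) - (\<Sum>x\<in>V. \<Sum>y\<in>V. c x y * (w (T - s) y * u s x))"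
      unfolding sum_subtractf[symmetric]
    proof (rule sum.cong[OF refl])
      fix x assume "x \<in> V"
      then have mx: "m x * avg g x = (\<Sum>y\<in>V. c x y * g y)" for g
        using m_pos[of x] by (simp add: avg_def)
      have "m x * ((avg (u s) x - \<Lambda> * u s x) * w (T - s) x + - (avg (w (T - s)) x - \<Lambda> * w (T - s) x) * u s x)
        = (m x * avg (u s) x) * w (T - s) x - (m x * avg (w (T - s)) x) * u s x"
        by (simp add: algebra_simps)
      then show "m x * ((avg (u s) x - \<Lambda> * u s x) * w (T - s) x + - (avg (w (T - s)) x - \<Lambda> * w (T - s) x) * u s x)
        = (\<Sum>y\<in>V. c x y * (u s y * w (T - s) x) - c x y * (w (T - s) y * u s x))"
        unfolding mx by (simp add: sum_distrib_right sum_subtractf mult.assoc)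
    qed
    also have "(\<Sum>x\<in>V. \<Sum>y\<in>V. c x y * (w (T - s) y * u s x)) = (\<Sum>x\<in>V. \<Sum>y\<in>V. c x y * (u s y * w (T - s) x))"
      by (subst sum.swap) (simp add: c_sym[of _ _] mult.commute)
    finally show ?thesis by simp
  qed
  have "f T = f 0"
    using False T der by (intro DERIV_isconst_end) (auto intro!: continuous_at_imp_continuous_on DERIV_isCont)
  then show ?thesis by (simp add: f_def)
qed simp

text \<open>This is exp(t (avg - \<Lambda>)) f, with the scalar factor pulled out. In this form its
  terms can be compared one by one with the Poisson series of the chain.\<close>

definition flow :: "('a \<Rightarrow> real) \<Rightarrow> real \<Rightarrow> 'a \<Rightarrow> real" where
  "flow f t x = exp (- \<Lambda> * t) * (\<Sum>n. (avg ^^ n) f x / fact n * t ^ n)"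

lemma avg_nonneg: "(\<And>y. y \<in> V \<Longrightarrow> f y \<ge> 0) \<Longrightarrow> x \<in> V \<Longrightarrow> avg f x \<ge> 0"
  using m_pos[of x] c_nonneg unfolding avg_def by (intro divide_nonneg_nonneg sum_nonneg) auto

lemma avg_pow_nonneg:
  assumes "\<And>y. y \<in> V \<Longrightarrow> f y \<ge> 0"
  shows "x \<in> V \<Longrightarrow> (avg ^^ n) f x \<ge> 0"
  by (induction n arbitrary: x) (auto simp: assms avg_nonneg)

lemma avg_pow_bound:
  assumes "\<And>y. y \<in> V \<Longrightarrow> \<bar>f y\<bar> \<le> B"
  shows "x \<in> V \<Longrightarrow> \<bar>(avg ^^ n) f x\<bar> \<le> B * \<Lambda> ^ n"
proof (induction n arbitrary: x)
  case (Suc n)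
  let ?g = "(avg ^^ n) f"
  have B0: "B * \<Lambda> ^ n \<ge> 0" using Suc.IH[OF Suc.prems] by simp
  have mx: "m x > 0" using Suc.prems by (rule m_pos)
  have "\<bar>\<Sum>y\<in>V. c x y * ?g y\<bar> \<le> (\<Sum>y\<in>V. \<bar>c x y * ?g y\<bar>)" by (rule sum_abs)
  also have "\<dots> \<le> (\<Sum>y\<in>V. c x y * (B * \<Lambda> ^ n))"
    using Suc.IH c_nonneg by (intro sum_mono) (auto simp: abs_mult intro!: mult_left_mono)
  also have "\<dots> = (\<Sum>y\<in>V. c x y) * (B * \<Lambda> ^ n)" by (simp add: sum_distrib_right)
  also have "\<dots> \<le> (\<Lambda> * m x) * (B * \<Lambda> ^ n)"
    using row_sum_le[OF Suc.prems] B0 by (intro mult_right_mono) auto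
  finally have "\<bar>\<Sum>y\<in>V. c x y * ?g y\<bar> / m x \<le> B * \<Lambda> ^ Suc n"
    using mx by (simp add: field_simps)
  then show ?case using mx by (simp add: avg_def[of ?g])
qed (use assms in simp)

lemma flow_series_summable:
  assumes "x \<in> V"
  shows "summable (\<lambda>n. (avg ^^ n) f x / fact n * t ^ n)"
proof -
  define B where "B = (\<Sum>y\<in>V. \<bar>f y\<bar>)"
  have B: "\<bar>f y\<bar> \<le> B" if "y \<in> V" for y
    unfolding B_def using finite_V that by (intro member_le_sum) auto
  show ?thesis
  proof (rule summable_comparison_test')
    have "summable (\<lambda>n. inverse (fact n) * (\<Lambda> * \<bar>t\<bar>) ^ n)" by (rule summable_exp)
    then show "summable (\<lambda>n. B * (inverse (fact n) * (\<Lambda> * \<bar>t\<bar>) ^ n))" by (rule summable_mult)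
    fix n :: nat assume "n \<ge> 0"
    have "norm ((avg ^^ n) f x / fact n * t ^ n) = \<bar>(avg ^^ n) f x\<bar> * (\<bar>t\<bar> ^ n / fact n)"
      by (simp add: abs_mult power_abs)
    also have "\<dots> \<le> (B * \<Lambda> ^ n) * (\<bar>t\<bar> ^ n / fact n)"
      using avg_pow_bound[OF B assms] by (intro mult_right_mono) auto
    finally show "norm ((avg ^^ n) f x / fact n * t ^ n) \<le> B * (inverse (fact n) * (\<Lambda> * \<bar>t\<bar>) ^ n)"
      by (simp add: power_mult_distrib field_simps)
  qed
qed

lemma flow_0: "flow f 0 x = f x"
  using powser_zero[of "\<lambda>n. (avg ^^ n) f x / fact n"] by (simp add: flow_def)

lemma flow_heat_sol:
  assumes "\<And>x. x \<in> V \<Longrightarrow> f x \<ge> 0"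
  shows "heat_sol (flow f)"
  unfolding heat_sol_def
proof (intro allI impI ballI conjI)
  fix t x assume t: "(t::real) \<ge> 0" and x: "x \<in> V"
  define G where "G y s = (\<Sum>n. (avg ^^ n) f y / fact n * s ^ n)" for y s
  have "G x t \<ge> 0"
    unfolding G_def using t avg_pow_nonneg[OF assms x]
    by (intro suminf_nonneg flow_series_summable x) auto
  then show "flow f t x \<ge> 0" by (simp add: flow_def G_def)
  have "(G x has_real_derivative (\<Sum>n. diffs (\<lambda>n. (avg ^^ n) f x / fact n) n * t ^ n)) (at t)"
    unfolding G_def by (rule termdiffs_strong_converges_everywhere) (rule flow_series_summable[OF x])
  \<comment> \<open>Differentiation cancels one factor of the factorial and leaves one more
    application of \<open>avg\<close>; this is a finite sum over y, which can be taken out of the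
    series.\<close>
  also have "diffs (\<lambda>n. (avg ^^ n) f x / fact n) = (\<lambda>n. (\<Sum>y\<in>V. c x y * (avg ^^ n) f y) / m x / fact n)"
  proof
    fix n
    have "real (Suc n) * (a / (real (Suc n) * fact n)) = a / fact n" for a by (simp del: of_nat_Suc)
    then show "diffs (\<lambda>n. (avg ^^ n) f x / fact n) n = (\<Sum>y\<in>V. c x y * (avg ^^ n) f y) / m x / fact n"
      by (simp add: diffs_def avg_def[of "(avg ^^ n) f"] del: of_nat_Suc)
  qed
  also have "(\<lambda>n. (\<Sum>y\<in>V. c x y * (avg ^^ n) f y) / m x / fact n * t ^ n)
      = (\<lambda>n. \<Sum>y\<in>V. c x y / m x * ((avg ^^ n) f y / fact n * t ^ n))"
    by (auto simp: sum_divide_distrib sum_distrib_right fun_eq_iff intro!: sum.cong)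
  also have "(\<Sum>n. \<Sum>y\<in>V. c x y / m x * ((avg ^^ n) f y / fact n * t ^ n)) = (\<Sum>y\<in>V. c x y / m x * G y t)"
    unfolding G_def
    by (rule sums_unique[symmetric], rule sums_sum, rule sums_mult, rule summable_sums, rule flow_series_summable)
  finally have "(G x has_real_derivative (\<Sum>y\<in>V. c x y / m x * G y t)) (at t)" .
  note [derivative_intros] = this
  have fl: "flow f s y = exp (- \<Lambda> * s) * G y s" for s y by (simp add: flow_def G_def)
  have "((\<lambda>s. exp (- \<Lambda> * s) * G x s) has_real_derivative
      (- \<Lambda> * exp (- \<Lambda> * t) * G x t + exp (- \<Lambda> * t) * (\<Sum>y\<in>V. c x y / m x * G y t))) (at t)"
    by (auto intro!: derivative_eq_intros)
  also have "- \<Lambda> * exp (- \<Lambda> * t) * G x t + exp (- \<Lambda> * t) * (\<Sum>y\<in>V. c x y / m x * G y t)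
      = avg (flow f t) x - \<Lambda> * flow f t x"
    by (simp add: avg_def fl sum_distrib_left sum_divide_distrib mult_ac)
  finally show "((\<lambda>s. flow f s x) has_real_derivative avg (flow f t) x - \<Lambda> * flow f t x) (at t)"
    by (simp add: fl)
qed

end

section \<open>From a Nash inequality to Gaussian bounds\<close>

text \<open>In the notation N = ||f||_2^2, F = ||f||_1, the inequality is up to a factor 2 the
  planar one N^2 \<le> K E F^2 when N \<ge> F^2, and the one-dimensional one N^3 \<le> K E F^4 when
  N \<le> F^2.\<close>

locale nash_network = killed_network +
  fixes K :: real
  assumes K_ge_1: "K \<ge> 1"
    and nash: "(\<And>x. x \<in> V \<Longrightarrow> f x \<ge> 0) \<Longrightarrow>
      (\<Sum>x\<in>V. m x * (f x)\<^sup>2) ^ 3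
        \<le> K * form f * (\<Sum>x\<in>V. m x * f x)\<^sup>2 * ((\<Sum>x\<in>V. m x * (f x)\<^sup>2) + (\<Sum>x\<in>V. m x * f x)\<^sup>2)"
begin

text \<open>Nash is applied to v^(2q), whose L1 norm is the 2q-th moment F and whose squared L2 norm
  is the 4q-th moment N. Discounting N by exp(\<kappa>t) and dividing by (F 0)^2 gives a quantity z
  to which \<open>cubic_decay\<close> applies.\<close>

lemma moment_step:
  assumes u: "heat_sol u" and s: "0 \<le> s" and \<tau>: "\<tau> > 0" and \<psi>: "lipschitz_weight \<sigma> \<psi>" and q: "q \<ge> 1"
  shows "moment \<psi> u (4 * q) (s + \<tau>)
    \<le> max (2 * K / \<tau>) (sqrt (K / \<tau>)) * exp (12 * (real q)\<^sup>2 * (sinh \<sigma>)\<^sup>2 * \<Lambda> * \<tau>) * (moment \<psi> u (2 * q) s)\<^sup>2"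
proof (cases "moment \<psi> u (4 * q) (s + \<tau>) = 0")
  case True
  have "max (2 * K / \<tau>) (sqrt (K / \<tau>)) \<ge> 0" using K_ge_1 \<tau> by (simp add: le_max_iff_disj)
  then show ?thesis unfolding True by simp
next
  case False
  define \<kappa> where "\<kappa> = 12 * (real q)\<^sup>2 * (sinh \<sigma>)\<^sup>2 * \<Lambda>"
  define N where "N t = moment \<psi> u (4 * q) (s + t)" for t
  define F where "F t = moment \<psi> u (2 * q) (s + t)" for t
  have eq4: "2 * (2 * q) = 4 * q" by simp
  \<comment> \<open>If N vanished at an earlier time, \<open>moment_growth\<close> would make it
    vanish at the end as well, contrary to the case assumption.\<close>
  have N0: "N t > 0" if t: "0 \<le> t" "t \<le> \<tau>" for t
  proof -
    have "moment \<psi> u (2 * (2 * q)) (s + \<tau>) \<le>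
        exp (3 * (real (2 * q))\<^sup>2 * (sinh \<sigma>)\<^sup>2 * \<Lambda> * (s + \<tau> - (s + t))) * moment \<psi> u (2 * (2 * q)) (s + t)"
      using s t q by (intro moment_growth[OF u _ _ \<psi>]) auto
    then have "N t \<noteq> 0" using False moment_nonneg[OF u, of "s + \<tau>" \<psi> "4 * q"] s \<tau>
      by (auto simp: N_def eq4)
    then show ?thesis using moment_nonneg[OF u, of "s + t" \<psi> "4 * q"] s t by (simp add: N_def)
  qed
  define E where "E t = form (\<lambda>x. (exp (\<psi> x) * u (s + t) x) ^ (2 * q))" for t
  have nash': "N t ^ 3 \<le> K * E t * (F t)\<^sup>2 * (N t + (F t)\<^sup>2)" if t: "0 \<le> t" for t
  proof -
    have "(exp (\<psi> x) * u (s + t) x) ^ (2 * q) \<ge> 0" if "x \<in> V" for x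
      using u s t that by (simp add: heat_sol_def)
    from nash[OF this] show ?thesis
      by (simp add: N_def F_def E_def moment_def mult.commute flip: power_mult)
  qed
  have F_growth: "F t \<le> exp (\<kappa> / 4 * t) * F 0" if t: "0 \<le> t" for t
    using moment_growth[OF u _ _ \<psi> q, of s "s + t"] s t by (simp add: F_def \<kappa>_def mult_ac)
  have F_nonneg: "F t \<ge> 0" if "0 \<le> t" for t
    using moment_nonneg[OF u] s that by (simp add: F_def)
  have F0: "F 0 > 0"
  proof (rule ccontr)
    assume "\<not> F 0 > 0"
    then have "F 0 = 0" using F_nonneg[of 0] by simp
    then have "N 0 ^ 3 \<le> 0" using nash'[of 0] by simp
    then show False using N0[of 0] \<tau> by (simp add: power_le_zero_eq)
  qed
  define z where "z t = exp (- \<kappa> * t) * N t / (F 0)\<^sup>2" for t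
  define z' where "z' t = exp (- \<kappa> * t) * (moment_deriv \<psi> u (4 * q) (s + t) - \<kappa> * N t) / (F 0)\<^sup>2" for t
  have "z \<tau> \<le> max (2 * K / \<tau>) (sqrt (K / \<tau>))"
  proof (rule cubic_decay[where z' = z'])
    fix t assume t: "0 \<le> t" "t \<le> \<tau>"
    show "z t > 0" using N0[OF t] F0 by (simp add: z_def)
    have "(N has_real_derivative moment_deriv \<psi> u (4 * q) (s + t)) (at t)"
    proof -
      have "0 \<le> t + s" using s t by simp
      from moment_has_derivative[OF u this, of \<psi> "4 * q"]
      have "((\<lambda>r. moment \<psi> u (4 * q) (r + s)) has_real_derivative moment_deriv \<psi> u (4 * q) (t + s)) (at t)"
        by (simp only: DERIV_shift)
      then show ?thesis unfolding N_def by (simp only: add.commute)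
    qed
    note [derivative_intros] = this
    show "(z has_real_derivative z' t) (at t)"
      unfolding z_def z'_def using F0
      by (auto intro!: derivative_eq_intros simp: field_simps)
    define w where "w = exp (- \<kappa> * t)"
    \<comment> \<open>G = (F 0)^2 exp(\<kappa>t) dominates (F t)^2, since F grows at rate at most
      \<kappa>/4, and N = z G. Replacing (F t)^2 by G in Nash's inequality makes the powers of G
      cancel.\<close>
    define G where "G = (F 0)\<^sup>2 / w"
    have w: "w > 0" by (simp add: w_def)
    have G: "G > 0" using F0 w by (simp add: G_def)
    have FG: "(F t)\<^sup>2 \<le> G"
    proof -
      have "(F t)\<^sup>2 \<le> (exp (\<kappa> / 4 * t) * F 0)\<^sup>2"
        using F_growth F_nonneg t by (intro power_mono) auto
      also have "\<dots> = exp (\<kappa> * t / 2) * (F 0)\<^sup>2"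
        by (simp add: power_mult_distrib flip: exp_double)
      also have "\<dots> \<le> exp (\<kappa> * t) * (F 0)\<^sup>2"
        using t rate_pos by (intro mult_right_mono) (auto simp: \<kappa>_def)
      also have "\<dots> = G" by (simp add: G_def w_def exp_minus field_simps)
      finally show ?thesis .
    qed
    have zN: "N t = z t * G" using w F0 by (simp add: z_def G_def w_def)
    have E0: "E t \<ge> 0" unfolding E_def by (rule form_nonneg)
    have "(z t * G) ^ 3 \<le> K * E t * (F t)\<^sup>2 * (N t + (F t)\<^sup>2)"
      using nash'[of t] t by (simp add: zN)
    also have "\<dots> \<le> K * E t * G * (N t + G)"
      using FG E0 K_ge_1 N0[OF t] G by (intro mult_mono mult_nonneg_nonneg) auto
    also have "\<dots> = K * E t * (1 + z t) * G\<^sup>2" by (simp add: zN algebra_simps power2_eq_square)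
    finally have "z t ^ 3 * G * G\<^sup>2 \<le> K * E t * (1 + z t) * G\<^sup>2"
      by (simp add: power_mult_distrib power3_eq_cube power2_eq_square mult_ac)
    then have le: "z t ^ 3 * G \<le> K * E t * (1 + z t)" using G by simp
    have "moment_deriv \<psi> u (4 * q) (s + t) - \<kappa> * N t \<le> - E t"
      using moment_deriv_le[OF u _ \<psi>, of "s + t" "2 * q"] s t q
      by (simp add: E_def N_def \<kappa>_def eq4 power_mult_distrib)
    then have "z' t \<le> exp (- \<kappa> * t) * (- E t) / (F 0)\<^sup>2"
      unfolding z'_def by (intro divide_right_mono mult_left_mono) auto
    then have "z' t \<le> - E t / G" using w by (simp add: G_def w_def mult.commute)
    then have "K * z' t * (1 + z t) \<le> K * (- E t / G) * (1 + z t)"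
      using K_ge_1 \<open>z t > 0\<close> by (intro mult_right_mono mult_left_mono) auto
    also have "\<dots> = - ((K * E t * (1 + z t)) / G)" by simp
    also have "\<dots> \<le> - (z t ^ 3)" using le G by (simp add: pos_le_divide_eq)
    finally show "K * z' t * (1 + z t) \<le> - ((z t) ^ 3)" .
  qed (use \<tau> K_ge_1 in auto)
  then have "exp (\<kappa> * \<tau>) * (F 0)\<^sup>2 * z \<tau> \<le> exp (\<kappa> * \<tau>) * (F 0)\<^sup>2 * max (2 * K / \<tau>) (sqrt (K / \<tau>))"
    by (rule mult_left_mono) simp
  moreover have "exp (\<kappa> * \<tau>) * (F 0)\<^sup>2 * z \<tau> = N \<tau>"
    using F0 by (simp add: z_def exp_minus field_simps)
  ultimately show ?thesis by (simp add: N_def F_def \<kappa>_def mult_ac)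
qed

text \<open>The growth rate of the 4 * 2^i-th moment is proportional to 4^i, so on time steps
  proportional to 4^-i every step costs the same factor exp(9S). After the 2^n-th root this factor
  survives only once; the initial stretch of length T / 4^n contributes at most exp(S), which makes
  10.\<close>

lemma moser_iteration:
  assumes u: "heat_sol u" and T: "T > 0" and \<psi>: "lipschitz_weight \<sigma> \<psi>" and y: "y \<in> V"
  shows "(exp (\<psi> y) * u T y)\<^sup>2
    \<le> 16 * K * max (1 / T) (1 / sqrt T) * exp (10 * (sinh \<sigma>)\<^sup>2 * \<Lambda> * T) * moment \<psi> u 2 0"
proof -
  define H where "H = max (1 / T) (1 / sqrt T)"
  define S where "S = (sinh \<sigma>)\<^sup>2 * \<Lambda> * T"
  define b where "b = K * H * exp (9 * S)"
  define R where "R = 16 * b * exp S * moment \<psi> u 2 0"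
  have S0: "S \<ge> 0" using T rate_pos by (simp add: S_def)
  have H: "H > 0" "1 / T \<le> H" "1 / sqrt T \<le> H" using T by (auto simp: H_def less_max_iff_disj)
  have b: "b > 0" using H K_ge_1 by (simp add: b_def)
  have R: "R \<ge> 0" using b moment_nonneg[OF u, of 0 \<psi> 2] by (simp add: R_def)
  have "(exp (\<psi> y) * u T y)\<^sup>2 \<le> R"
  proof (rule le_if_power_le)
    fix n :: nat assume n: "n \<ge> 1"
    \<comment> \<open>The iteration starts at \<open>T / 4 ^ n\<close> so that its \<open>n\<close> steps end exactly at time \<open>T\<close>; only \<open>n\<close> tends to infinity.\<close>
    define t where "t i = T / 4 ^ n + (T - T / 4 ^ i)" for i :: nat
    define a where "a i = moment \<psi> u (2 * 2 ^ i) (t i)" for i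
    \<comment> \<open>The normalization b * 4^(i+2) turns the recursion a (i+1) \<le> b 4^(i+1) (a
      i)^2 into e (i+1) \<le> (e i)^2.\<close>
    define e where "e i = b * 4 ^ (i + 2) * a i" for i
    have t0: "t i \<ge> 0" for i
    proof -
      have "T / 4 ^ i \<le> T" using T by (simp add: field_simps)
      then show ?thesis using T by (simp add: t_def)
    qed
    have a0: "a i \<ge> 0" for i unfolding a_def by (rule moment_nonneg[OF u t0])
    have e0: "e i \<ge> 0" for i using a0 b by (simp add: e_def)
    have step: "a (Suc i) \<le> b * 4 ^ (i + 1) * (a i)\<^sup>2" for i
    proof -
      \<comment> \<open>This is the difference of T / 4^i and T / 4^(i+1), so that 12 * 4^i * \<tau>
        = 9 T.\<close>
      define \<tau> where "\<tau> = 3 * T / 4 ^ (i + 1)"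
      define X where "X = K * 4 ^ (i + 1)"
      have \<tau>: "\<tau> > 0" using T by (simp add: \<tau>_def)
      have ti: "t (Suc i) = t i + \<tau>" by (simp add: t_def \<tau>_def field_simps)
      have X1: "X \<ge> 1"
        using mult_mono[of 1 K 1 "4 ^ (i + 1)"] K_ge_1 one_le_power[of "4::real" "i + 1"] by (simp add: X_def)
      have m1: "2 * K / \<tau> \<le> X * H"
      proof -
        have "2 * K / \<tau> = (2 / 3) * X * (1 / T)" by (simp add: \<tau>_def X_def)
        also have "\<dots> \<le> 1 * X * H" using X1 H T by (intro mult_mono) auto
        finally show ?thesis by simp
      qed
      have m2: "sqrt (K / \<tau>) \<le> X * H"
      proof -
        have "K / \<tau> = X / 3 * (1 / T)" by (simp add: \<tau>_def X_def)
        then have "sqrt (K / \<tau>) = sqrt (X / 3) * (1 / sqrt T)"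
          by (simp only: real_sqrt_mult real_sqrt_divide real_sqrt_one)
        also have "\<dots> \<le> X * H"
        proof (intro mult_mono)
          have "X / 3 \<le> X\<^sup>2" using X1 by (simp add: power2_eq_square)
          then show "sqrt (X / 3) \<le> X" using X1 by (intro real_le_lsqrt) auto
        qed (use X1 H T in auto)
        finally show ?thesis .
      qed
      have "a (Suc i) = moment \<psi> u (4 * 2 ^ i) (t i + \<tau>)" by (simp add: a_def ti)
      also have "\<dots> \<le> max (2 * K / \<tau>) (sqrt (K / \<tau>)) *
          exp (12 * (real (2 ^ i))\<^sup>2 * (sinh \<sigma>)\<^sup>2 * \<Lambda> * \<tau>) * (moment \<psi> u (2 * 2 ^ i) (t i))\<^sup>2"
        by (rule moment_step[OF u t0 \<tau> \<psi>]) simp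
      also have "12 * (real (2 ^ i))\<^sup>2 * (sinh \<sigma>)\<^sup>2 * \<Lambda> * \<tau> = 9 * S"
      proof -
        have "(real (2 ^ i))\<^sup>2 = 4 ^ i" by (simp add: power2_eq_square flip: power_mult_distrib)
        then show ?thesis by (simp add: \<tau>_def S_def)
      qed
      also have "max (2 * K / \<tau>) (sqrt (K / \<tau>)) * exp (9 * S) * (moment \<psi> u (2 * 2 ^ i) (t i))\<^sup>2
          \<le> (X * H) * exp (9 * S) * (moment \<psi> u (2 * 2 ^ i) (t i))\<^sup>2"
        using m1 m2 by (intro mult_right_mono) auto
      also have "\<dots> = b * 4 ^ (i + 1) * (a i)\<^sup>2" by (simp add: X_def b_def a_def)
      finally show ?thesis .
    qed
    have estep: "e (Suc i) \<le> (e i)\<^sup>2" for i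
    proof -
      have "e (Suc i) \<le> b * 4 ^ (Suc i + 2) * (b * 4 ^ (i + 1) * (a i)\<^sup>2)"
        unfolding e_def using b by (intro mult_left_mono step) auto
      also have "\<dots> = (e i)\<^sup>2" by (simp add: e_def power2_eq_square)
      finally show ?thesis .
    qed
    have en: "e i \<le> (e 0) ^ (2 ^ i)" for i
    proof (induction i)
      case (Suc i)
      have "e (Suc i) \<le> (e i)\<^sup>2" by (rule estep)
      also have "\<dots> \<le> ((e 0) ^ (2 ^ i))\<^sup>2" using Suc e0 by (intro power_mono) auto
      also have "\<dots> = (e 0) ^ (2 ^ Suc i)" by (simp add: mult.commute flip: power_mult)
      finally show ?case .
    qed simp
    have "a 0 \<le> exp S * moment \<psi> u 2 0"
    proof -
      have "moment \<psi> u (2 * 1) (t 0) \<le> exp (3 * (real 1)\<^sup>2 * (sinh \<sigma>)\<^sup>2 * \<Lambda> * (t 0 - 0)) * moment \<psi> u (2 * 1) 0"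
        using t0[of 0] by (intro moment_growth[OF u _ _ \<psi>]) auto
      also have "\<dots> \<le> exp S * moment \<psi> u (2 * 1) 0"
      proof (intro mult_right_mono)
        have "(4::real) ^ 1 \<le> 4 ^ n" using n by (intro power_increasing) auto
        then have "3 / 4 ^ n \<le> (1::real)" by simp
        then have "S * (3 / 4 ^ n) \<le> S * 1" using S0 by (rule mult_left_mono)
        then show "exp (3 * (real 1)\<^sup>2 * (sinh \<sigma>)\<^sup>2 * \<Lambda> * (t 0 - 0)) \<le> exp S"
          by (simp add: t_def S_def mult_ac)
      qed (use moment_nonneg[OF u] in auto)
      finally show ?thesis by (simp add: a_def)
    qed
    then have e0R: "e 0 \<le> R"
      using b mult_left_mono[of "a 0" "exp S * moment \<psi> u 2 0" "16 * b"] by (simp add: e_def R_def mult_ac)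
    have "m y * ((exp (\<psi> y) * u T y)\<^sup>2) ^ 2 ^ n = m y * (exp (\<psi> y) * u (t n) y) ^ (2 * 2 ^ n)"
      by (simp add: t_def flip: power_mult)
    also have "\<dots> \<le> a n"
      unfolding a_def moment_def
    proof (rule member_le_sum[OF y _ finite_V])
      fix x assume "x \<in> V - {y}"
      then show "0 \<le> m x * (exp (\<psi> x) * u (t n) x) ^ (2 * 2 ^ n)"
        using u m_pos[of x] t0[of n] by (simp add: heat_sol_def)
    qed
    also have "\<dots> \<le> e n / b"
    proof -
      have "1 * a n \<le> 4 ^ (n + 2) * a n"
        using a0[of n] one_le_power[of "4::real" "n + 2"] by (intro mult_right_mono) auto
      then show ?thesis using b by (simp add: e_def field_simps)
    qed
    also have "\<dots> \<le> R ^ (2 ^ n) / b"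
      using en[of n] power_mono[OF e0R e0, of "2 ^ n"] b by (intro divide_right_mono) auto
    \<comment> \<open>The prefactor depends on the mass at y but not on n, so it leaves no trace in
      the limit.\<close>
    finally show "((exp (\<psi> y) * u T y)\<^sup>2) ^ 2 ^ n \<le> (1 / (m y * b)) * R ^ 2 ^ n"
      using m_pos[OF y] b by (simp add: field_simps)
  qed (use R in auto)
  also have "R = 16 * K * H * exp (10 * S) * moment \<psi> u 2 0"
    by (simp add: R_def b_def mult_exp_exp[symmetric] exp_add[symmetric])
  finally show ?thesis by (simp add: H_def S_def mult_ac)
qed

text \<open>The time interval is split in half. The unit mass at x, where \<psi> vanishes, is first
  estimated in the tilted L2 norm, with squared norm S \<le> M; the second half then carries L2 to
  the value at y. Each half contributes a factor sqrt M.\<close>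

theorem tilted_kernel_bound:
  assumes u: "heat_sol u" and init: "\<And>z. z \<in> V \<Longrightarrow> u 0 z = (if z = x then 1 / m x else 0)"
    and t: "t > 0" and \<psi>: "lipschitz_weight \<sigma> \<psi>" and x: "x \<in> V" "\<psi> x = 0" and y: "y \<in> V"
  shows "exp (\<psi> y) * u t y
    \<le> 32 * K * max (1 / t) (1 / sqrt t) * exp (5 * (sinh \<sigma>)\<^sup>2 * \<Lambda> * t)"
proof -
  define T where "T = t / 2"
  define M where "M = 16 * K * max (1 / T) (1 / sqrt T) * exp (10 * (sinh \<sigma>)\<^sup>2 * \<Lambda> * T)"
  define S where "S = moment \<psi> u 2 T"
  define f where "f z = (exp (\<psi> z))\<^sup>2 * u T z" for z
  have T: "T > 0" and tT: "t = T + T" using t by (auto simp: T_def)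
  have M0: "M \<ge> 0" using K_ge_1 T by (auto simp: M_def le_max_iff_disj)
  have S0: "S \<ge> 0" unfolding S_def using T by (intro moment_nonneg[OF u]) auto
  have f0: "f z \<ge> 0" if "z \<in> V" for z using u T that by (simp add: f_def heat_sol_def)
  have w: "heat_sol (flow f)" using f0 by (rule flow_heat_sol)
  \<comment> \<open>The \<open>L\<^sup>1\<close> to \<open>L\<^sup>2\<close> bound on the first half of the time interval, by duality: it is the
    \<open>L\<^sup>2\<close> to \<open>L\<^sup>\<infinity>\<close> bound at \<open>x\<close> for the weight \<open>- \<psi>\<close>.\<close>
  have "S = (\<Sum>z\<in>V. m z * (u T z * flow f 0 z))"
    by (simp add: S_def moment_def flow_0 f_def power_mult_distrib power2_eq_square mult_ac)
  also have "\<dots> = (\<Sum>z\<in>V. m z * (u 0 z * flow f T z))"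
    using heat_duality[OF u w] T by simp
  also have "\<dots> = (\<Sum>z\<in>V. if z = x then flow f T x else 0)"
    using m_pos by (intro sum.cong) (auto simp: init less_imp_neq[symmetric])
  also have "\<dots> = flow f T x" using x finite_V by simp
  finally have Sw: "S = flow f T x" .
  have "S\<^sup>2 \<le> M * moment (\<lambda>x. - \<psi> x) (flow f) 2 0"
    using moser_iteration[OF w T lipschitz_weight_uminus[OF \<psi>] x(1)] x(2) by (simp add: Sw M_def)
  also have "moment (\<lambda>x. - \<psi> x) (flow f) 2 0 = S"
    unfolding S_def moment_def
    by (intro sum.cong) (simp_all add: flow_0 f_def exp_minus field_simps power2_eq_square)
  finally have SM: "S \<le> M" using S0 M0 by (cases "S = 0") (auto simp: power2_eq_square)
  have "(exp (\<psi> y) * u t y)\<^sup>2 \<le> M * moment \<psi> (\<lambda>t. u (T + t)) 2 0"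
    using moser_iteration[OF heat_sol_shift[OF u, of T] T \<psi> y] T by (simp add: tT M_def)
  also have "\<dots> = M * S" by (simp add: S_def moment_def)
  also have "\<dots> \<le> M\<^sup>2" using SM M0 by (simp add: power2_eq_square mult_left_mono)
  finally have "exp (\<psi> y) * u t y \<le> M" using M0 by (rule power2_le_imp_le)
  also have "M \<le> 16 * K * (2 * max (1 / t) (1 / sqrt t)) * exp (10 * (sinh \<sigma>)\<^sup>2 * \<Lambda> * T)"
    unfolding M_def
  proof (intro mult_right_mono mult_left_mono)
    have "sqrt 2 \<le> (2::real)" by (rule real_le_lsqrt) auto
    then have "1 / sqrt T \<le> 2 * (1 / sqrt t)"
      using T by (simp add: tT[unfolded mult_2[symmetric]] real_sqrt_mult field_simps)
    then show "max (1 / T) (1 / sqrt T) \<le> 2 * max (1 / t) (1 / sqrt t)"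
      by (auto simp: T_def max_def field_simps split: if_splits)
  qed (use K_ge_1 in auto)
  finally show ?thesis by (simp add: T_def mult_ac)
qed

end

section \<open>Interpolation of moments and total variation\<close>

text \<open>Log-convexity of moments: Cauchy-Schwarz gives A^2 \<le> F C and C^2 \<le> A Q with C
  the third moment, hence A^4 \<le> F^2 A Q.\<close>

lemma cube_sum_le:
  fixes m f :: "'a \<Rightarrow> real"
  assumes m: "\<And>x. x \<in> I \<Longrightarrow> m x \<ge> 0" and f: "\<And>x. x \<in> I \<Longrightarrow> f x \<ge> 0"
  shows "(\<Sum>x\<in>I. m x * (f x)\<^sup>2) ^ 3 \<le> (\<Sum>x\<in>I. m x * f x)\<^sup>2 * (\<Sum>x\<in>I. m x * (f x) ^ 4)"
proof -
  define A where "A = (\<Sum>x\<in>I. m x * (f x)\<^sup>2)"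
  define F where "F = (\<Sum>x\<in>I. m x * f x)"
  define C where "C = (\<Sum>x\<in>I. m x * (f x) ^ 3)"
  define Q where "Q = (\<Sum>x\<in>I. m x * (f x) ^ 4)"
  have nn: "A \<ge> 0" "F \<ge> 0" "C \<ge> 0" "Q \<ge> 0"
    unfolding A_def F_def C_def Q_def using m f by (auto intro!: sum_nonneg)
  have cs: "(\<Sum>x\<in>I. g x)\<^sup>2 \<le> (\<Sum>x\<in>I. a x) * (\<Sum>x\<in>I. b x)"
    if "\<And>x. x \<in> I \<Longrightarrow> a x \<ge> 0" "\<And>x. x \<in> I \<Longrightarrow> b x \<ge> 0" "\<And>x. x \<in> I \<Longrightarrow> g x \<ge> 0"
      "\<And>x. x \<in> I \<Longrightarrow> (g x)\<^sup>2 = a x * b x" for g a b :: "'a \<Rightarrow> real"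
  proof -
    have "(\<Sum>x\<in>I. g x) = (\<Sum>x\<in>I. sqrt (a x) * sqrt (b x))"
      using that by (intro sum.cong) (auto simp flip: real_sqrt_mult intro!: real_sqrt_unique[symmetric])
    then have "(\<Sum>x\<in>I. g x)\<^sup>2 \<le> (\<Sum>x\<in>I. (sqrt (a x))\<^sup>2) * (\<Sum>x\<in>I. (sqrt (b x))\<^sup>2)"
      using Cauchy_Schwarz_ineq_sum by simp
    then show ?thesis using that by simp
  qed
  have 1: "A\<^sup>2 \<le> F * C" unfolding A_def F_def C_def
    by (rule cs) (use m f in \<open>auto simp: power2_eq_square power3_eq_cube\<close>)
  have 2: "C\<^sup>2 \<le> A * Q" unfolding A_def Q_def C_def
    by (rule cs) (use m f in \<open>auto simp: power2_eq_square power3_eq_cube power4_eq_xxxx\<close>)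
  have "A ^ 3 \<le> F\<^sup>2 * Q"
  proof (cases "A = 0")
    case False
    then have A: "A > 0" using nn by simp
    have "A * A ^ 3 = (A\<^sup>2)\<^sup>2" by (simp add: power2_eq_square power3_eq_cube)
    also have "\<dots> \<le> (F * C)\<^sup>2" using 1 by (intro power_mono) auto
    also have "\<dots> = F\<^sup>2 * C\<^sup>2" by (simp add: power_mult_distrib)
    also have "\<dots> \<le> F\<^sup>2 * (A * Q)" using 2 by (intro mult_left_mono) auto
    finally have "A * A ^ 3 \<le> A * (F\<^sup>2 * Q)" by (simp add: mult_ac)
    then show ?thesis using A by simp
  qed (use nn in simp)
  then show ?thesis by (simp add: A_def F_def Q_def)
qed

lemma total_variation_int:
  fixes h :: "int \<Rightarrow> real"
  assumes "a \<le> b"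
  shows "\<bar>h a - h b\<bar> \<le> (\<Sum>i\<in>{a..<b}. \<bar>h i - h (i + 1)\<bar>)"
  using assms
proof (induction rule: int_ge_induct)
  case (step b)
  have "{a..<b + 1} = insert b {a..<b}" using step by auto
  then have "(\<Sum>i\<in>{a..<b + 1}. \<bar>h i - h (i + 1)\<bar>) = \<bar>h b - h (b + 1)\<bar> + (\<Sum>i\<in>{a..<b}. \<bar>h i - h (i + 1)\<bar>)"
    by simp
  then show ?case using step.IH by linarith
qed simp

lemma total_variation_nat:
  fixes h :: "nat \<Rightarrow> real"
  assumes "a \<le> b"
  shows "\<bar>h a - h b\<bar> \<le> (\<Sum>i\<in>{a..<b}. \<bar>h i - h (Suc i)\<bar>)"
  using assms
proof (induction rule: dec_induct)
  case (step b)
  then show ?case by (simp add: sum.atLeastLessThan_Suc)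
qed simp

section \<open>The Nash inequality on the graph\<close>

text \<open>A segment all of whose points have both coordinates at least as large in absolute value
  as those of u stays outside the disk, because u does.\<close>

lemma adj_outward:
  assumes u: "u \<in> plane_verts \<epsilon> k" and d: "dist (plane_pt k v) (plane_pt k w) = 1 / 2 ^ k"
    and le: "\<And>z. z \<in> closed_segment (plane_pt k v) (plane_pt k w) \<Longrightarrow>
      \<bar>fst (plane_pt k u)\<bar> \<le> \<bar>fst z\<bar> \<and> \<bar>snd (plane_pt k u)\<bar> \<le> \<bar>snd z\<bar>"
  shows "adj \<epsilon> k (Plane v) (Plane w)"
proof -
  have big: "norm z > \<epsilon>" if z: "z \<in> closed_segment (plane_pt k v) (plane_pt k w)" for z
  proof -
    have "norm (plane_pt k u) \<le> norm z"
      using le[OF z] unfolding norm_prod_def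
      by (intro real_sqrt_le_mono add_mono power_mono) auto
    then show ?thesis using u by (simp add: plane_verts_def)
  qed
  show ?thesis using big[of "plane_pt k v"] big[of "plane_pt k w"] big d
    by (force simp: plane_verts_def)
qed

lemma abs_le_on_segment:
  fixes p q r c :: real
  assumes "0 \<le> c" "c \<le> 1" "0 \<le> p \<and> p \<le> q \<and> p \<le> r \<or> p \<le> 0 \<and> q \<le> p \<and> r \<le> p"
  shows "\<bar>p\<bar> \<le> \<bar>(1 - c) * q + c * r\<bar>"
  using assms(3)
proof
  assume *: "0 \<le> p \<and> p \<le> q \<and> p \<le> r"
  have "(1 - c) * p + c * p \<le> (1 - c) * q + c * r"
    using assms * by (intro add_mono mult_left_mono) auto
  then show ?thesis using * by (simp add: algebra_simps)
next
  assume *: "p \<le> 0 \<and> q \<le> p \<and> r \<le> p"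
  have "(1 - c) * q + c * r \<le> (1 - c) * p + c * p"
    using assms * by (intro add_mono mult_left_mono) auto
  then show ?thesis using * by (simp add: algebra_simps)
qed

text \<open>These are the edges of the horizontal ray from (a, b) pointing away from the vertical
  axis, to the right for a \<ge> 0 and to the left for a \<le> 0.\<close>

lemma adj_outward_horizontal:
  assumes "(a, b) \<in> plane_verts \<epsilon> k" "0 \<le> a \<and> a \<le> i \<or> a \<le> 0 \<and> i + 1 \<le> a"
  shows "adj \<epsilon> k (Plane (i, b)) (Plane (i + 1, b))"
proof (rule adj_outward[OF assms(1)])
  show "dist (plane_pt k (i, b)) (plane_pt k (i + 1, b)) = 1 / 2 ^ k"
    by (simp add: plane_pt_def dist_Pair_Pair dist_real_def add_divide_distrib)
  fix z assume "z \<in> closed_segment (plane_pt k (i, b)) (plane_pt k (i + 1, b))"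
  then obtain c where c: "0 \<le> c" "c \<le> 1" "z = (1 - c) *\<^sub>R plane_pt k (i, b) + c *\<^sub>R plane_pt k (i + 1, b)"
    by (auto simp: closed_segment_def)
  have "\<bar>real_of_int a / 2 ^ k\<bar> \<le> \<bar>(1 - c) * (of_int i / 2 ^ k) + c * (of_int (i + 1) / 2 ^ k)\<bar>"
    using assms(2) by (intro abs_le_on_segment c(1,2)) (auto intro!: divide_right_mono simp: divide_nonneg_pos divide_nonpos_pos)
  moreover have "(1 - c) * r / s + c * r / s = r / s" for r s :: real
    by (simp add: algebra_simps flip: add_divide_distrib)
  ultimately show "\<bar>fst (plane_pt k (a, b))\<bar> \<le> \<bar>fst z\<bar> \<and> \<bar>snd (plane_pt k (a, b))\<bar> \<le> \<bar>snd z\<bar>"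
    unfolding c(3) by (simp add: plane_pt_def)
qed

lemma adj_outward_vertical:
  assumes "(a, b) \<in> plane_verts \<epsilon> k" "0 \<le> b \<and> b \<le> i \<or> b \<le> 0 \<and> i + 1 \<le> b"
  shows "adj \<epsilon> k (Plane (a, i)) (Plane (a, i + 1))"
proof (rule adj_outward[OF assms(1)])
  show "dist (plane_pt k (a, i)) (plane_pt k (a, i + 1)) = 1 / 2 ^ k"
    by (simp add: plane_pt_def dist_Pair_Pair dist_real_def add_divide_distrib)
  fix z assume "z \<in> closed_segment (plane_pt k (a, i)) (plane_pt k (a, i + 1))"
  then obtain c where c: "0 \<le> c" "c \<le> 1" "z = (1 - c) *\<^sub>R plane_pt k (a, i) + c *\<^sub>R plane_pt k (a, i + 1)"
    by (auto simp: closed_segment_def)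
  have "\<bar>real_of_int b / 2 ^ k\<bar> \<le> \<bar>(1 - c) * (of_int i / 2 ^ k) + c * (of_int (i + 1) / 2 ^ k)\<bar>"
    using assms(2) by (intro abs_le_on_segment c(1,2)) (auto intro!: divide_right_mono simp: divide_nonneg_pos divide_nonpos_pos)
  moreover have "(1 - c) * r / s + c * r / s = r / s" for r s :: real
    by (simp add: algebra_simps flip: add_divide_distrib)
  ultimately show "\<bar>fst (plane_pt k (a, b))\<bar> \<le> \<bar>fst z\<bar> \<and> \<bar>snd (plane_pt k (a, b))\<bar> \<le> \<bar>snd z\<bar>"
    unfolding c(3) by (simp add: plane_pt_def)
qed

lemma lattice_neighbour_cases:
  assumes "dist (plane_pt k (a, b)) (plane_pt k w) = 1 / 2 ^ k"
  shows "w \<in> {(a + 1, b), (a - 1, b), (a, b + 1), (a, b - 1)}"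
proof -
  obtain i j where w: "w = (i, j)" by (cases w)
  define x where "x = a - i"
  define y where "y = b - j"
  have "dist (plane_pt k (a, b)) (plane_pt k w) = norm (real_of_int x / 2 ^ k, real_of_int y / 2 ^ k)"
    by (simp add: dist_norm plane_pt_def w x_def y_def diff_divide_distrib)
  then have "sqrt ((real_of_int x / 2 ^ k)\<^sup>2 + (real_of_int y / 2 ^ k)\<^sup>2) = 1 / 2 ^ k"
    using assms by (simp add: norm_Pair power_divide)
  then have "(real_of_int x / 2 ^ k)\<^sup>2 + (real_of_int y / 2 ^ k)\<^sup>2 = (1 / 2 ^ k)\<^sup>2"
    by (metis real_sqrt_pow2 add_nonneg_nonneg zero_le_power2)
  then have "(real_of_int x)\<^sup>2 + (real_of_int y)\<^sup>2 = 1"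
    by (simp add: power_divide flip: add_divide_distrib)
  then have "real_of_int (x\<^sup>2 + y\<^sup>2) = real_of_int 1" by simp
  then have xy: "x\<^sup>2 + y\<^sup>2 = 1" by (simp only: of_int_eq_iff)
  then have "x\<^sup>2 \<le> 1" "y\<^sup>2 \<le> 1" using zero_le_power2[of x] zero_le_power2[of y] by linarith+
  then have "\<bar>x\<bar> \<le> 1" "\<bar>y\<bar> \<le> 1" by (simp_all add: abs_square_le_1)
  then have "x \<in> {-1, 0, 1}" "y \<in> {-1, 0, 1}" by auto
  then show ?thesis using xy by (auto simp: w x_def y_def)
qed

section \<open>Bounds for degree, mass and conductance\<close>

lemma num_nbrs_Plane_le: "num_nbrs \<epsilon> k (Plane u) \<le> 5"
proof -
  obtain a b where u: "u = (a, b)" by (cases u)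
  let ?S = "insert Star (Plane ` {(a + 1, b), (a - 1, b), (a, b + 1), (a, b - 1)})"
  have "{y. adj \<epsilon> k (Plane u) y} \<subseteq> ?S"
  proof
    fix y assume y: "y \<in> {y. adj \<epsilon> k (Plane u) y}"
    show "y \<in> ?S"
    proof (cases y)
      case (Plane w)
      then have "w \<in> {(a + 1, b), (a - 1, b), (a, b + 1), (a, b - 1)}"
        using y lattice_neighbour_cases[of k a b w] by (auto simp: u)
      then show ?thesis using Plane by blast
    qed (use y in auto)
  qed
  then have "num_nbrs \<epsilon> k (Plane u) \<le> card ?S"
    unfolding num_nbrs_def by (intro card_mono) auto
  also have "\<dots> \<le> 5" by (simp add: card_insert_if)
  finally show ?thesis .
qed

lemma mass_Plane_le: "2 ^ (2 * k) * mass \<epsilon> k (Plane u) \<le> 5 / 4"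
  using num_nbrs_Plane_le[of \<epsilon> k u] by simp

text \<open>\<open>Star\<close> satisfies the same lower bound as the points of the leg, so it can
  serve as the origin of the half-line in the one-dimensional Nash inequality.\<close>

lemma mass_Leg_Star_ge:
  assumes "x \<in> vertices \<epsilon> k" "x \<notin> range Plane"
  shows "1 / 2 ^ k / 2 \<le> mass \<epsilon> k x"
proof -
  have "1 \<le> num_nbrs \<epsilon> k x" using num_nbrs_pos[OF assms(1)] by simp
  then show ?thesis using assms(2) by (cases x) (auto simp: field_simps)
qed

lemma sum_conductance_le:
  assumes "x \<in> vertices \<epsilon> k" "finite U"
  shows "(\<Sum>y\<in>U. conductance \<epsilon> k x y) \<le> 2 ^ (2 * k) * mass \<epsilon> k x"
proof -
  have "(\<Sum>y\<in>U. conductance \<epsilon> k x y) = (\<Sum>y\<in>U \<inter> {y. adj \<epsilon> k x y}. conductance \<epsilon> k x y)"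
    using assms(2) by (intro sum.mono_neutral_right) (auto simp: conductance_def)
  also have "\<dots> \<le> (\<Sum>y | adj \<epsilon> k x y. conductance \<epsilon> k x y)"
    by (rule sum_mono2) (auto simp: finite_neighbours conductance_nonneg)
  finally show ?thesis using sum_conductance[OF assms(1)] by simp
qed

section \<open>Energy of functions extended by zero\<close>

locale killed_graph =
  fixes \<epsilon> :: real and k :: nat and V :: "vertex set"
  assumes fin: "finite V" and sub: "V \<subseteq> vertices \<epsilon> k"
begin

sublocale killed_network V "conductance \<epsilon> k" "mass \<epsilon> k" "2 ^ (2 * k)"
  by unfold_locales
    (use fin sub mass_pos sum_conductance_le conductance_sym in \<open>auto simp: conductance_nonneg\<close>)

definition zext :: "(vertex \<Rightarrow> real) \<Rightarrow> vertex \<Rightarrow> real" where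
  "zext f x = (if x \<in> V then f x else 0)"

text \<open>Enlarge S to U = V \<union> S and expand the square. The cross terms live on V, and the
  diagonal terms carry row sums over U, which are at most the total rate in \<open>form\<close>. The
  factor 2 comes from counting both orientations of each edge.\<close>

lemma form_ge_edges:
  assumes "finite S"
  shows "(\<Sum>x\<in>S. \<Sum>y\<in>S. conductance \<epsilon> k x y * (zext f x - zext f y)\<^sup>2) \<le> 2 * form f"
proof -
  let ?c = "conductance \<epsilon> k" and ?g = "zext f"
  define U where "U = V \<union> S"
  have U: "finite U" "V \<subseteq> U" "S \<subseteq> U" using assms fin by (auto simp: U_def)
  have "(\<Sum>x\<in>S. \<Sum>y\<in>S. ?c x y * (?g x - ?g y)\<^sup>2) \<le> (\<Sum>x\<in>S. \<Sum>y\<in>U. ?c x y * (?g x - ?g y)\<^sup>2)"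
    using U by (intro sum_mono sum_mono2) (auto simp: conductance_nonneg)
  also have "\<dots> \<le> (\<Sum>x\<in>U. \<Sum>y\<in>U. ?c x y * (?g x - ?g y)\<^sup>2)"
    using U by (intro sum_mono2 sum_nonneg) (auto simp: conductance_nonneg)
  also have "\<dots> = (\<Sum>x\<in>U. \<Sum>y\<in>U. ?c x y * (?g x)\<^sup>2) + (\<Sum>x\<in>U. \<Sum>y\<in>U. ?c x y * (?g y)\<^sup>2)
      - 2 * (\<Sum>x\<in>U. \<Sum>y\<in>U. ?c x y * (?g x * ?g y))"
    by (simp add: sum_distrib_left power2_diff algebra_simps flip: sum.distrib sum_subtractf)
  also have "(\<Sum>x\<in>U. \<Sum>y\<in>U. ?c x y * (?g y)\<^sup>2) = (\<Sum>x\<in>U. \<Sum>y\<in>U. ?c x y * (?g x)\<^sup>2)"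
    by (subst sum.swap) (simp add: conductance_sym[of _ _ _ _])
  also have "(\<Sum>x\<in>U. \<Sum>y\<in>U. ?c x y * (?g x * ?g y)) = (\<Sum>x\<in>V. \<Sum>y\<in>V. ?c x y * (f x * f y))"
  proof -
    have "(\<Sum>x\<in>U. \<Sum>y\<in>U. ?c x y * (?g x * ?g y)) = (\<Sum>x\<in>V. \<Sum>y\<in>U. ?c x y * (?g x * ?g y))"
      using U by (intro sum.mono_neutral_right) (auto simp: zext_def)
    also have "\<dots> = (\<Sum>x\<in>V. \<Sum>y\<in>V. ?c x y * (?g x * ?g y))"
      using U by (intro sum.cong sum.mono_neutral_right) (auto simp: zext_def)
    finally show ?thesis by (simp add: zext_def)
  qed
  also have "(\<Sum>x\<in>U. \<Sum>y\<in>U. ?c x y * (?g x)\<^sup>2) = (\<Sum>x\<in>V. (\<Sum>y\<in>U. ?c x y) * (f x)\<^sup>2)"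
  proof -
    have "(\<Sum>x\<in>U. \<Sum>y\<in>U. ?c x y * (?g x)\<^sup>2) = (\<Sum>x\<in>V. \<Sum>y\<in>U. ?c x y * (?g x)\<^sup>2)"
      using U by (intro sum.mono_neutral_right) (auto simp: zext_def)
    then show ?thesis by (simp add: zext_def sum_distrib_right)
  qed
  finally have le: "(\<Sum>x\<in>S. \<Sum>y\<in>S. ?c x y * (?g x - ?g y)\<^sup>2)
      \<le> 2 * (\<Sum>x\<in>V. (\<Sum>y\<in>U. ?c x y) * (f x)\<^sup>2) - 2 * (\<Sum>x\<in>V. \<Sum>y\<in>V. ?c x y * (f x * f y))"
    by simp
  have "(\<Sum>x\<in>V. (\<Sum>y\<in>U. ?c x y) * (f x)\<^sup>2) \<le> (\<Sum>x\<in>V. (2 ^ (2 * k) * mass \<epsilon> k x) * (f x)\<^sup>2)"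
    using sub U by (intro sum_mono mult_right_mono sum_conductance_le) auto
  also have "\<dots> = 2 ^ (2 * k) * (\<Sum>x\<in>V. mass \<epsilon> k x * (f x)\<^sup>2)"
    by (simp add: sum_distrib_left mult.assoc)
  finally have "(\<Sum>x\<in>V. (\<Sum>y\<in>U. ?c x y) * (f x)\<^sup>2) \<le> 2 ^ (2 * k) * (\<Sum>x\<in>V. mass \<epsilon> k x * (f x)\<^sup>2)" .
  moreover have "a \<le> 2 * b - 2 * d \<Longrightarrow> b \<le> e \<Longrightarrow> a \<le> 2 * (e - d)" for a b d e :: real by simp
  ultimately show ?thesis using le unfolding form_def by blast
qed

definition vertex_size :: "vertex \<Rightarrow> nat" where
  "vertex_size x = (case x of Star \<Rightarrow> 0 | Leg n \<Rightarrow> n | Plane u \<Rightarrow> nat (max \<bar>fst u\<bar> \<bar>snd u\<bar>))"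

lemma bounded_size: "\<exists>M. \<forall>x\<in>V. vertex_size x < M"
  using finite_imageI[OF fin, of vertex_size] unfolding finite_nat_set_iff_bounded by auto

text \<open>Gagliardo's argument for g = f^2: g (a, b) is at most the variation H b along its row
  and at most the variation W a along its column, so the sum of g^2 is at most the product of the
  sums of H and W, hence at most S^2. Cauchy-Schwarz bounds S^2 by the energy times the L2 mass, and
  \<open>cube_sum_le\<close> concludes.\<close>

lemma plane_nash:
  assumes f: "\<And>x. x \<in> V \<Longrightarrow> f x \<ge> 0"
  shows "(\<Sum>x\<in>V \<inter> range Plane. mass \<epsilon> k x * (f x)\<^sup>2)\<^sup>2
    \<le> 160 * form f * (\<Sum>x\<in>V \<inter> range Plane. mass \<epsilon> k x * f x)\<^sup>2"
proof -
  obtain M where M: "\<And>x. x \<in> V \<Longrightarrow> vertex_size x < M" using bounded_size by blast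
  define I where "I = {- int M..int M}"
  define B where "B = I \<times> I"
  define G where "G u = zext f (Plane u)" for u
  define g where "g u = (G u)\<^sup>2" for u
  define c where "c u w = conductance \<epsilon> k (Plane u) (Plane w)" for u w
  define \<mu> where "\<mu> u = mass \<epsilon> k (Plane u)" for u
  define L where "L = (2::real) ^ (2 * k)"
  define A where "A = (\<Sum>u\<in>B. \<mu> u * (G u)\<^sup>2)"
  define F where "F = (\<Sum>u\<in>B. \<mu> u * G u)"
  define E where "E = form f"
  \<comment> \<open>The factor 4 offsets the planar conductance 1/4: \<phi> is the increment of g on
    edges and 0 on pairs that are not joined.\<close>
  define \<phi> where "\<phi> u w = 4 * c u w * \<bar>g u - g w\<bar>" for u w
  define S where "S = (\<Sum>u\<in>B. \<Sum>w\<in>B. \<phi> u w)"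
  have finB: "finite I" "finite B" by (auto simp: I_def B_def)
  have L: "L > 0" by (simp add: L_def)
  have c0: "c u w \<ge> 0" for u w by (simp add: c_def conductance_nonneg)
  have G0: "G u \<ge> 0" for u using f by (simp add: G_def zext_def)
  have \<mu>0: "\<mu> u \<ge> 0" for u by (simp add: \<mu>_def)
  have \<phi>0: "\<phi> u w \<ge> 0" for u w using c0 by (simp add: \<phi>_def)
  have inV: "u \<in> plane_verts \<epsilon> k" "\<bar>fst u\<bar> < int M" "\<bar>snd u\<bar> < int M" if "G u \<noteq> 0" for u
  proof -
    have "Plane u \<in> V" using that by (auto simp: G_def zext_def split: if_splits)
    then show "u \<in> plane_verts \<epsilon> k" "\<bar>fst u\<bar> < int M" "\<bar>snd u\<bar> < int M"
      using sub M[of "Plane u"] by (auto simp: vertices_def vertex_size_def)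
  qed
  have transfer: "(\<Sum>u\<in>B. \<mu> u * h (G u)) = (\<Sum>x\<in>V \<inter> range Plane. mass \<epsilon> k x * h (f x))" if "h 0 = 0" for h
  proof -
    have "(\<Sum>u\<in>B. \<mu> u * h (G u)) = (\<Sum>x\<in>Plane ` B. mass \<epsilon> k x * h (zext f x))"
      by (subst sum.reindex) (auto simp: inj_on_def \<mu>_def G_def)
    also have "\<dots> = (\<Sum>x\<in>V \<inter> range Plane. mass \<epsilon> k x * h (zext f x))"
    proof (rule sum.mono_neutral_right)
      show "V \<inter> range Plane \<subseteq> Plane ` B"
      proof
        fix x assume "x \<in> V \<inter> range Plane"
        then obtain u where u: "x = Plane u" "x \<in> V" by auto
        then have "\<bar>fst u\<bar> < int M" "\<bar>snd u\<bar> < int M" using M[of x] by (auto simp: vertex_size_def)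
        then have "u \<in> B" by (cases u) (auto simp: B_def I_def)
        then show "x \<in> Plane ` B" using u by auto
      qed
    qed (use finB that in \<open>auto simp: zext_def\<close>)
    finally show ?thesis by (simp add: zext_def)
  qed
  have E1: "(\<Sum>u\<in>B. \<Sum>w\<in>B. c u w * (G u - G w)\<^sup>2) \<le> 2 * E"
  proof -
    have "(\<Sum>u\<in>B. \<Sum>w\<in>B. c u w * (G u - G w)\<^sup>2)
        = (\<Sum>x\<in>Plane ` B. \<Sum>y\<in>Plane ` B. conductance \<epsilon> k x y * (zext f x - zext f y)\<^sup>2)"
      by (simp add: sum.reindex inj_on_def c_def G_def)
    then show ?thesis using form_ge_edges[of "Plane ` B" f] finB by (simp add: E_def)
  qed
  have E2: "(\<Sum>u\<in>B. \<Sum>w\<in>B. c u w * (G u + G w)\<^sup>2) \<le> 4 * L * A"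
  proof -
    have "(\<Sum>u\<in>B. \<Sum>w\<in>B. c u w * (G u + G w)\<^sup>2) \<le> (\<Sum>u\<in>B. \<Sum>w\<in>B. c u w * (2 * (g u + g w)))"
    proof (intro sum_mono mult_left_mono c0)
      fix u w show "(G u + G w)\<^sup>2 \<le> 2 * (g u + g w)"
        using sum_squares_bound[of "G u" "G w"] by (simp add: g_def power2_sum)
    qed
    also have "\<dots> = 2 * (\<Sum>u\<in>B. \<Sum>w\<in>B. c u w * g u) + 2 * (\<Sum>u\<in>B. \<Sum>w\<in>B. c u w * g w)"
      by (simp add: sum_distrib_left algebra_simps flip: sum.distrib)
    also have "(\<Sum>u\<in>B. \<Sum>w\<in>B. c u w * g w) = (\<Sum>u\<in>B. \<Sum>w\<in>B. c u w * g u)"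
      by (subst sum.swap) (simp add: c_def conductance_sym[of _ _ _ _])
    finally have "(\<Sum>u\<in>B. \<Sum>w\<in>B. c u w * (G u + G w)\<^sup>2) \<le> 4 * (\<Sum>u\<in>B. (\<Sum>w\<in>B. c u w) * g u)"
      by (simp add: sum_distrib_right)
    also have "(\<Sum>u\<in>B. (\<Sum>w\<in>B. c u w) * g u) \<le> (\<Sum>u\<in>B. (L * \<mu> u) * g u)"
    proof (rule sum_mono)
      fix u
      show "(\<Sum>w\<in>B. c u w) * g u \<le> (L * \<mu> u) * g u"
      proof (cases "G u = 0")
        case False
        then have "Plane u \<in> vertices \<epsilon> k" using inV by (auto simp: vertices_def)
        from sum_conductance_le[OF this, of "Plane ` B"] have "(\<Sum>w\<in>B. c u w) \<le> L * \<mu> u"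
          using finB by (simp add: sum.reindex inj_on_def c_def L_def \<mu>_def del: mass.simps)
        then show ?thesis by (intro mult_right_mono) (auto simp: g_def)
      qed (simp add: g_def)
    qed
    also have "\<dots> = L * A" by (simp add: A_def g_def sum_distrib_left mult.assoc)
    finally show ?thesis by simp
  qed
  have S2: "S\<^sup>2 \<le> 128 * L * E * A"
  proof -
    define a where "a p = sqrt (c (fst p) (snd p)) * \<bar>G (fst p) - G (snd p)\<bar>" for p
    define b where "b p = sqrt (c (fst p) (snd p)) * (G (fst p) + G (snd p))" for p
    have "S = 4 * (\<Sum>p\<in>B \<times> B. a p * b p)"
      unfolding S_def sum.cartesian_product sum_distrib_left
    proof (intro sum.cong refl, clarify)
      fix u w
      have "\<bar>g u - g w\<bar> = \<bar>G u - G w\<bar> * (G u + G w)"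
      proof -
        have "g u - g w = (G u - G w) * (G u + G w)" by (simp add: g_def power2_eq_square algebra_simps)
        then show ?thesis using G0[of u] G0[of w] by (simp add: abs_mult)
      qed
      then show "\<phi> u w = 4 * (a (u, w) * b (u, w))"
        using c0[of u w] by (simp add: \<phi>_def a_def b_def)
    qed
    then have "S\<^sup>2 = 16 * (\<Sum>p\<in>B \<times> B. a p * b p)\<^sup>2" by (simp add: power_mult_distrib)
    also have "\<dots> \<le> 16 * ((\<Sum>p\<in>B \<times> B. (a p)\<^sup>2) * (\<Sum>p\<in>B \<times> B. (b p)\<^sup>2))"
      by (intro mult_left_mono Cauchy_Schwarz_ineq_sum) auto
    also have "(\<Sum>p\<in>B \<times> B. (a p)\<^sup>2) = (\<Sum>u\<in>B. \<Sum>w\<in>B. c u w * (G u - G w)\<^sup>2)"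
      unfolding sum.cartesian_product using c0 by (intro sum.cong) (auto simp: a_def power_mult_distrib)
    also have "(\<Sum>p\<in>B \<times> B. (b p)\<^sup>2) = (\<Sum>u\<in>B. \<Sum>w\<in>B. c u w * (G u + G w)\<^sup>2)"
      unfolding sum.cartesian_product using c0 by (intro sum.cong) (auto simp: b_def power_mult_distrib)
    finally have "S\<^sup>2 \<le> 16 * ((\<Sum>u\<in>B. \<Sum>w\<in>B. c u w * (G u - G w)\<^sup>2) * (\<Sum>u\<in>B. \<Sum>w\<in>B. c u w * (G u + G w)\<^sup>2))" .
    also have "\<dots> \<le> 16 * ((2 * E) * (4 * L * A))"
      using E1 E2 c0 by (intro mult_left_mono mult_mono sum_nonneg mult_nonneg_nonneg) (auto simp: E_def form_nonneg)
    finally show ?thesis by (simp add: mult_ac)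
  qed
  have \<phi>_adj: "\<phi> u w = \<bar>g u - g w\<bar>" if "adj \<epsilon> k (Plane u) (Plane w)" for u w
    using that by (auto simp: \<phi>_def c_def conductance_def simp del: adj.simps)
  define H where "H b = (\<Sum>i\<in>{- int M..<int M}. \<phi> (i, b) (i + 1, b))" for b
  define W where "W a = (\<Sum>i\<in>{- int M..<int M}. \<phi> (a, i) (a, i + 1))" for a
  have HW0: "H b \<ge> 0" "W b \<ge> 0" for b unfolding H_def W_def by (intro sum_nonneg \<phi>0)+
  \<comment> \<open>The variation is taken along the ray leading away from the vertical axis, all of
    whose edges belong to the graph. It ends at first coordinate M or -M, where g vanishes because M
    exceeds the size of every point of V.\<close>
  have gH: "g (a, b) \<le> H b" for a b
  proof (cases "G (a, b) = 0")
    case False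
    from inV[OF False] have ab: "(a, b) \<in> plane_verts \<epsilon> k" "\<bar>a\<bar> < int M" by auto
    have bd: "a \<le> int M" "- int M \<le> a" using ab by auto
    have z: "g (int M, b) = 0" "g (- int M, b) = 0" using inV(2)[of "(int M, b)"] inV(2)[of "(- int M, b)"]
      by (auto simp: g_def)
    show ?thesis
    proof (cases "a \<ge> 0")
      case True
      have "g (a, b) \<le> (\<Sum>i\<in>{a..<int M}. \<bar>g (i, b) - g (i + 1, b)\<bar>)"
        using total_variation_int[of a "int M" "\<lambda>i. g (i, b)"] bd z by simp
      also have "\<dots> = (\<Sum>i\<in>{a..<int M}. \<phi> (i, b) (i + 1, b))"
        using adj_outward_horizontal[OF ab(1)] True by (intro sum.cong) (auto simp: \<phi>_adj simp del: adj.simps)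
      also have "\<dots> \<le> H b" unfolding H_def using ab \<phi>0 by (intro sum_mono2) auto
      finally show ?thesis .
    next
      case False
      have "g (a, b) \<le> (\<Sum>i\<in>{- int M..<a}. \<bar>g (i, b) - g (i + 1, b)\<bar>)"
        using total_variation_int[of "- int M" a "\<lambda>i. g (i, b)"] bd z by simp
      also have "\<dots> = (\<Sum>i\<in>{- int M..<a}. \<phi> (i, b) (i + 1, b))"
        using adj_outward_horizontal[OF ab(1)] False by (intro sum.cong) (auto simp: \<phi>_adj simp del: adj.simps)
      also have "\<dots> \<le> H b" unfolding H_def using ab \<phi>0 by (intro sum_mono2) auto
      finally show ?thesis .
    qed
  qed (use HW0 in \<open>simp add: g_def\<close>)
  have gW: "g (a, b) \<le> W a" for a b
  proof (cases "G (a, b) = 0")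
    case False
    from inV[OF False] have ab: "(a, b) \<in> plane_verts \<epsilon> k" "\<bar>b\<bar> < int M" by auto
    have bd: "b \<le> int M" "- int M \<le> b" using ab by auto
    have z: "g (a, int M) = 0" "g (a, - int M) = 0" using inV(3)[of "(a, int M)"] inV(3)[of "(a, - int M)"]
      by (auto simp: g_def)
    show ?thesis
    proof (cases "b \<ge> 0")
      case True
      have "g (a, b) \<le> (\<Sum>i\<in>{b..<int M}. \<bar>g (a, i) - g (a, i + 1)\<bar>)"
        using total_variation_int[of b "int M" "\<lambda>i. g (a, i)"] bd z by simp
      also have "\<dots> = (\<Sum>i\<in>{b..<int M}. \<phi> (a, i) (a, i + 1))"
        using adj_outward_vertical[OF ab(1)] True by (intro sum.cong) (auto simp: \<phi>_adj simp del: adj.simps)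
      also have "\<dots> \<le> W a" unfolding W_def using ab \<phi>0 by (intro sum_mono2) auto
      finally show ?thesis .
    next
      case False
      have "g (a, b) \<le> (\<Sum>i\<in>{- int M..<b}. \<bar>g (a, i) - g (a, i + 1)\<bar>)"
        using total_variation_int[of "- int M" b "\<lambda>i. g (a, i)"] bd z by simp
      also have "\<dots> = (\<Sum>i\<in>{- int M..<b}. \<phi> (a, i) (a, i + 1))"
        using adj_outward_vertical[OF ab(1)] False by (intro sum.cong) (auto simp: \<phi>_adj simp del: adj.simps)
      also have "\<dots> \<le> W a" unfolding W_def using ab \<phi>0 by (intro sum_mono2) auto
      finally show ?thesis .
    qed
  qed (use HW0 in \<open>simp add: g_def\<close>)
  \<comment> \<open>Rows and columns use each edge in one orientation only, so they embed
    injectively into the pairs counted by S.\<close>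
  have S_ge: "(\<Sum>p\<in>Q. \<phi> (fst (\<iota> p)) (snd (\<iota> p))) \<le> S" if "inj_on \<iota> Q" "\<And>p. p \<in> Q \<Longrightarrow> \<iota> p \<in> B \<times> B"
    for \<iota> :: "int \<times> int \<Rightarrow> (int \<times> int) \<times> (int \<times> int)" and Q
  proof -
    have "(\<Sum>p\<in>Q. \<phi> (fst (\<iota> p)) (snd (\<iota> p))) = (\<Sum>p\<in>\<iota> ` Q. \<phi> (fst p) (snd p))"
      using that by (simp add: sum.reindex)
    also have "\<dots> \<le> (\<Sum>p\<in>B \<times> B. \<phi> (fst p) (snd p))"
      using that finB \<phi>0 by (intro sum_mono2 image_subsetI) auto
    also have "\<dots> = S" by (simp add: S_def sum.cartesian_product case_prod_unfold)
    finally show ?thesis .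
  qed
  have SH: "(\<Sum>b\<in>I. H b) \<le> S"
    using S_ge[of "\<lambda>(b, i). ((i, b), (i + 1, b))" "I \<times> {- int M..<int M}"]
    by (auto simp: H_def sum.cartesian_product case_prod_unfold inj_on_def B_def I_def)
  have SW: "(\<Sum>a\<in>I. W a) \<le> S"
    using S_ge[of "\<lambda>(a, i). ((a, i), (a, i + 1))" "I \<times> {- int M..<int M}"]
    by (auto simp: W_def sum.cartesian_product case_prod_unfold inj_on_def B_def I_def)
  have "(\<Sum>u\<in>B. (g u)\<^sup>2) \<le> S\<^sup>2"
  proof -
    have "(\<Sum>u\<in>B. (g u)\<^sup>2) = (\<Sum>a\<in>I. \<Sum>b\<in>I. g (a, b) * g (a, b))"
      by (simp add: B_def sum.cartesian_product case_prod_unfold power2_eq_square)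
    also have "\<dots> \<le> (\<Sum>a\<in>I. \<Sum>b\<in>I. W a * H b)"
      using gH gW HW0 by (intro sum_mono mult_mono) (auto simp: g_def)
    also have "\<dots> = (\<Sum>a\<in>I. W a) * (\<Sum>b\<in>I. H b)" by (simp add: sum_product)
    also have "\<dots> \<le> S * S"
      using SH SW HW0 by (intro mult_mono sum_nonneg order_trans[OF sum_nonneg SW]) auto
    finally show ?thesis by (simp add: power2_eq_square)
  qed
  moreover have "L * (\<Sum>u\<in>B. \<mu> u * (G u) ^ 4) \<le> 5 / 4 * (\<Sum>u\<in>B. (g u)\<^sup>2)"
    unfolding sum_distrib_left
  proof (rule sum_mono)
    fix u
    have "(L * \<mu> u) * (G u) ^ 4 \<le> 5 / 4 * (G u) ^ 4"
      using mass_Plane_le[of k \<epsilon> u] by (intro mult_right_mono) (auto simp: L_def \<mu>_def simp del: mass.simps)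
    then show "L * (\<mu> u * (G u) ^ 4) \<le> 5 / 4 * (g u)\<^sup>2" by (simp add: g_def mult.assoc flip: power_mult)
  qed
  ultimately have "L * (\<Sum>u\<in>B. \<mu> u * (G u) ^ 4) \<le> 5 / 4 * (128 * L * E * A)"
    using S2 by linarith
  then have "L * (\<Sum>u\<in>B. \<mu> u * (G u) ^ 4) \<le> L * (160 * E * A)" by (simp add: mult_ac)
  then have Q: "(\<Sum>u\<in>B. \<mu> u * (G u) ^ 4) \<le> 160 * E * A" using L by simp
  have "A ^ 3 \<le> F\<^sup>2 * (\<Sum>u\<in>B. \<mu> u * (G u) ^ 4)"
    unfolding A_def F_def using \<mu>0 G0 by (intro cube_sum_le) auto
  also have "\<dots> \<le> F\<^sup>2 * (160 * E * A)" using Q by (rule mult_left_mono) simp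
  finally have "A * A\<^sup>2 \<le> A * (160 * E * F\<^sup>2)"
    by (simp add: power2_eq_square power3_eq_cube mult_ac)
  moreover have "A \<ge> 0" unfolding A_def using \<mu>0 by (intro sum_nonneg) auto
  moreover have "160 * E * F\<^sup>2 \<ge> 0" by (simp add: E_def form_nonneg)
  ultimately have "A\<^sup>2 \<le> 160 * E * F\<^sup>2" by (cases "A = 0") auto
  then show ?thesis
    using transfer[of "\<lambda>s. s\<^sup>2"] transfer[of "\<lambda>s. s"] by (simp add: A_def F_def E_def)
qed

text \<open>In one dimension f^2 is bounded pointwise by the total variation S of f^2, and S^2 \<le>
  32 E B by Cauchy-Schwarz. Then B \<le> F sqrt S; the fourth power of this contains one factor B
  too many, which cancels.\<close>

lemma leg_nash:
  assumes f: "\<And>x. x \<in> V \<Longrightarrow> f x \<ge> 0"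
  shows "(\<Sum>x\<in>V - range Plane. mass \<epsilon> k x * (f x)\<^sup>2) ^ 3
    \<le> 32 * form f * (\<Sum>x\<in>V - range Plane. mass \<epsilon> k x * f x) ^ 4"
proof -
  obtain M where M: "\<And>x. x \<in> V \<Longrightarrow> vertex_size x < M" using bounded_size by blast
  \<comment> \<open>Index 0 stands for \<open>Star\<close>. The edge from \<open>Star\<close> to
    \<open>Leg 1\<close> has the same conductance as the other edges of the leg, so the half-line is
    homogeneous.\<close>
  define \<iota> where "\<iota> n = (if n = 0 then Star else Leg n)" for n
  define e where "e n = zext f (\<iota> n)" for n
  define E where "E = form f"
  define B where "B = (\<Sum>x\<in>V - range Plane. mass \<epsilon> k x * (f x)\<^sup>2)"
  define F where "F = (\<Sum>x\<in>V - range Plane. mass \<epsilon> k x * f x)"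
  define S where "S = (\<Sum>n<M. \<bar>(e n)\<^sup>2 - (e (Suc n))\<^sup>2\<bar>)"
  define h where "h = (2::real) ^ k"
  have h: "h > 0" by (simp add: h_def)
  have inj: "inj \<iota>" by (auto simp: inj_def \<iota>_def split: if_splits)
  have e0: "e n \<ge> 0" for n using f by (simp add: e_def zext_def)
  have mass0: "mass \<epsilon> k x \<ge> 0" if "x \<in> V" for x using that sub mass_pos[of x \<epsilon> k] by auto
  have B0: "B \<ge> 0" and F0: "F \<ge> 0" using mass0 f by (auto simp: B_def F_def intro!: sum_nonneg)
  have E0: "E \<ge> 0" by (simp add: E_def form_nonneg)
  have range: "x \<in> \<iota> ` {..<M}" if x: "x \<in> V - range Plane" for x
  proof -
    have "x = \<iota> (vertex_size x)"
      using x sub by (cases x) (auto simp: \<iota>_def vertex_size_def vertices_def)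
    moreover have "vertex_size x < M" using x M by auto
    ultimately show ?thesis by blast
  qed
  have eM: "e M = 0"
  proof -
    have "\<iota> M \<notin> V" using M[of "\<iota> M"] by (auto simp: \<iota>_def vertex_size_def split: if_splits)
    then show ?thesis by (simp add: e_def zext_def)
  qed
  have c_leg: "conductance \<epsilon> k (\<iota> n) (\<iota> (Suc n)) = h / 2" for n
    by (auto simp: conductance_def \<iota>_def h_def)
  have E1: "(\<Sum>n<M. (e n - e (Suc n))\<^sup>2) \<le> 4 / h * E"
  proof -
    have "(\<Sum>n<M. h / 2 * (e n - e (Suc n))\<^sup>2)
        \<le> (\<Sum>n\<le>M. \<Sum>j\<le>M. conductance \<epsilon> k (\<iota> n) (\<iota> j) * (e n - e j)\<^sup>2)"
    proof (rule order_trans[OF sum_mono sum_mono2])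
      fix n assume "n \<in> {..<M}"
      then have "conductance \<epsilon> k (\<iota> n) (\<iota> (Suc n)) * (e n - e (Suc n))\<^sup>2
          \<le> (\<Sum>j\<le>M. conductance \<epsilon> k (\<iota> n) (\<iota> j) * (e n - e j)\<^sup>2)"
        by (intro member_le_sum) (auto simp: conductance_nonneg)
      then show "h / 2 * (e n - e (Suc n))\<^sup>2 \<le> (\<Sum>j\<le>M. conductance \<epsilon> k (\<iota> n) (\<iota> j) * (e n - e j)\<^sup>2)"
        by (simp add: c_leg)
    qed (auto intro!: sum_nonneg simp: conductance_nonneg)
    also have "\<dots> = (\<Sum>x\<in>\<iota> ` {..M}. \<Sum>y\<in>\<iota> ` {..M}. conductance \<epsilon> k x y * (zext f x - zext f y)\<^sup>2)"
      using inj by (simp add: sum.reindex inj_on_subset[OF inj] e_def)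
    also have "\<dots> \<le> 2 * E" unfolding E_def by (rule form_ge_edges) simp
    finally have "h / 2 * (\<Sum>n<M. (e n - e (Suc n))\<^sup>2) \<le> 2 * E" by (simp add: sum_distrib_left)
    then show ?thesis using h by (simp add: field_simps)
  qed
  have e_sum: "(\<Sum>n<M. (e n)\<^sup>2) \<le> 2 * h * B"
  proof -
    have "(\<Sum>n<M. (e n)\<^sup>2) = (\<Sum>x\<in>\<iota> ` {..<M}. (zext f x)\<^sup>2)"
      by (simp add: sum.reindex inj_on_subset[OF inj] e_def)
    also have "\<dots> = (\<Sum>x\<in>V - range Plane. (zext f x)\<^sup>2)"
    proof (rule sum.mono_neutral_right)
      show "V - range Plane \<subseteq> \<iota> ` {..<M}" using range by blast
      have "\<iota> n \<notin> range Plane" for n by (auto simp: \<iota>_def)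
      then show "\<forall>x\<in>\<iota> ` {..<M} - (V - range Plane). (zext f x)\<^sup>2 = 0" by (auto simp: zext_def)
    qed simp
    also have "\<dots> \<le> (\<Sum>x\<in>V - range Plane. 2 * h * (mass \<epsilon> k x * (f x)\<^sup>2))"
    proof (rule sum_mono)
      fix x assume x: "x \<in> V - range Plane"
      then have "1 / 2 ^ k / 2 \<le> mass \<epsilon> k x" using sub by (intro mass_Leg_Star_ge) auto
      then have "1 \<le> 2 * h * mass \<epsilon> k x" using h by (simp add: h_def field_simps)
      then have "1 * (f x)\<^sup>2 \<le> (2 * h * mass \<epsilon> k x) * (f x)\<^sup>2" by (rule mult_right_mono) simp
      then show "(zext f x)\<^sup>2 \<le> 2 * h * (mass \<epsilon> k x * (f x)\<^sup>2)" using x by (simp add: zext_def mult.assoc)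
    qed
    also have "\<dots> = 2 * h * B" by (simp add: B_def sum_distrib_left)
    finally show ?thesis .
  qed
  have E2: "(\<Sum>n<M. (e n + e (Suc n))\<^sup>2) \<le> 8 * h * B"
  proof -
    have "(\<Sum>n<M. (e n + e (Suc n))\<^sup>2) \<le> (\<Sum>n<M. 2 * (e n)\<^sup>2 + 2 * (e (Suc n))\<^sup>2)"
    proof (rule sum_mono)
      fix n show "(e n + e (Suc n))\<^sup>2 \<le> 2 * (e n)\<^sup>2 + 2 * (e (Suc n))\<^sup>2"
        using sum_squares_bound[of "e n" "e (Suc n)"] by (simp add: power2_sum)
    qed
    also have "\<dots> = 2 * (\<Sum>n<M. (e n)\<^sup>2) + 2 * (\<Sum>n<M. (e (Suc n))\<^sup>2)"
      by (simp add: sum.distrib sum_distrib_left)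
    also have "(\<Sum>n<M. (e (Suc n))\<^sup>2) \<le> (\<Sum>n<M. (e n)\<^sup>2)"
      using sum.lessThan_Suc_shift[of "\<lambda>n. (e n)\<^sup>2" M] eM by simp
    finally show ?thesis using e_sum by simp
  qed
  have S2: "S\<^sup>2 \<le> 32 * E * B"
  proof -
    have "S = (\<Sum>n<M. \<bar>e n - e (Suc n)\<bar> * (e n + e (Suc n)))"
      unfolding S_def
    proof (rule sum.cong[OF refl])
      fix n
      have "(e n)\<^sup>2 - (e (Suc n))\<^sup>2 = (e n - e (Suc n)) * (e n + e (Suc n))"
        by (simp add: power2_eq_square algebra_simps)
      then show "\<bar>(e n)\<^sup>2 - (e (Suc n))\<^sup>2\<bar> = \<bar>e n - e (Suc n)\<bar> * (e n + e (Suc n))"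
        using e0[of n] e0[of "Suc n"] by (simp add: abs_mult)
    qed
    then have "S\<^sup>2 \<le> (\<Sum>n<M. \<bar>e n - e (Suc n)\<bar>\<^sup>2) * (\<Sum>n<M. (e n + e (Suc n))\<^sup>2)"
      using Cauchy_Schwarz_ineq_sum by metis
    also have "\<dots> \<le> (4 / h * E) * (8 * h * B)"
      using E1 E2 E0 h by (intro mult_mono sum_nonneg) auto
    finally show ?thesis using h by simp
  qed
  have sup: "(f x)\<^sup>2 \<le> S" if x: "x \<in> V - range Plane" for x
  proof -
    obtain n where n: "x = \<iota> n" "n < M" using range[OF x] by blast
    have "(f x)\<^sup>2 = (e n)\<^sup>2" using x n by (simp add: e_def zext_def)
    also have "\<dots> \<le> (\<Sum>i\<in>{n..<M}. \<bar>(e i)\<^sup>2 - (e (Suc i))\<^sup>2\<bar>)"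
      using total_variation_nat[of n M "\<lambda>n. (e n)\<^sup>2"] n eM by simp
    also have "\<dots> \<le> S" unfolding S_def by (rule sum_mono2) auto
    finally show ?thesis .
  qed
  have S0: "S \<ge> 0" by (auto simp: S_def intro!: sum_nonneg)
  have "B \<le> F * sqrt S"
    unfolding B_def F_def sum_distrib_right
  proof (rule sum_mono)
    fix x assume x: "x \<in> V - range Plane"
    then have "f x \<le> sqrt S" using sup by (intro real_le_rsqrt)
    then show "mass \<epsilon> k x * (f x)\<^sup>2 \<le> mass \<epsilon> k x * f x * sqrt S"
      using x mass0 f by (auto simp: power2_eq_square mult.assoc intro!: mult_left_mono)
  qed
  then have "B ^ 4 \<le> (F * sqrt S) ^ 4" using B0 by (rule power_mono)
  also have "(F * sqrt S) ^ 4 = F ^ 4 * S\<^sup>2"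
    using S0 by (simp add: power_mult_distrib) (simp add: power4_eq_xxxx power2_eq_square)
  also have "F ^ 4 * S\<^sup>2 \<le> F ^ 4 * (32 * E * B)"
    using S2 F0 by (intro mult_left_mono) auto
  finally have "B * B ^ 3 \<le> B * (32 * E * F ^ 4)"
    by (simp add: power4_eq_xxxx power3_eq_cube mult_ac)
  then have "B ^ 3 \<le> 32 * E * F ^ 4" using B0 E0 F0 by (cases "B = 0") auto
  then show ?thesis by (simp add: B_def E_def F_def)
qed

text \<open>The plane gives A^3 \<le> 160 E F^2 N and the leg with \<open>Star\<close> gives B^3
  \<le> 32 E F^4. Since N^3 \<le> 4 (A^3 + B^3), the constant is 4 * 160 = 640, which covers 4 * 32
  too.\<close>

sublocale nash_network V "conductance \<epsilon> k" "mass \<epsilon> k" "2 ^ (2 * k)" 640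
proof
  fix f :: "vertex \<Rightarrow> real" assume f: "\<And>x. x \<in> V \<Longrightarrow> f x \<ge> 0"
  define A where "A = (\<Sum>x\<in>V \<inter> range Plane. mass \<epsilon> k x * (f x)\<^sup>2)"
  define B where "B = (\<Sum>x\<in>V - range Plane. mass \<epsilon> k x * (f x)\<^sup>2)"
  define FA where "FA = (\<Sum>x\<in>V \<inter> range Plane. mass \<epsilon> k x * f x)"
  define FB where "FB = (\<Sum>x\<in>V - range Plane. mass \<epsilon> k x * f x)"
  define E where "E = form f"
  define N where "N = A + B"
  define F where "F = FA + FB"
  have mass0: "mass \<epsilon> k x \<ge> 0" if "x \<in> V" for x using that sub mass_pos[of x \<epsilon> k] by auto
  have nn: "A \<ge> 0" "B \<ge> 0" "FA \<ge> 0" "FB \<ge> 0" "E \<ge> 0"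
    using mass0 f by (auto simp: A_def B_def FA_def FB_def E_def form_nonneg intro!: sum_nonneg)
  have split: "(\<Sum>x\<in>V. h x) = (\<Sum>x\<in>V \<inter> range Plane. h x) + (\<Sum>x\<in>V - range Plane. h x)" for h :: "vertex \<Rightarrow> real"
    using sum.Int_Diff[OF fin] by blast
  have a: "A ^ 3 \<le> 160 * E * F\<^sup>2 * N"
  proof -
    have "A ^ 3 = A\<^sup>2 * A" by (simp add: power2_eq_square power3_eq_cube)
    also have "\<dots> \<le> (160 * E * FA\<^sup>2) * A"
      using plane_nash[of f] f nn by (intro mult_right_mono) (auto simp: A_def E_def FA_def)
    also have "\<dots> \<le> (160 * E * F\<^sup>2) * N"
      using nn by (intro mult_mono mult_left_mono power_mono) (auto simp: F_def N_def)
    finally show ?thesis .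
  qed
  have b: "B ^ 3 \<le> 32 * E * F ^ 4"
  proof -
    have "B ^ 3 \<le> 32 * E * FB ^ 4" using leg_nash[of f] f by (simp add: B_def E_def FB_def)
    also have "\<dots> \<le> 32 * E * F ^ 4" using nn by (intro mult_left_mono power_mono) (auto simp: F_def)
    finally show ?thesis .
  qed
  \<comment> \<open>This quantity is exactly 4 (A^3 + B^3) - (A + B)^3.\<close>
  have "0 \<le> 3 * (A + B) * (A - B)\<^sup>2" using nn by simp
  then have "N ^ 3 \<le> 4 * (A ^ 3 + B ^ 3)"
    by (simp add: N_def power3_eq_cube power2_eq_square algebra_simps)
  also have "\<dots> \<le> 640 * E * F\<^sup>2 * N + 128 * E * F ^ 4" using a b by simp
  also have "\<dots> \<le> 640 * E * F\<^sup>2 * N + 640 * E * F ^ 4" using nn by (intro add_left_mono mult_right_mono) auto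
  also have "\<dots> = 640 * E * F\<^sup>2 * (N + F\<^sup>2)"
    by (simp add: power4_eq_xxxx power2_eq_square algebra_simps)
  finally show "(\<Sum>x\<in>V. mass \<epsilon> k x * (f x)\<^sup>2) ^ 3 \<le> 640 * form f * (\<Sum>x\<in>V. mass \<epsilon> k x * f x)\<^sup>2 *
      ((\<Sum>x\<in>V. mass \<epsilon> k x * (f x)\<^sup>2) + (\<Sum>x\<in>V. mass \<epsilon> k x * f x)\<^sup>2)"
    by (simp add: split N_def F_def A_def B_def FA_def FB_def E_def)
qed simp

end

section \<open>The law of the chain\<close>

lemma (in product_prob_space) indep_vars_components:
  assumes "I \<noteq> {}"
  shows "P.indep_vars M (\<lambda>i \<omega>. \<omega> i) I"
proof (subst P.indep_vars_iff_distr_eq_PiM'[OF assms])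
  have "distr (PiM I M) (PiM I M) (\<lambda>x. \<lambda>i\<in>I. x i) = distr (PiM I M) (PiM I M) (\<lambda>x. x)"
    by (intro distr_cong) (auto simp: space_PiM PiE_restrict)
  also have "\<dots> = PiM I M" by (rule distr_id)
  also have "\<dots> = (\<Pi>\<^sub>M i\<in>I. distr (PiM I M) (M i) (\<lambda>\<omega>. \<omega> i))"
    by (intro PiM_cong) (auto simp: PiM_component)
  finally show "distr (PiM I M) (PiM I M) (\<lambda>x. \<lambda>i\<in>I. x i) = (\<Pi>\<^sub>M i\<in>I. distr (PiM I M) (M i) (\<lambda>\<omega>. \<omega> i))" .
qed simp

section \<open>Law of the jump chain\<close>

abbreviation jump_space :: "real \<Rightarrow> nat \<Rightarrow> (nat \<times> vertex \<Rightarrow> vertex) measure" where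
  "jump_space \<epsilon> k \<equiv> \<Pi>\<^sub>M (n, z)\<in>UNIV. measure_pmf (jump \<epsilon> k z)"

definition step_prob :: "real \<Rightarrow> nat \<Rightarrow> vertex \<Rightarrow> nat \<Rightarrow> vertex \<Rightarrow> real" where
  "step_prob \<epsilon> k x n y = measure (jump_space \<epsilon> k) {\<xi> \<in> space (jump_space \<epsilon> k). jump_chain x \<xi> n = y}"

lemma sets_jump_chain: "{\<xi> \<in> space (jump_space \<epsilon> k). jump_chain x \<xi> n = y} \<in> sets (jump_space \<epsilon> k)"
proof -
  have "(\<lambda>\<xi>. jump_chain x \<xi> n) \<in> jump_space \<epsilon> k \<rightarrow>\<^sub>M count_space UNIV"
    using measurable_compose[OF measurable_jump_chain measurable_component_singleton[of n UNIV]] by simp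
  from measurable_sets[OF this, of "{y}"] show ?thesis
    by (simp add: vimage_def Int_def conj_commute)
qed

lemma jump_chain_cong:
  "(\<And>i z. i < n \<Longrightarrow> \<xi> (i, z) = \<eta> (i, z)) \<Longrightarrow> jump_chain x \<xi> n = jump_chain x \<eta> n"
  by (induction n) auto

text \<open>The first N jumps read only instructions with index below N. Measurability on that
  smaller product is what allows independence of the past to be used.\<close>

lemma jump_chain_measurable_past:
  assumes "n \<le> N"
  shows "(\<lambda>\<xi>. jump_chain x \<xi> n) \<in> (\<Pi>\<^sub>M (n, z)\<in>{..<N} \<times> UNIV. measure_pmf (jump \<epsilon> k z)) \<rightarrow>\<^sub>M count_space UNIV"
  using assms
proof (induction n)
  case (Suc n)
  let ?M = "\<Pi>\<^sub>M (n, z)\<in>{..<N} \<times> UNIV. measure_pmf (jump \<epsilon> k z)"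
  have comp: "(\<lambda>\<xi>. \<xi> (n, z)) \<in> ?M \<rightarrow>\<^sub>M count_space UNIV" for z
    using measurable_component_singleton[of "(n, z)" "{..<N} \<times> UNIV" "\<lambda>(n, z). measure_pmf (jump \<epsilon> k z)"] Suc.prems
    by simp
  have "(\<lambda>\<xi>. jump_chain x \<xi> n) \<in> ?M \<rightarrow>\<^sub>M count_space UNIV" using Suc by simp
  then show ?case
    unfolding jump_chain.simps by (rule measurable_compose_countable[OF comp])
qed simp

text \<open>The position after n jumps is a function of the instructions with index below n, and
  these are independent of the instruction (n, z).\<close>

lemma markov_step:
  "measure (jump_space \<epsilon> k) {\<xi> \<in> space (jump_space \<epsilon> k). jump_chain x \<xi> n = z \<and> \<xi> (n, z) = y}
    = step_prob \<epsilon> k x n z * pmf (jump \<epsilon> k z) y"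
proof -
  interpret product_prob_space "\<lambda>(n::nat, z). measure_pmf (jump \<epsilon> k z)" UNIV
    by (auto simp: product_prob_space_def product_prob_space_axioms_def product_sigma_finite_def
        measure_pmf.prob_space_axioms prob_space_imp_sigma_finite split: prod.split)
  let ?M' = "\<lambda>(n::nat, z). measure_pmf (jump \<epsilon> k z)" and ?J = "jump_space \<epsilon> k"
  let ?A = "{..<n} \<times> (UNIV :: vertex set)" and ?B = "{n} \<times> (UNIV :: vertex set)"
  have ind: "P.indep_var (PiM ?A ?M') (\<lambda>\<omega>. restrict (\<lambda>i. \<omega> i) ?A) (PiM ?B ?M') (\<lambda>\<omega>. restrict (\<lambda>i. \<omega> i) ?B)"
    by (rule P.indep_var_restrict[OF indep_vars_components]) auto
  let ?Xa = "{\<xi> \<in> space (PiM ?A ?M'). jump_chain x \<xi> n = z}"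
  let ?Xb = "{\<xi> \<in> space (PiM ?B ?M'). \<xi> (n, z) = y}"
  have Xa: "?Xa \<in> sets (PiM ?A ?M')"
    using measurable_sets[OF jump_chain_measurable_past[of n n x \<epsilon> k], of "{z}"]
    by (simp add: vimage_def Int_def conj_commute)
  have Xb: "?Xb \<in> sets (PiM ?B ?M')"
    using measurable_sets[OF measurable_component_singleton[of "(n, z)" ?B ?M'], of "{y}"]
    by (simp add: vimage_def Int_def conj_commute)
  have chain: "jump_chain x (restrict \<xi> ?A) n = jump_chain x \<xi> n" for \<xi>
    by (rule jump_chain_cong) auto
  have sp: "restrict \<xi> C \<in> space (PiM C ?M')" for \<xi> C
    by (auto simp: space_PiM PiE_def split: prod.split)
  have "measure ?J {\<xi> \<in> space ?J. jump_chain x \<xi> n = z \<and> \<xi> (n, z) = y}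
      = measure ?J ((\<lambda>\<omega>. (restrict (\<lambda>i. \<omega> i) ?A, restrict (\<lambda>i. \<omega> i) ?B)) -` (?Xa \<times> ?Xb) \<inter> space ?J)"
    by (rule arg_cong[where f = "measure ?J"]) (use sp in \<open>auto simp: chain\<close>)
  also have "\<dots> = measure ?J ((\<lambda>\<omega>. restrict (\<lambda>i. \<omega> i) ?A) -` ?Xa \<inter> space ?J)
      * measure ?J ((\<lambda>\<omega>. restrict (\<lambda>i. \<omega> i) ?B) -` ?Xb \<inter> space ?J)"
    by (rule P.indep_varD[OF ind Xa Xb])
  also have "(\<lambda>\<omega>. restrict (\<lambda>i. \<omega> i) ?A) -` ?Xa \<inter> space ?J = {\<xi> \<in> space ?J. jump_chain x \<xi> n = z}"
    using sp by (auto simp: chain)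
  also have "(\<lambda>\<omega>. restrict (\<lambda>i. \<omega> i) ?B) -` ?Xb \<inter> space ?J = (\<lambda>\<omega>. \<omega> (n, z)) -` {y} \<inter> space ?J"
    using sp by auto
  also have "measure ?J \<dots> = measure (distr ?J (?M' (n, z)) (\<lambda>\<omega>. \<omega> (n, z))) {y}"
    by (subst measure_distr) (auto simp: measurable_component_singleton[of "(n, z)" UNIV ?M', simplified])
  also have "\<dots> = pmf (jump \<epsilon> k z) y"
    using PiM_component[of "(n, z)"] by (simp add: pmf.rep_eq)
  finally show ?thesis by (simp add: step_prob_def)
qed

lemma step_prob_0: "step_prob \<epsilon> k x 0 y = (if y = x then 1 else 0)"
proof -
  interpret prob_space "jump_space \<epsilon> k"
    by (rule prob_space_PiM) (auto simp: measure_pmf.prob_space_axioms split: prod.split)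
  show ?thesis by (auto simp: step_prob_def prob_space)
qed

text \<open>The two claims depend on each other. The recursion requires that no mass sits outside
  \<open>vertices\<close>, where \<open>jump\<close> is unspecified; that in turn follows by
  induction from the recursion.\<close>

lemma step_prob_Suc:
  assumes x: "x \<in> vertices \<epsilon> k"
  shows "step_prob \<epsilon> k x (Suc n) y = (\<Sum>z | adj \<epsilon> k y z. step_prob \<epsilon> k x n z * jump_prob \<epsilon> k z y)"
    and "y \<notin> vertices \<epsilon> k \<Longrightarrow> step_prob \<epsilon> k x n y = 0"
proof -
  interpret J: prob_space "jump_space \<epsilon> k"
    by (rule prob_space_PiM) (auto simp: measure_pmf.prob_space_axioms split: prod.split)
  let ?J = "jump_space \<epsilon> k"
  define E where "E n y z = {\<xi> \<in> space ?J. jump_chain x \<xi> n = z \<and> \<xi> (n, z) = y}" for n y z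
  have E: "E n y z \<in> sets ?J" for n y z
  proof -
    have "E n y z = {\<xi> \<in> space ?J. jump_chain x \<xi> n = z} \<inter> {\<xi> \<in> space ?J. jump_chain z \<xi> 0 = z \<and> \<xi> (n, z) = y}"
      by (auto simp: E_def)
    moreover have "{\<xi> \<in> space ?J. \<xi> (n, z) = y} \<in> sets ?J"
      using measurable_sets[OF measurable_component_singleton[of "(n, z)" UNIV "\<lambda>(n, z). measure_pmf (jump \<epsilon> k z)"], of "{y}"]
      by (simp add: vimage_def Int_def conj_commute)
    ultimately show ?thesis using sets_jump_chain[of \<epsilon> k x n z] by simp
  qed
  have prob_E: "measure ?J (E n y z) = step_prob \<epsilon> k x n z * pmf (jump \<epsilon> k z) y" for n y z
    by (simp add: E_def markov_step)
  have rec: "step_prob \<epsilon> k x (Suc n) y = (\<Sum>z | adj \<epsilon> k y z. step_prob \<epsilon> k x n z * jump_prob \<epsilon> k z y)"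
    if out: "\<And>z. z \<notin> vertices \<epsilon> k \<Longrightarrow> step_prob \<epsilon> k x n z = 0" for n y
  proof -
    define R where "R = {z. adj \<epsilon> k y z}"
    have null: "measure ?J (E n y z) = 0" if "z \<notin> R" for z
    proof (cases "z \<in> vertices \<epsilon> k")
      case True
      have "\<not> adj \<epsilon> k z y" using that adj_sym by (auto simp: R_def)
      then show ?thesis using pmf_jump[OF True] by (simp add: prob_E jump_prob_def)
    qed (use out in \<open>simp add: prob_E\<close>)
    \<comment> \<open>The predecessors outside R are infinitely many but countable, so their null
      events have a null union and only the finite neighbourhood remains.\<close>
    have un: "{\<xi> \<in> space ?J. jump_chain x \<xi> (Suc n) = y} = (\<Union>z\<in>R. E n y z) \<union> (\<Union>z\<in>- R. E n y z)"
      by (auto simp: E_def)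
    have "(\<Union>z\<in>- R. E n y z) \<in> null_sets ?J"
      using null E by (intro null_sets_UN') (auto simp: J.emeasure_eq_measure null_sets_def)
    then have "step_prob \<epsilon> k x (Suc n) y = measure ?J (\<Union>z\<in>R. E n y z)"
      unfolding step_prob_def un using E finite_neighbours[of \<epsilon> k y]
      by (intro measure_Un_null_set sets.finite_UN) (auto simp: R_def)
    also have "\<dots> = (\<Sum>z\<in>R. measure ?J (E n y z))"
      using E finite_neighbours[of \<epsilon> k y]
      by (intro J.finite_measure_finite_Union) (auto simp: R_def disjoint_family_on_def E_def)
    also have "\<dots> = (\<Sum>z\<in>R. step_prob \<epsilon> k x n z * jump_prob \<epsilon> k z y)"
      using pmf_jump[OF adj_in_vertices[OF adj_sym]] by (intro sum.cong) (auto simp: prob_E R_def)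
    finally show ?thesis by (simp add: R_def)
  qed
  have out: "y \<notin> vertices \<epsilon> k \<Longrightarrow> step_prob \<epsilon> k x n y = 0" for n y
  proof (induction n arbitrary: y)
    case 0
    then show ?case using x by (auto simp: step_prob_0)
  next
    case (Suc n)
    then have "\<not> adj \<epsilon> k y z" for z using adj_in_vertices by blast
    then show ?case by (subst rec[OF Suc.IH]) (auto intro: sum.neutral)
  qed
  show "step_prob \<epsilon> k x (Suc n) y = (\<Sum>z | adj \<epsilon> k y z. step_prob \<epsilon> k x n z * jump_prob \<epsilon> k z y)"
    by (rule rec) (rule out)
  show "y \<notin> vertices \<epsilon> k \<Longrightarrow> step_prob \<epsilon> k x n y = 0" by (rule out)
qed

section \<open>The Poisson clock\<close>

abbreviation clock_space :: "real \<Rightarrow> (nat \<Rightarrow> real) measure" where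
  "clock_space l \<equiv> \<Pi>\<^sub>M n\<in>UNIV. density lborel (exponential_density l)"

lemma partial_sums_erlang:
  assumes l: "l > 0"
  shows "distributed (clock_space l) lborel (\<lambda>\<tau>. \<Sum>i\<le>n. \<tau> i) (erlang_density n l)"
proof -
  interpret product_prob_space "\<lambda>_::nat. density lborel (exponential_density l)" UNIV
    using l by (auto simp: product_prob_space_def product_prob_space_axioms_def product_sigma_finite_def
        prob_space_exponential_density prob_space_imp_sigma_finite)
  have "distributed (clock_space l) lborel (\<lambda>\<tau>. \<Sum>i\<in>{..n}. \<tau> i) (erlang_density (card {..n} - 1) l)"
  proof (rule P.exponential_distributed_sum)
    show "P.indep_vars (\<lambda>i. borel) (\<lambda>i \<tau>. \<tau> i) {..n}"
    proof -
      have "P.indep_vars (\<lambda>_. density lborel (exponential_density l)) (\<lambda>i \<tau>. \<tau> i) {..n}"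
        by (rule P.indep_vars_subset[OF indep_vars_components]) auto
      then have "P.indep_vars (\<lambda>i. borel) (\<lambda>i \<tau>. id (\<tau> i)) {..n}"
        by (rule P.indep_vars_compose2) auto
      then show ?thesis by simp
    qed
    fix i
    have "distr (clock_space l) (density lborel (exponential_density l)) (\<lambda>\<tau>. \<tau> i) = density lborel (exponential_density l)"
      by (rule PiM_component) simp
    then have "distr (clock_space l) lborel (\<lambda>\<tau>. \<tau> i) = density lborel (exponential_density l)"
      by (simp cong: distr_cong)
    moreover have "(\<lambda>\<tau>. \<tau> i) \<in> measurable (clock_space l) lborel"
      using measurable_component_singleton[of i UNIV "\<lambda>_. density lborel (exponential_density l)"] by simp
    ultimately show "distributed (clock_space l) lborel (\<lambda>\<tau>. \<tau> i) (exponential_density l)"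
      by (simp add: distributed_def)
  qed (use l in auto)
  then show ?thesis by simp
qed

text \<open>Up to a null set, exactly n jumps means that the sum of n + 1 holding times exceeds t
  but the sum of n does not. The difference of the two Erlang tails is the Poisson weight.\<close>

lemma num_jumps_le_poisson:
  assumes l: "l > 0" and t: "t \<ge> 0"
  shows "measure (clock_space l) {\<tau> \<in> space (clock_space l). num_jumps \<tau> t = n}
    \<le> exp (- l * t) * (l * t) ^ n / fact n"
proof -
  interpret prob_space "clock_space l"
    using l by (intro prob_space_PiM prob_space_exponential_density)
  let ?H = "clock_space l"
  define D where "D n = {\<tau> \<in> space ?H. t < (\<Sum>i\<le>n. \<tau> i)}" for n
  have D: "D n \<in> sets ?H" for n
  proof -
    have "(\<lambda>\<tau>. \<Sum>i\<le>n. \<tau> i) \<in> borel_measurable ?H"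
      using distributed_measurable[OF partial_sums_erlang[OF l, of n]] by simp
    then show ?thesis unfolding D_def by measurable
  qed
  have prob_D: "prob (D n) = (\<Sum>i\<le>n. (l * t) ^ i * exp (- l * t) / fact i)" for n
    using erlang_distributed_gt[OF partial_sums_erlang[OF l] l t, of n] t
    by (simp add: D_def erlang_CDF_def)
  \<comment> \<open>On Z the clock never passes t, and \<open>num_jumps\<close> is an arbitrary
    \<open>LEAST\<close>. Z is null because the Poisson weights sum to 1.\<close>
  define Z where "Z = (\<Inter>n. space ?H - D n)"
  have Z: "Z \<in> sets ?H" using D by (auto simp: Z_def)
  have prob_Z: "prob Z = 0"
  proof -
    have "(\<lambda>i. (l * t) ^ i * exp (- l * t) / fact i) sums (exp (l * t) * exp (- l * t))"
      using sums_mult2[OF exp_converges[of "l * t"], of "exp (- l * t)"] by (simp add: divide_inverse mult_ac)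
    then have "(\<lambda>n. prob (D n)) \<longlonglongrightarrow> 1"
      unfolding prob_D sums_def_le by (simp add: exp_minus)
    then have "(\<lambda>n. 1 - prob (D n)) \<longlonglongrightarrow> 1 - 1" by (intro tendsto_diff tendsto_const)
    moreover have "prob Z \<le> 1 - prob (D n)" for n
    proof -
      have "prob Z \<le> prob (space ?H - D n)" using D by (intro finite_measure_mono) (auto simp: Z_def)
      then show ?thesis using D[of n] by (simp add: prob_compl)
    qed
    ultimately have "prob Z \<le> 1 - 1" by (intro LIMSEQ_le_const) auto
    then show ?thesis using measure_nonneg[of ?H Z] by simp
  qed
  define X where "X = {\<tau> \<in> space ?H. num_jumps \<tau> t = n}"
  have Least: "\<tau> \<in> Z \<or> \<tau> \<in> D n \<and> (\<forall>i<n. \<tau> \<notin> D i)" if "\<tau> \<in> X" for \<tau>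
  proof (cases "\<exists>n. t < (\<Sum>i\<le>n. \<tau> i)")
    case True
    then have "t < (\<Sum>i\<le>num_jumps \<tau> t. \<tau> i)" unfolding num_jumps_def by (rule LeastI_ex)
    moreover have "\<not> t < (\<Sum>i\<le>j. \<tau> i)" if "j < num_jumps \<tau> t" for j
      using that unfolding num_jumps_def by (rule not_less_Least)
    ultimately show ?thesis using that by (auto simp: X_def D_def)
  qed (use that in \<open>auto simp: X_def Z_def D_def\<close>)
  have "prob X \<le> (l * t) ^ n * exp (- l * t) / fact n"
  proof (cases n)
    case 0
    have "prob X \<le> prob (D 0 \<union> Z)" using Least D Z 0 by (intro finite_measure_mono) auto
    also have "\<dots> \<le> prob (D 0) + prob Z" using D Z by (intro measure_Un_le) auto
    finally show ?thesis using 0 by (simp add: prob_Z prob_D)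
  next
    case (Suc j)
    have "prob X \<le> prob ((D n - D j) \<union> Z)" using Least D Z Suc by (intro finite_measure_mono) auto
    also have "\<dots> \<le> prob (D n - D j) + prob Z" using D Z by (intro measure_Un_le) auto
    also have "prob (D n - D j) = prob (D n) - prob (D n \<inter> D j)"
      using D by (intro finite_measure_Diff')
    \<comment> \<open>Holding times are nonnegative only almost surely, so D j is contained in D n
      up to a null set.\<close>
    also have "prob (D n \<inter> D j) = prob (D j)"
    proof (rule finite_measure_eq_AE)
      have "AE \<tau> in ?H. 0 \<le> \<tau> n"
        using l by (intro AE_PiM_component prob_space_exponential_density)
          (auto simp: AE_density exponential_density_def)
      then show "AE \<tau> in ?H. \<tau> \<in> D n \<inter> D j \<longleftrightarrow> \<tau> \<in> D j"
        by eventually_elim (auto simp: D_def Suc)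
    qed (use D in auto)
    finally show ?thesis using Suc by (simp add: prob_Z prob_D)
  qed
  then show ?thesis by (simp add: X_def mult.commute)
qed

text \<open>Jump instructions and holding times live on separate factors, so the law of the chain is
  a series of products over the number of jumps. Bounding all partial sums suffices, and each of
  them involves only finitely many vertices.\<close>

lemma chain_prob_le:
  assumes t: "t \<ge> 0"
    and le: "\<And>N. (\<Sum>n<N. exp (- (2 ^ (2 * k)) * t) * (2 ^ (2 * k) * t) ^ n / fact n * step_prob \<epsilon> k x n y) \<le> b"
  shows "measure (chain_space \<epsilon> k) {\<omega> \<in> space (chain_space \<epsilon> k). chain x t \<omega> = y} \<le> b"
proof -
  interpret J: prob_space "jump_space \<epsilon> k"
    by (rule prob_space_PiM) (auto simp: measure_pmf.prob_space_axioms split: prod.split)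
  interpret H: prob_space "clock_space (2 ^ (2 * k))"
    by (intro prob_space_PiM prob_space_exponential_density) simp
  interpret C: prob_space "chain_space \<epsilon> k" by (rule prob_space_chain_space)
  let ?J = "jump_space \<epsilon> k" and ?H = "clock_space (2 ^ (2 * k))"
  define A where "A n = {\<xi> \<in> space ?J. jump_chain x \<xi> n = y}" for n
  define B where "B n = {\<tau> \<in> space ?H. num_jumps \<tau> t = n}" for n
  have A: "A n \<in> sets ?J" for n unfolding A_def by (rule sets_jump_chain)
  have B: "B n \<in> sets ?H" for n
    using measurable_sets[OF measurable_num_jumps[of t k], of "{n}"]
    by (simp add: B_def vimage_def Int_def conj_commute)
  have AB: "measure (chain_space \<epsilon> k) (A n \<times> B n) = measure ?J (A n) * measure ?H (B n)" for n
    unfolding measure_def chain_space_def by (simp add: H.emeasure_pair_measure_Times[OF A B] enn2real_mult)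
  have "(\<lambda>n. measure (chain_space \<epsilon> k) (A n \<times> B n)) sums measure (chain_space \<epsilon> k) (\<Union>n. A n \<times> B n)"
  proof (rule C.finite_measure_UNION)
    show "range (\<lambda>n. A n \<times> B n) \<subseteq> sets (chain_space \<epsilon> k)"
      using A B by (auto simp: chain_space_def)
    show "disjoint_family (\<lambda>n. A n \<times> B n)" by (auto simp: disjoint_family_on_def B_def)
  qed
  also have "(\<Union>n. A n \<times> B n) = {\<omega> \<in> space (chain_space \<epsilon> k). chain x t \<omega> = y}"
    by (auto simp: A_def B_def chain_space_def space_pair_measure chain_def)
  finally have sums: "(\<lambda>n. measure ?J (A n) * measure ?H (B n)) sums
      measure (chain_space \<epsilon> k) {\<omega> \<in> space (chain_space \<epsilon> k). chain x t \<omega> = y}"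
    by (simp only: AB)
  have "(\<Sum>n<N. measure ?J (A n) * measure ?H (B n)) \<le> b" for N
  proof -
    have "(\<Sum>n<N. measure ?J (A n) * measure ?H (B n))
        \<le> (\<Sum>n<N. exp (- (2 ^ (2 * k)) * t) * (2 ^ (2 * k) * t) ^ n / fact n * step_prob \<epsilon> k x n y)"
    proof (rule sum_mono)
      fix n
      have "measure ?J (A n) * measure ?H (B n) \<le> measure ?J (A n) * (exp (- (2 ^ (2 * k)) * t) * (2 ^ (2 * k) * t) ^ n / fact n)"
        unfolding B_def using t by (intro mult_left_mono num_jumps_le_poisson) auto
      then show "measure ?J (A n) * measure ?H (B n)
          \<le> exp (- (2 ^ (2 * k)) * t) * (2 ^ (2 * k) * t) ^ n / fact n * step_prob \<epsilon> k x n y"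
        by (simp add: A_def step_prob_def mult.commute)
    qed
    then show ?thesis using le[of N] by (rule order_trans)
  qed
  with sums show ?thesis unfolding sums_def by (intro LIMSEQ_le_const2) auto
qed

section \<open>Off-diagonal bounds\<close>

definition hops :: "real \<Rightarrow> nat \<Rightarrow> vertex \<Rightarrow> vertex \<Rightarrow> nat" where
  "hops \<epsilon> k x y = (LEAST n. (x, y) \<in> {(a, b). adj \<epsilon> k a b} ^^ n)"

lemma hops_self: "hops \<epsilon> k x x = 0"
  unfolding hops_def by (rule Least_equality) auto

text \<open>If \<open>y\<close> is not reachable from \<open>x\<close> then neither is \<open>z\<close>, and both values are the same junk \<open>LEAST\<close>; so
  \<open>hops\<close> is Lipschitz without a proof that the graph is connected.\<close>

lemma hops_adj_le:
  assumes "adj \<epsilon> k y z"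
  shows "hops \<epsilon> k x z \<le> Suc (hops \<epsilon> k x y)"
proof (cases "\<exists>n. (x, y) \<in> {(a, b). adj \<epsilon> k a b} ^^ n")
  case True
  then have "(x, y) \<in> {(a, b). adj \<epsilon> k a b} ^^ hops \<epsilon> k x y"
    unfolding hops_def by (rule LeastI_ex)
  then have "(x, z) \<in> {(a, b). adj \<epsilon> k a b} ^^ Suc (hops \<epsilon> k x y)"
    using assms by (auto intro: relpow_Suc_I)
  then show ?thesis unfolding hops_def[of \<epsilon> k x z] by (rule Least_le)
next
  case False
  have "\<not> (\<exists>n. (x, z) \<in> {(a, b). adj \<epsilon> k a b} ^^ n)"
  proof
    assume "\<exists>n. (x, z) \<in> {(a, b). adj \<epsilon> k a b} ^^ n"
    then obtain n where "(x, z) \<in> {(a, b). adj \<epsilon> k a b} ^^ n" by blast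
    then have "(x, y) \<in> {(a, b). adj \<epsilon> k a b} ^^ Suc n"
      using adj_sym[OF assms] by (auto intro: relpow_Suc_I)
    then show False using False by blast
  qed
  then have "hops \<epsilon> k x z = hops \<epsilon> k x y" using False by (simp add: hops_def)
  then show ?thesis by simp
qed

section \<open>Balls and comparison with the killed chain\<close>

primrec reach :: "real \<Rightarrow> nat \<Rightarrow> vertex \<Rightarrow> nat \<Rightarrow> vertex set" where
  "reach \<epsilon> k x 0 = {x}"
| "reach \<epsilon> k x (Suc n) = reach \<epsilon> k x n \<union> (\<Union>z\<in>reach \<epsilon> k x n. {y. adj \<epsilon> k z y})"

lemma finite_reach: "finite (reach \<epsilon> k x n)"
  by (induction n) (auto simp: finite_neighbours)

lemma reach_vertices: "x \<in> vertices \<epsilon> k \<Longrightarrow> reach \<epsilon> k x n \<subseteq> vertices \<epsilon> k"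
  by (induction n) (auto dest: adj_sym adj_in_vertices)

lemma reach_mono: "n \<le> N \<Longrightarrow> reach \<epsilon> k x n \<subseteq> reach \<epsilon> k x N"
  by (rule lift_Suc_mono_le[where f = "reach \<epsilon> k x"]) auto

lemma step_prob_reach:
  assumes "x \<in> vertices \<epsilon> k"
  shows "y \<notin> reach \<epsilon> k x n \<Longrightarrow> step_prob \<epsilon> k x n y = 0"
proof (induction n arbitrary: y)
  case (Suc n)
  have "step_prob \<epsilon> k x n z = 0" if "adj \<epsilon> k y z" for z
    using Suc.prems adj_sym[OF that] by (intro Suc.IH) auto
  then show ?case by (simp add: step_prob_Suc[OF assms])
qed (auto simp: step_prob_0)

text \<open>In at most N steps the chain cannot leave the ball of radius N around x, so killing
  outside the ball is not felt and the powers of \<open>avg\<close> give the exact density.\<close>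

lemma step_prob_avg:
  fixes N :: nat
  assumes x: "x \<in> vertices \<epsilon> k"
  defines "V \<equiv> reach \<epsilon> k x N"
  defines "g \<equiv> \<lambda>z. if z = x then 1 / mass \<epsilon> k x else 0"
  shows "n \<le> N \<Longrightarrow> z \<in> V \<Longrightarrow>
    (killed_network.avg V (conductance \<epsilon> k) (mass \<epsilon> k) ^^ n) g z
      = (2 ^ (2 * k)) ^ n * step_prob \<epsilon> k x n z / mass \<epsilon> k z"
proof (induction n arbitrary: z)
  case 0
  then show ?case by (simp add: g_def step_prob_0)
next
  case (Suc n)
  interpret killed_graph \<epsilon> k V
    by unfold_locales (auto simp: V_def finite_reach intro: subsetD[OF reach_vertices[OF x]])
  define L where "L = (2::real) ^ (2 * k)"
  have zV: "z \<in> vertices \<epsilon> k" using Suc.prems sub by auto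
  have "(\<Sum>w\<in>V. conductance \<epsilon> k z w * (avg ^^ n) g w)
      = (\<Sum>w\<in>V. L ^ Suc n * (step_prob \<epsilon> k x n w * jump_prob \<epsilon> k w z))"
  proof (rule sum.cong[OF refl])
    fix w assume w: "w \<in> V"
    then have mw: "mass \<epsilon> k w > 0" by (rule m_pos)
    \<comment> \<open>By symmetry the conductance is read as a jump from w to z; this turns the
      action of \<open>avg\<close> into the forward recursion for \<open>step_prob\<close>.\<close>
    have "conductance \<epsilon> k z w = L * mass \<epsilon> k w * jump_prob \<epsilon> k w z"
      unfolding L_def mass_jump_prob by (rule conductance_sym)
    moreover have "(avg ^^ n) g w = L ^ n * step_prob \<epsilon> k x n w / mass \<epsilon> k w"
      using Suc.IH[of w] Suc.prems w by (simp add: L_def)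
    ultimately show "conductance \<epsilon> k z w * (avg ^^ n) g w = L ^ Suc n * (step_prob \<epsilon> k x n w * jump_prob \<epsilon> k w z)"
      using mw by simp
  qed
  also have "\<dots> = L ^ Suc n * (\<Sum>w\<in>V. step_prob \<epsilon> k x n w * jump_prob \<epsilon> k w z)"
    by (simp add: sum_distrib_left)
  also have "(\<Sum>w\<in>V. step_prob \<epsilon> k x n w * jump_prob \<epsilon> k w z)
      = (\<Sum>w\<in>V \<inter> {w. adj \<epsilon> k z w}. step_prob \<epsilon> k x n w * jump_prob \<epsilon> k w z)"
    using fin adj_sym by (intro sum.mono_neutral_right) (auto simp: jump_prob_def)
  also have "\<dots> = (\<Sum>w | adj \<epsilon> k z w. step_prob \<epsilon> k x n w * jump_prob \<epsilon> k w z)"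
  proof (rule sum.mono_neutral_left[OF finite_neighbours])
    have "reach \<epsilon> k x n \<subseteq> V" unfolding V_def using Suc.prems by (intro reach_mono) auto
    then show "\<forall>w\<in>{w. adj \<epsilon> k z w} - V \<inter> {w. adj \<epsilon> k z w}. step_prob \<epsilon> k x n w * jump_prob \<epsilon> k w z = 0"
      using step_prob_reach[OF x] by auto
  qed auto
  also have "\<dots> = step_prob \<epsilon> k x (Suc n) z" by (rule step_prob_Suc[OF x, symmetric])
  finally show ?case by (simp add: avg_def[of "(avg ^^ n) g"] L_def)
qed

section \<open>Choice of the tilt and the two regimes\<close>

text \<open>Convexity gives sinh \<sigma> \<le> \<sigma> sinh 1, and sinh 1 \<le> 6/5, so the
  constant is 36/5 \<le> 8. The value 8 is the one that leads to 32 in the Gaussian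
  exponent.\<close>

lemma sinh_square_bound:
  fixes \<sigma> :: real
  assumes "0 \<le> \<sigma>" "\<sigma> \<le> 1"
  shows "5 * (sinh \<sigma>)\<^sup>2 \<le> 8 * \<sigma>\<^sup>2"
proof -
  have "convex_on {0..} (sinh :: real \<Rightarrow> real)"
  proof (rule f''_ge0_imp_convex)
    show "(sinh has_real_derivative cosh x) (at x)" for x :: real
      by (auto intro!: derivative_eq_intros)
    show "(cosh has_real_derivative sinh x) (at x)" for x :: real
      by (auto intro!: derivative_eq_intros)
  qed auto
  then have "sinh ((1 - \<sigma>) *\<^sub>R 0 + \<sigma> *\<^sub>R 1) \<le> (1 - \<sigma>) * sinh 0 + \<sigma> * sinh 1"
    by (rule convex_onD) (use assms in auto)
  then have 1: "sinh \<sigma> \<le> \<sigma> * sinh 1" by simp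
  have "sinh (1::real) \<le> 6 / 5"
  proof -
    have e: "exp (1::real) < 272 / 100" using e_less_272 by simp
    have "100 / 272 < inverse (exp (1::real))"
      using less_imp_inverse_less[OF e] by simp
    then show ?thesis using e by (simp add: sinh_def exp_minus)
  qed
  then have "\<sigma> * sinh 1 \<le> \<sigma> * (6 / 5)" using assms by (intro mult_left_mono)
  then have "(sinh \<sigma>)\<^sup>2 \<le> (\<sigma> * (6 / 5))\<^sup>2" using 1 assms by (intro power_mono) auto
  then have "5 * (sinh \<sigma>)\<^sup>2 \<le> 36 / 5 * \<sigma>\<^sup>2" by (simp add: power_mult_distrib power2_eq_square)
  also have "\<dots> \<le> 8 * \<sigma>\<^sup>2" by (rule mult_right_mono) auto
  finally show ?thesis .
qed

text \<open>Each partial sum of the Poisson series is bounded through the kernel killed outside a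
  ball, tilted by \<sigma> times the number of edges from x. The constant 20480 = 32 * 640 does not
  depend on the ball, so it survives the limit.\<close>

lemma trans_density_tilted:
  assumes x: "x \<in> vertices \<epsilon> k" and y: "y \<in> vertices \<epsilon> k" and t: "t > 0" and \<sigma>: "0 \<le> \<sigma>" "\<sigma> \<le> 1"
  shows "trans_density \<epsilon> k t x y
    \<le> 20480 * max (1 / t) (1 / sqrt t) * exp (8 * \<sigma>\<^sup>2 * 2 ^ (2 * k) * t - \<sigma> * real (hops \<epsilon> k x y))"
proof -
  define L where "L = (2::real) ^ (2 * k)"
  define b where "b = 20480 * max (1 / t) (1 / sqrt t) * exp (8 * \<sigma>\<^sup>2 * L * t - \<sigma> * real (hops \<epsilon> k x y))"
  have my: "mass \<epsilon> k y > 0" using y by (rule mass_pos)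
  have L: "L > 0" by (simp add: L_def)
  have b0: "b \<ge> 0" using t by (simp add: b_def le_max_iff_disj)
  have "measure (chain_space \<epsilon> k) {\<omega> \<in> space (chain_space \<epsilon> k). chain x t \<omega> = y} \<le> mass \<epsilon> k y * b"
  proof (rule chain_prob_le)
    fix N
    define V where "V = reach \<epsilon> k x N"
    define g where "g z = (if z = x then 1 / mass \<epsilon> k x else 0)" for z
    define \<psi> where "\<psi> z = \<sigma> * real (hops \<epsilon> k x z)" for z
    interpret killed_graph \<epsilon> k V
      by unfold_locales (auto simp: V_def finite_reach intro: subsetD[OF reach_vertices[OF x]])
    have xV: "x \<in> V" unfolding V_def using reach_mono[of 0 N \<epsilon> k x] by auto
    show "(\<Sum>n<N. exp (- (2 ^ (2 * k)) * t) * (2 ^ (2 * k) * t) ^ n / fact n * step_prob \<epsilon> k x n y) \<le> mass \<epsilon> k y * b"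
    proof (cases "y \<in> V")
      case True
      have g0: "g z \<ge> 0" if "z \<in> V" for z using mass_pos[OF x] by (simp add: g_def)
      have avg_n: "(avg ^^ n) g y = L ^ n * step_prob \<epsilon> k x n y / mass \<epsilon> k y" if "n < N" for n
        using step_prob_avg[OF x, of n N y] that True by (simp add: V_def g_def[abs_def] L_def)
      have fl: "flow g t y = exp (- L * t) * (\<Sum>n. (avg ^^ n) g y / fact n * t ^ n)"
        by (simp add: flow_def L_def)
      have "(\<Sum>n<N. exp (- L * t) * (L * t) ^ n / fact n * step_prob \<epsilon> k x n y)
          = mass \<epsilon> k y * (exp (- L * t) * (\<Sum>n<N. (avg ^^ n) g y / fact n * t ^ n))"
        using my by (simp add: avg_n sum_distrib_left power_mult_distrib mult_ac)
      \<comment> \<open>The remaining terms of the series are nonnegative, so the full killed kernel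
        dominates its first N terms.\<close>
      also have "\<dots> \<le> mass \<epsilon> k y * flow g t y"
        unfolding fl using my t avg_pow_nonneg[OF g0 True]
        by (intro mult_left_mono sum_le_suminf flow_series_summable True) auto
      also have "\<dots> \<le> mass \<epsilon> k y * b"
      proof (intro mult_left_mono)
        have lip: "lipschitz_weight \<sigma> \<psi>"
          unfolding lipschitz_weight_def
        proof (intro ballI impI)
          fix z w assume "conductance \<epsilon> k z w \<noteq> 0"
          then have zw: "adj \<epsilon> k z w" by (auto simp: conductance_def split: if_splits)
          have "\<bar>real (hops \<epsilon> k x z) - real (hops \<epsilon> k x w)\<bar> \<le> 1"
            using hops_adj_le[OF zw, of x] hops_adj_le[OF adj_sym[OF zw], of x] by linarith
          then have "\<sigma> * \<bar>real (hops \<epsilon> k x z) - real (hops \<epsilon> k x w)\<bar> \<le> \<sigma> * 1"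
            using \<sigma>(1) by (rule mult_left_mono)
          then show "\<bar>\<psi> z - \<psi> w\<bar> \<le> \<sigma>"
            using \<sigma>(1) by (simp add: \<psi>_def abs_mult flip: right_diff_distrib)
        qed
        have "exp (\<psi> y) * flow g t y \<le> 32 * 640 * max (1 / t) (1 / sqrt t) * exp (5 * (sinh \<sigma>)\<^sup>2 * L * t)"
          unfolding L_def
          by (rule tilted_kernel_bound[OF flow_heat_sol _ t lip xV _ True])
            (use g0 in \<open>auto simp: flow_0 g_def \<psi>_def hops_self\<close>)
        also have "\<dots> \<le> 32 * 640 * max (1 / t) (1 / sqrt t) * exp (8 * \<sigma>\<^sup>2 * L * t)"
        proof -
          have "5 * (sinh \<sigma>)\<^sup>2 * (L * t) \<le> 8 * \<sigma>\<^sup>2 * (L * t)"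
            using sinh_square_bound[OF \<sigma>] L t by (intro mult_right_mono) auto
          then show ?thesis using t by (intro mult_left_mono) (auto simp: le_max_iff_disj mult.assoc)
        qed
        finally have "exp (- \<psi> y) * (exp (\<psi> y) * flow g t y)
            \<le> exp (- \<psi> y) * (32 * 640 * max (1 / t) (1 / sqrt t) * exp (8 * \<sigma>\<^sup>2 * L * t))"
          by (rule mult_left_mono) simp
        then show "flow g t y \<le> b"
          by (simp add: b_def \<psi>_def exp_diff exp_minus field_simps)
      qed (use my in simp)
      finally show ?thesis by (simp add: L_def)
    next
      case False
      have "step_prob \<epsilon> k x n y = 0" if "n < N" for n
        using False reach_mono[of n N \<epsilon> k x] that by (intro step_prob_reach[OF x]) (auto simp: V_def)
      then show ?thesis using my b0 by simp
    qed
  qed (use t in simp)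
  then show ?thesis using my by (simp add: trans_density_def b_def L_def field_simps)
qed

theorem corollary3p4:
  fixes \<epsilon> :: real and k0 :: nat
  assumes "0 < \<epsilon>" and "\<epsilon> < 1 / 64"
    and "\<forall>k\<ge>k0. 1 / 2 ^ k < \<epsilon> / 4"
  shows "(\<exists>C3>0. \<forall>k\<ge>k0. \<forall>x\<in>vertices \<epsilon> k. \<forall>y\<in>vertices \<epsilon> k. \<forall>t>0.
            (graph_dist \<epsilon> k x y \<le> 16 * 2 ^ k * t \<longrightarrow>
               trans_density \<epsilon> k t x y
                 \<le> C3 * max (1 / t) (1 / sqrt t) * exp (- (graph_dist \<epsilon> k x y)\<^sup>2 / (32 * t))) \<and>
            (graph_dist \<epsilon> k x y \<ge> 16 * 2 ^ k * t \<longrightarrow>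
               trans_density \<epsilon> k t x y
                 \<le> C3 * max (1 / t) (1 / sqrt t) * exp (- (2 ^ k * graph_dist \<epsilon> k x y / 2)))) \<and>
         (\<forall>T>0. \<exists>C4>0. \<forall>k\<ge>k0. \<forall>t\<in>{0<..T}. \<forall>x\<in>vertices \<epsilon> k. \<forall>y\<in>vertices \<epsilon> k.
            trans_density \<epsilon> k t x y
              \<le> C4 / t * (exp (- (graph_dist \<epsilon> k x y)\<^sup>2 / (32 * t))
                        + exp (- (2 ^ k * graph_dist \<epsilon> k x y / 2))))"
proof -
  have gd: "graph_dist \<epsilon> k x y = real (hops \<epsilon> k x y) / 2 ^ k" for k x y
    by (simp add: graph_dist_def hops_def)
  have near: "trans_density \<epsilon> k t x y
      \<le> 20480 * max (1 / t) (1 / sqrt t) * exp (- (graph_dist \<epsilon> k x y)\<^sup>2 / (32 * t))"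
    if xy: "x \<in> vertices \<epsilon> k" "y \<in> vertices \<epsilon> k" and t: "t > 0" and d: "graph_dist \<epsilon> k x y \<le> 16 * 2 ^ k * t"
    for k x y t
  proof -
    define h where "h = (2::real) ^ k"
    define d where "d = graph_dist \<epsilon> k x y"
    \<comment> \<open>This \<sigma> minimizes 8 \<sigma>^2 h^2 t - \<sigma> h d, with value -d^2 /
      (32 t). The restriction \<sigma> \<le> 1 is exactly d \<le> 16 h t.\<close>
    define \<sigma> where "\<sigma> = d / (16 * h * t)"
    have h: "h > 0" by (simp add: h_def)
    have d0: "d \<ge> 0" by (simp add: d_def gd)
    have \<sigma>: "0 \<le> \<sigma>" "\<sigma> \<le> 1" using d d0 h t by (auto simp: \<sigma>_def d_def h_def)
    have "(2::real) ^ (2 * k) = h * h" by (simp add: h_def power_mult power2_eq_square flip: power_mult_distrib)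
    then have "8 * \<sigma>\<^sup>2 * 2 ^ (2 * k) * t - \<sigma> * real (hops \<epsilon> k x y) = 8 * \<sigma>\<^sup>2 * (h * h) * t - \<sigma> * (h * d)"
      using h by (simp add: d_def gd h_def)
    also have "\<dots> = - d\<^sup>2 / (32 * t)"
      using h t by (simp add: \<sigma>_def field_simps power2_eq_square)
    finally show ?thesis using trans_density_tilted[OF xy t \<sigma>] by (simp add: d_def)
  qed
  have far: "trans_density \<epsilon> k t x y
      \<le> 20480 * max (1 / t) (1 / sqrt t) * exp (- (2 ^ k * graph_dist \<epsilon> k x y / 2))"
    if xy: "x \<in> vertices \<epsilon> k" "y \<in> vertices \<epsilon> k" and t: "t > 0" and d: "graph_dist \<epsilon> k x y \<ge> 16 * 2 ^ k * t"
    for k x y t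
  proof -
    define h where "h = (2::real) ^ k"
    define d where "d = graph_dist \<epsilon> k x y"
    have h: "h > 0" by (simp add: h_def)
    have "(2::real) ^ (2 * k) = h * h" by (simp add: h_def power_mult power2_eq_square flip: power_mult_distrib)
    \<comment> \<open>Here the minimizer is at least 1, so \<sigma> = 1 is used; 8 h^2 t \<le> h d /
      2 then leaves half of the linear term.\<close>
    then have "8 * 1\<^sup>2 * 2 ^ (2 * k) * t - 1 * real (hops \<epsilon> k x y) = h * (16 * h * t) / 2 - h * d"
      using h by (simp add: d_def gd h_def)
    also have "\<dots> \<le> - (h * d / 2)"
    proof -
      have "h * (16 * h * t) \<le> h * d"
        using that(4) h by (intro mult_left_mono) (auto simp: d_def h_def)
      then show ?thesis by linarith
    qed
    finally have "20480 * max (1 / t) (1 / sqrt t) * exp (8 * 1\<^sup>2 * 2 ^ (2 * k) * t - 1 * real (hops \<epsilon> k x y))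
        \<le> 20480 * max (1 / t) (1 / sqrt t) * exp (- (h * d / 2))"
      using t by (intro mult_left_mono) (auto simp: le_max_iff_disj)
    then show ?thesis using trans_density_tilted[OF xy t, of 1] by (simp add: d_def h_def)
  qed
  show ?thesis
  proof (intro conjI allI impI)
    show "\<exists>C3>0. \<forall>k\<ge>k0. \<forall>x\<in>vertices \<epsilon> k. \<forall>y\<in>vertices \<epsilon> k. \<forall>t>0.
        (graph_dist \<epsilon> k x y \<le> 16 * 2 ^ k * t \<longrightarrow> trans_density \<epsilon> k t x y
           \<le> C3 * max (1 / t) (1 / sqrt t) * exp (- (graph_dist \<epsilon> k x y)\<^sup>2 / (32 * t))) \<and>
        (graph_dist \<epsilon> k x y \<ge> 16 * 2 ^ k * t \<longrightarrow> trans_density \<epsilon> k t x y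
           \<le> C3 * max (1 / t) (1 / sqrt t) * exp (- (2 ^ k * graph_dist \<epsilon> k x y / 2)))"
      using near far by (intro exI[of _ 20480]) auto
    fix T :: real assume T: "T > 0"
    \<comment> \<open>For t \<le> T, 1 / sqrt t = sqrt t / t \<le> sqrt T / t, so this constant
      absorbs both entries of the maximum.\<close>
    define C4 where "C4 = 20480 * max 1 (sqrt T)"
    have "trans_density \<epsilon> k t x y \<le> C4 / t * (exp (- (graph_dist \<epsilon> k x y)\<^sup>2 / (32 * t))
        + exp (- (2 ^ k * graph_dist \<epsilon> k x y / 2)))"
      if xy: "x \<in> vertices \<epsilon> k" "y \<in> vertices \<epsilon> k" and t: "t \<in> {0<..T}" for k t x y
    proof -
      define a where "a = exp (- (graph_dist \<epsilon> k x y)\<^sup>2 / (32 * t))"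
      define b where "b = exp (- (2 ^ k * graph_dist \<epsilon> k x y / 2))"
      have t0: "t > 0" and tT: "t \<le> T" using t by auto
      have "1 / sqrt t = sqrt t / t" using t0 by (simp add: field_simps)
      also have "\<dots> \<le> sqrt T / t" using t0 tT by (intro divide_right_mono) auto
      also have "\<dots> \<le> max 1 (sqrt T) / t" using t0 by (intro divide_right_mono) auto
      finally have "1 / sqrt t \<le> max 1 (sqrt T) / t" .
      moreover have "1 / t \<le> max 1 (sqrt T) / t" using t0 by (intro divide_right_mono) auto
      ultimately have m: "20480 * max (1 / t) (1 / sqrt t) \<le> C4 / t" by (simp add: C4_def)
      have "trans_density \<epsilon> k t x y \<le> 20480 * max (1 / t) (1 / sqrt t) * (a + b)"
      proof (cases "graph_dist \<epsilon> k x y \<le> 16 * 2 ^ k * t")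
        case True
        have "20480 * max (1 / t) (1 / sqrt t) * a \<le> 20480 * max (1 / t) (1 / sqrt t) * (a + b)"
          using t0 by (intro mult_left_mono) (auto simp: b_def le_max_iff_disj)
        then show ?thesis using near[OF xy t0 True] by (simp add: a_def)
      next
        case False
        have "20480 * max (1 / t) (1 / sqrt t) * b \<le> 20480 * max (1 / t) (1 / sqrt t) * (a + b)"
          using t0 by (intro mult_left_mono) (auto simp: a_def le_max_iff_disj)
        then show ?thesis using far[OF xy t0] False by (simp add: b_def)
      qed
      also have "\<dots> \<le> C4 / t * (a + b)" using m by (rule mult_right_mono) (simp add: a_def b_def)
      finally show ?thesis by (simp add: a_def b_def)
    qed
    moreover have "C4 > 0" by (simp add: C4_def less_max_iff_disj)
    ultimately show "\<exists>C4>0. \<forall>k\<ge>k0. \<forall>t\<in>{0<..T}. \<forall>x\<in>vertices \<epsilon> k. \<forall>y\<in>vertices \<epsilon> k.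
        trans_density \<epsilon> k t x y \<le> C4 / t * (exp (- (graph_dist \<epsilon> k x y)\<^sup>2 / (32 * t))
          + exp (- (2 ^ k * graph_dist \<epsilon> k x y / 2)))"
      by blast
  qed
qed

end
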